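(* Let $F:(M^m,g_1)\to(N^n,g_2,J)$ be a Clairaut Lagrangian Riemannian map with $\tilde s=e^{g}$ ($g$ a smooth function on $N$) from a Riemannian manifold $M$ to a Kähler manifold $N$, with $(\mathrm{range}F_* )^\perp$ totally geodesic, such that $\dim(\mathrm{range}F_* )>1$. Then the following statements are true: (i) $\mathrm{range}F_*$ is minimal. (ii) $\mathrm{range}F_*$ is totally geodesic.
   Context: A smooth map $F:(M^m,g_1)\to(N^n,g_2)$ between Riemannian manifolds with $0<\mathrm{rank}F\le\min\{m,n\}$ is a Riemannian map if $g_2(F_*X,F_*Y)=g_1(X,Y)$ for all $X,Y\in\Gamma(\ker F_* )^\perp$. Put $r=\dim\ker F_*$. $\mathrm{range}F_*$ and its orthogonal complement $(\mathrm{range}F_* )^\perp$ are regarded as subbundles of $TN$ (distributions on $N$). The second fundamental form is $(\nabla F_* )(X,Y)=\overset{N}{\nabla^F_X}F_*Y-F_*(\nabla^M_XY)$ ($\overset{N}{\nabla^F}$ the pullback connection). The mean curvature vector field of $\mathrm{range}F_*$ is $H_2=\frac1{m-r}\sum_{j=r+1}^m(\nabla F_* )(X_j,X_j)$, $\{X_j\}$ an orthonormal basis of $(\ker F_* )^\perp$; $\mathrm{range}F_*$ is minimal if $H_2=0$. A distribution $D$ on $N$ is totally geodesic if $\nabla^N_UV\in\Gamma(D)$ for all $U,V\in\Gamma(D)$ ($\nabla^N$ the Levi-Civita connection of $N$). Kähler manifold: $(N,g_2,J)$ with $J^2=-I$, $g_2(JX_1,JY_1)=g_2(X_1,Y_1)$,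 $\nabla^NJ=0$. $F$ is anti-invariant if $J(\mathrm{range}F_{*p})\subset(\mathrm{range}F_{*p})^\perp$ for every $p\in M$; it is Lagrangian if moreover $J(\mathrm{range}F_* )=(\mathrm{range}F_* )^\perp$. $F$ is Clairaut with function $\tilde s:N\to\mathbb R^+$ if for every geodesic $\beta$ on $N$, $(\tilde s\circ\beta)\sin\omega(t)$ is constant, where $\dot\beta(t)=F_*X+V$ with $F_*X\in\Gamma(\mathrm{range}F_* )$ ($X\in\Gamma(\ker F_* )^\perp$) and $V\in\Gamma(\mathrm{range}F_* )^\perp$, and $\omega(t)\in[0,\pi]$ is the angle between $\dot\beta(t)$ and $V$.
   Formalization: Since range F_* is defined only over F(M), it is extended to a smooth distribution on N (used in the Clairaut condition); "totally geodesic", for range F_* in (ii) and for its complement in the hypothesis, is required only at points of F(M), as (ii) fails for such extensions on all of N. *)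

theory Defs
  imports "HOL-Analysis.Analysis"
begin

section \<open>Smooth maps between Euclidean spaces\<close>

text \<open>These two notions are only used on open sets.\<close>

primrec Ck_on :: "nat \<Rightarrow> 'a::euclidean_space set \<Rightarrow> ('a \<Rightarrow> 'b::real_normed_vector) \<Rightarrow> bool" where
  "Ck_on 0 S f \<longleftrightarrow> continuous_on S f"
| "Ck_on (Suc k) S f \<longleftrightarrow>
     (\<forall>x\<in>S. f differentiable (at x)) \<and> (\<forall>v. Ck_on k S (\<lambda>x. frechet_derivative f (at x) v))"

definition smooth_on :: "'a::euclidean_space set \<Rightarrow> ('a \<Rightarrow> 'b::real_normed_vector) \<Rightarrow> bool" where
  "smooth_on S f \<longleftrightarrow> (\<forall>k. Ck_on k S f)"


section \<open>Smooth manifolds and tangent vectors\<close>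

text \<open>
  A manifold is a whole type \<open>'m\<close> (Hausdorff and second countable by its sort) with a smooth
  atlas; \<open>'e\<close> is the model space, so the dimension is \<open>DIM('e)\<close>. Manifolds have no boundary and
  need not be connected. A chart consists of its domain and its coordinate map.
\<close>

type_synonym ('m, 'e) chart = "'m set \<times> ('m \<Rightarrow> 'e)"

definition chart_inv :: "('m, 'e) chart \<Rightarrow> 'e \<Rightarrow> 'm" where
  "chart_inv c = inv_into (fst c) (snd c)"

definition is_chart :: "('m::topological_space, 'e::euclidean_space) chart \<Rightarrow> bool" where
  "is_chart c \<longleftrightarrow> open (fst c) \<and> open (snd c ` fst c) \<and>
     homeomorphism (fst c) (snd c ` fst c) (snd c) (chart_inv c)"

definition smooth_manifold ::
    "('m::{t2_space, second_countable_topology}, 'e::euclidean_space) chart set \<Rightarrow> bool" where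
  "smooth_manifold A \<longleftrightarrow>
     (\<forall>c\<in>A. is_chart c) \<and> (\<Union>c\<in>A. fst c) = UNIV \<and>
     (\<forall>c\<in>A. \<forall>d\<in>A. smooth_on (snd c ` (fst c \<inter> fst d)) (snd d \<circ> chart_inv c))"

text \<open>
  Every point \<open>p\<close> gets one preferred chart \<open>chart_at A p\<close> around it, and the tangent space at \<open>p\<close>
  is identified with the model space \<open>'e\<close> by taking components with respect to that chart. The
  preferred chart jumps from point to point, so smoothness of a vector field \<open>X :: 'm \<Rightarrow> 'e\<close>
  cannot be read off from \<open>X\<close> directly: \<open>to_chart A c p\<close> converts a tangent vector at \<open>p\<close> to its
  components in an arbitrary chart \<open>c\<close>, and \<open>of_chart A c p\<close> converts back. In particular
  \<open>\<lambda>p. of_chart A c p b\<close> is the coordinate vector field of \<open>c\<close> in direction \<open>b\<close>.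
\<close>

definition chart_at :: "('m, 'e) chart set \<Rightarrow> 'm \<Rightarrow> ('m, 'e) chart" where
  "chart_at A p = (SOME c. c \<in> A \<and> p \<in> fst c)"

definition to_chart ::
    "('m, 'e::euclidean_space) chart set \<Rightarrow> ('m, 'e) chart \<Rightarrow> 'm \<Rightarrow> 'e \<Rightarrow> 'e" where
  "to_chart A c p =
     frechet_derivative (snd c \<circ> chart_inv (chart_at A p)) (at (snd (chart_at A p) p))"

definition of_chart ::
    "('m, 'e::euclidean_space) chart set \<Rightarrow> ('m, 'e) chart \<Rightarrow> 'm \<Rightarrow> 'e \<Rightarrow> 'e" where
  "of_chart A c p = frechet_derivative (snd (chart_at A p) \<circ> chart_inv c) (at (snd c p))"

definition smooth_map_on ::
    "('m::topological_space, 'e::euclidean_space) chart set \<Rightarrow>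
     ('n::topological_space, 'f::euclidean_space) chart set \<Rightarrow> 'm set \<Rightarrow> ('m \<Rightarrow> 'n) \<Rightarrow> bool" where
  "smooth_map_on A B W F \<longleftrightarrow> continuous_on W F \<and>
     (\<forall>c\<in>A. \<forall>d\<in>B. smooth_on (snd c ` (W \<inter> fst c \<inter> F -` fst d)) (snd d \<circ> F \<circ> chart_inv c))"

definition differential ::
    "('m, 'e::euclidean_space) chart set \<Rightarrow> ('n, 'f::euclidean_space) chart set \<Rightarrow>
     ('m \<Rightarrow> 'n) \<Rightarrow> 'm \<Rightarrow> 'e \<Rightarrow> 'f" where
  "differential A B F p =
     frechet_derivative (snd (chart_at B (F p)) \<circ> F \<circ> chart_inv (chart_at A p))
       (at (snd (chart_at A p) p))"

definition smooth_field_on ::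
    "('m, 'e::euclidean_space) chart set \<Rightarrow> 'm set \<Rightarrow> ('m \<Rightarrow> 'e) \<Rightarrow> bool" where
  "smooth_field_on A W X \<longleftrightarrow>
     (\<forall>c\<in>A. smooth_on (snd c ` (W \<inter> fst c))
              (\<lambda>x. to_chart A c (chart_inv c x) (X (chart_inv c x))))"

text \<open>
  The standard manifold structure of a Euclidean space. It serves as target for real functions
  and, on \<open>real\<close>, as source for curves.
\<close>

definition std_atlas :: "('a::euclidean_space, 'a) chart set" where
  "std_atlas = {(UNIV, \<lambda>x. x)}"

lemma chart_at_std_atlas [simp]: "chart_at std_atlas x = (UNIV, \<lambda>x. x)"
  unfolding chart_at_def std_atlas_def by (rule some_equality) auto

lemma chart_inv_std_chart [simp]: "chart_inv (UNIV, \<lambda>x. x) = (\<lambda>x. x)"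
  by (auto simp: chart_inv_def fun_eq_iff intro: inv_into_f_eq)

abbreviation smooth_fun_on ::
    "('m::topological_space, 'e::euclidean_space) chart set \<Rightarrow> 'm set \<Rightarrow> ('m \<Rightarrow> real) \<Rightarrow> bool" where
  "smooth_fun_on A W f \<equiv> smooth_map_on A std_atlas W f"

abbreviation dfun ::
    "('m, 'e::euclidean_space) chart set \<Rightarrow> ('m \<Rightarrow> real) \<Rightarrow> 'm \<Rightarrow> 'e \<Rightarrow> real" where
  "dfun A f \<equiv> differential A std_atlas f"


section \<open>Riemannian metrics and the Levi-Civita connection\<close>

definition riemannian_metric ::
    "('m, 'e::euclidean_space) chart set \<Rightarrow> ('m \<Rightarrow> 'e \<Rightarrow> 'e \<Rightarrow> real) \<Rightarrow> bool" where
  "riemannian_metric A g \<longleftrightarrow>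
     (\<forall>p. bilinear (g p) \<and> (\<forall>u v. g p u v = g p v u) \<and> (\<forall>u. u \<noteq> 0 \<longrightarrow> 0 < g p u u)) \<and>
     (\<forall>c\<in>A. \<forall>a b. smooth_on (snd c ` fst c)
        (\<lambda>x. g (chart_inv c x) (of_chart A c (chart_inv c x) a) (of_chart A c (chart_inv c x) b)))"

text \<open>
  \<open>nab Y p v\<close> stands for the covariant derivative of \<open>Y\<close> at \<open>p\<close> in direction \<open>v\<close>. Connections
  act on vector fields that are smooth on some open set; since fields are total functions, the
  sheaf property (dependence on the germ only) is a separate clause. Values at fields that are not
  smooth near \<open>p\<close> are unconstrained.
\<close>

definition affine_connection ::
    "('m::topological_space, 'e::euclidean_space) chart set \<Rightarrow>
     (('m \<Rightarrow> 'e) \<Rightarrow> 'm \<Rightarrow> 'e \<Rightarrow> 'e) \<Rightarrow> bool" where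
  "affine_connection A nab \<longleftrightarrow> (\<forall>W. open W \<longrightarrow>
     (\<forall>Y. smooth_field_on A W Y \<longrightarrow>
        (\<forall>p\<in>W. linear (nab Y p)) \<and>
        (\<forall>X. smooth_field_on A W X \<longrightarrow> smooth_field_on A W (\<lambda>p. nab Y p (X p))) \<and>
        (\<forall>Z. (\<forall>q\<in>W. Z q = Y q) \<longrightarrow> (\<forall>p\<in>W. nab Z p = nab Y p)) \<and>
        (\<forall>Z. smooth_field_on A W Z \<longrightarrow>
           (\<forall>p\<in>W. \<forall>v. nab (\<lambda>q. Y q + Z q) p v = nab Y p v + nab Z p v)) \<and>
        (\<forall>f. smooth_fun_on A W f \<longrightarrow>
           (\<forall>p\<in>W. \<forall>v. nab (\<lambda>q. f q *\<^sub>R Y q) p v = dfun A f p v *\<^sub>R Y p + f p *\<^sub>R nab Y p v))))"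

text \<open>The Lie bracket enters through its action \<open>f \<mapsto> X (Y f) - Y (X f)\<close> on functions.\<close>

definition torsion_free ::
    "('m::topological_space, 'e::euclidean_space) chart set \<Rightarrow>
     (('m \<Rightarrow> 'e) \<Rightarrow> 'm \<Rightarrow> 'e \<Rightarrow> 'e) \<Rightarrow> bool" where
  "torsion_free A nab \<longleftrightarrow>
     (\<forall>W X Y f. open W \<and> smooth_field_on A W X \<and> smooth_field_on A W Y \<and> smooth_fun_on A W f \<longrightarrow>
        (\<forall>p\<in>W. dfun A f p (nab Y p (X p) - nab X p (Y p)) =
           dfun A (\<lambda>q. dfun A f q (Y q)) p (X p) - dfun A (\<lambda>q. dfun A f q (X q)) p (Y p)))"

definition metric_connection ::
    "('m::topological_space, 'e::euclidean_space) chart set \<Rightarrow> ('m \<Rightarrow> 'e \<Rightarrow> 'e \<Rightarrow> real) \<Rightarrow>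
     (('m \<Rightarrow> 'e) \<Rightarrow> 'm \<Rightarrow> 'e \<Rightarrow> 'e) \<Rightarrow> bool" where
  "metric_connection A g nab \<longleftrightarrow>
     (\<forall>W Y Z. open W \<and> smooth_field_on A W Y \<and> smooth_field_on A W Z \<longrightarrow>
        (\<forall>p\<in>W. \<forall>v. dfun A (\<lambda>q. g q (Y q) (Z q)) p v =
           g p (nab Y p v) (Z p) + g p (Y p) (nab Z p v)))"

definition levi_civita ::
    "('m::topological_space, 'e::euclidean_space) chart set \<Rightarrow> ('m \<Rightarrow> 'e \<Rightarrow> 'e \<Rightarrow> real) \<Rightarrow>
     (('m \<Rightarrow> 'e) \<Rightarrow> 'm \<Rightarrow> 'e \<Rightarrow> 'e) \<Rightarrow> bool" where
  "levi_civita A g nab \<longleftrightarrow>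
     affine_connection A nab \<and> torsion_free A nab \<and> metric_connection A g nab"

definition riemannian_manifold ::
    "('m::{t2_space, second_countable_topology}, 'e::euclidean_space) chart set \<Rightarrow>
     ('m \<Rightarrow> 'e \<Rightarrow> 'e \<Rightarrow> real) \<Rightarrow> (('m \<Rightarrow> 'e) \<Rightarrow> 'm \<Rightarrow> 'e \<Rightarrow> 'e) \<Rightarrow> bool" where
  "riemannian_manifold A g nab \<longleftrightarrow>
     smooth_manifold A \<and> riemannian_metric A g \<and> levi_civita A g nab"

text \<open>
  The pullback along \<open>F\<close> of a connection on the target, applied to a section \<open>V\<close> along \<open>F\<close>
  (\<open>V q\<close> is tangent at \<open>F q\<close>). Writing \<open>V\<close> near \<open>p\<close> as \<open>\<Sum>b. V\<^sup>b (\<partial>\<^sub>b \<circ> F)\<close> in the coordinate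
  frame of the preferred chart at \<open>F p\<close>, the Leibniz rule and \<open>\<nabla>\<^sup>F\<^sub>v (\<partial>\<^sub>b \<circ> F) = \<nabla>\<^bsub>F\<^sub>* v\<^esub> \<partial>\<^sub>b\<close> give the
  formula.
\<close>

definition pullback_conn ::
    "('m, 'e::euclidean_space) chart set \<Rightarrow> ('n, 'f::euclidean_space) chart set \<Rightarrow>
     (('n \<Rightarrow> 'f) \<Rightarrow> 'n \<Rightarrow> 'f \<Rightarrow> 'f) \<Rightarrow> ('m \<Rightarrow> 'n) \<Rightarrow> ('m \<Rightarrow> 'f) \<Rightarrow> 'm \<Rightarrow> 'e \<Rightarrow> 'f" where
  "pullback_conn A B nab F V p v =
     (let d = chart_at B (F p); comp = (\<lambda>b q. to_chart B d (F q) (V q) \<bullet> b) in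
        \<Sum>b\<in>Basis. dfun A (comp b) p v *\<^sub>R of_chart B d (F p) b +
          comp b p *\<^sub>R nab (\<lambda>y. of_chart B d y b) (F p) (differential A B F p v))"

definition velocity ::
    "('n, 'f::euclidean_space) chart set \<Rightarrow> (real \<Rightarrow> 'n) \<Rightarrow> real \<Rightarrow> 'f" where
  "velocity B \<beta> t = differential std_atlas B \<beta> t 1"

definition geodesic_on ::
    "('n::topological_space, 'f::euclidean_space) chart set \<Rightarrow>
     (('n \<Rightarrow> 'f) \<Rightarrow> 'n \<Rightarrow> 'f \<Rightarrow> 'f) \<Rightarrow> real set \<Rightarrow> (real \<Rightarrow> 'n) \<Rightarrow> bool" where
  "geodesic_on B nab I \<beta> \<longleftrightarrow> open I \<and> is_interval I \<and> smooth_map_on std_atlas B I \<beta> \<and>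
     (\<forall>t\<in>I. pullback_conn std_atlas B nab \<beta> (velocity B \<beta>) t 1 = 0)"


section \<open>Kaehler manifolds\<close>

definition kaehler_manifold ::
    "('n::{t2_space, second_countable_topology}, 'f::euclidean_space) chart set \<Rightarrow>
     ('n \<Rightarrow> 'f \<Rightarrow> 'f \<Rightarrow> real) \<Rightarrow> (('n \<Rightarrow> 'f) \<Rightarrow> 'n \<Rightarrow> 'f \<Rightarrow> 'f) \<Rightarrow> ('n \<Rightarrow> 'f \<Rightarrow> 'f) \<Rightarrow> bool" where
  "kaehler_manifold B g nab J \<longleftrightarrow> riemannian_manifold B g nab \<and>
     (\<forall>q. linear (J q) \<and> (\<forall>u. J q (J q u) = - u) \<and> (\<forall>u v. g q (J q u) (J q v) = g q u v)) \<and>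
     (\<forall>W Y. open W \<and> smooth_field_on B W Y \<longrightarrow>
        smooth_field_on B W (\<lambda>q. J q (Y q)) \<and>
        (\<forall>q\<in>W. \<forall>v. nab (\<lambda>x. J x (Y x)) q v = J q (nab Y q v)))"


section \<open>Riemannian maps\<close>

definition orth_compl :: "('e \<Rightarrow> 'e \<Rightarrow> real) \<Rightarrow> 'e set \<Rightarrow> 'e set" where
  "orth_compl gp S = {v. \<forall>u\<in>S. gp u v = 0}"

definition ker_diff ::
    "('m, 'e::euclidean_space) chart set \<Rightarrow> ('n, 'f::euclidean_space) chart set \<Rightarrow>
     ('m \<Rightarrow> 'n) \<Rightarrow> 'm \<Rightarrow> 'e set" where
  "ker_diff A B F p = {v. differential A B F p v = 0}"

definition range_diff ::
    "('m, 'e::euclidean_space) chart set \<Rightarrow> ('n, 'f::euclidean_space) chart set \<Rightarrow>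
     ('m \<Rightarrow> 'n) \<Rightarrow> 'm \<Rightarrow> 'f set" where
  "range_diff A B F p = range (differential A B F p)"

definition riemannian_map ::
    "('m::topological_space, 'e::euclidean_space) chart set \<Rightarrow> ('m \<Rightarrow> 'e \<Rightarrow> 'e \<Rightarrow> real) \<Rightarrow>
     ('n::topological_space, 'f::euclidean_space) chart set \<Rightarrow> ('n \<Rightarrow> 'f \<Rightarrow> 'f \<Rightarrow> real) \<Rightarrow>
     ('m \<Rightarrow> 'n) \<Rightarrow> bool" where
  "riemannian_map A g1 B g2 F \<longleftrightarrow> smooth_map_on A B UNIV F \<and>
     (\<forall>p. 0 < dim (range_diff A B F p) \<and> dim (range_diff A B F p) \<le> min DIM('e) DIM('f) \<and>
        (\<forall>X \<in> orth_compl (g1 p) (ker_diff A B F p). \<forall>Y \<in> orth_compl (g1 p) (ker_diff A B F p).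
           g2 (F p) (differential A B F p X) (differential A B F p Y) = g1 p X Y))"

definition second_ff ::
    "('m, 'e::euclidean_space) chart set \<Rightarrow> (('m \<Rightarrow> 'e) \<Rightarrow> 'm \<Rightarrow> 'e \<Rightarrow> 'e) \<Rightarrow>
     ('n, 'f::euclidean_space) chart set \<Rightarrow> (('n \<Rightarrow> 'f) \<Rightarrow> 'n \<Rightarrow> 'f \<Rightarrow> 'f) \<Rightarrow>
     ('m \<Rightarrow> 'n) \<Rightarrow> ('m \<Rightarrow> 'e) \<Rightarrow> ('m \<Rightarrow> 'e) \<Rightarrow> 'm \<Rightarrow> 'f" where
  "second_ff A nab1 B nab2 F X Y p =
     pullback_conn A B nab2 F (\<lambda>q. differential A B F q (Y q)) p (X p)
       - differential A B F p (nab1 Y p (X p))"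

definition mean_curvature ::
    "('m, 'e::euclidean_space) chart set \<Rightarrow> (('m \<Rightarrow> 'e) \<Rightarrow> 'm \<Rightarrow> 'e \<Rightarrow> 'e) \<Rightarrow>
     ('n, 'f::euclidean_space) chart set \<Rightarrow> (('n \<Rightarrow> 'f) \<Rightarrow> 'n \<Rightarrow> 'f \<Rightarrow> 'f) \<Rightarrow>
     ('m \<Rightarrow> 'n) \<Rightarrow> nat \<Rightarrow> (nat \<Rightarrow> 'm \<Rightarrow> 'e) \<Rightarrow> 'm \<Rightarrow> 'f" where
  "mean_curvature A nab1 B nab2 F r X p =
     (1 / (real DIM('e) - real r)) *\<^sub>R (\<Sum>j=r+1..DIM('e). second_ff A nab1 B nab2 F (X j) (X j) p)"

definition orthonormal_basis ::
    "('e::euclidean_space \<Rightarrow> 'e \<Rightarrow> real) \<Rightarrow> 'e set \<Rightarrow> nat set \<Rightarrow> (nat \<Rightarrow> 'e) \<Rightarrow> bool" where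
  "orthonormal_basis gp S K b \<longleftrightarrow>
     (\<forall>i\<in>K. \<forall>j\<in>K. gp (b i) (b j) = (if i = j then 1 else 0)) \<and> span (b ` K) = S"

text \<open>
  The mean curvature vector does not depend on the frame, nor on how the frame vectors at \<open>p\<close> are
  extended to a neighbourhood. Hence minimality at \<open>p\<close> is demanded for every family of local
  fields that is an orthonormal basis of the horizontal space at \<open>p\<close>; such families always exist.
\<close>

definition minimal_range ::
    "('m::topological_space, 'e::euclidean_space) chart set \<Rightarrow> ('m \<Rightarrow> 'e \<Rightarrow> 'e \<Rightarrow> real) \<Rightarrow>
     (('m \<Rightarrow> 'e) \<Rightarrow> 'm \<Rightarrow> 'e \<Rightarrow> 'e) \<Rightarrow> ('n, 'f::euclidean_space) chart set \<Rightarrow>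
     (('n \<Rightarrow> 'f) \<Rightarrow> 'n \<Rightarrow> 'f \<Rightarrow> 'f) \<Rightarrow> ('m \<Rightarrow> 'n) \<Rightarrow> nat \<Rightarrow> bool" where
  "minimal_range A g1 nab1 B nab2 F r \<longleftrightarrow>
     (\<forall>W X p. open W \<and> p \<in> W \<and> (\<forall>j\<in>{r+1..DIM('e)}. smooth_field_on A W (X j)) \<and>
        orthonormal_basis (g1 p) (orth_compl (g1 p) (ker_diff A B F p)) {r+1..DIM('e)} (\<lambda>j. X j p)
        \<longrightarrow> mean_curvature A nab1 B nab2 F r X p = 0)"


section \<open>Distributions\<close>

definition distribution ::
    "('n::topological_space, 'f::euclidean_space) chart set \<Rightarrow> nat \<Rightarrow> ('n \<Rightarrow> 'f set) \<Rightarrow> bool" where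
  "distribution B k D \<longleftrightarrow> (\<forall>q. subspace (D q) \<and> dim (D q) = k) \<and>
     (\<forall>q. \<exists>W E. open W \<and> q \<in> W \<and> (\<forall>i<k. smooth_field_on B W (E i)) \<and>
        (\<forall>x\<in>W. D x = span ((\<lambda>i. E i x) ` {..<k})))"

text \<open>
  For a map \<open>F\<close> that is not a submersion the images of the tangent spaces give a vector
  bundle over the image of \<open>F\<close> only. That this bundle is regarded as a distribution on the target
  means: \<open>D\<close> is a distribution on the target whose fibres over the image are those subspaces.
\<close>

definition range_distribution ::
    "('m, 'e::euclidean_space) chart set \<Rightarrow> ('n::topological_space, 'f::euclidean_space) chart set \<Rightarrow>
     ('m \<Rightarrow> 'n) \<Rightarrow> ('n \<Rightarrow> 'f set) \<Rightarrow> bool" where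
  "range_distribution A B F D \<longleftrightarrow>
     (\<exists>k. distribution B k D) \<and> (\<forall>p. D (F p) = range_diff A B F p)"

text \<open>
  \<open>totally_geodesic_over B nab S D\<close>: covariant derivatives of local sections of \<open>D\<close> along \<open>D\<close> are
  in \<open>D\<close> at all points of \<open>S\<close>. For \<open>S = UNIV\<close> this says that \<open>D\<close> is a totally geodesic
  distribution; for the range of a map \<open>F\<close> and its complement, \<open>S\<close> is the image of \<open>F\<close>, where
  these bundles are determined by \<open>F\<close>.
\<close>

definition totally_geodesic_over ::
    "('n::topological_space, 'f::euclidean_space) chart set \<Rightarrow>
     (('n \<Rightarrow> 'f) \<Rightarrow> 'n \<Rightarrow> 'f \<Rightarrow> 'f) \<Rightarrow> 'n set \<Rightarrow> ('n \<Rightarrow> 'f set) \<Rightarrow> bool" where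
  "totally_geodesic_over B nab S D \<longleftrightarrow>
     (\<forall>W U V. open W \<and> smooth_field_on B W U \<and> smooth_field_on B W V \<and>
        (\<forall>x\<in>W. U x \<in> D x \<and> V x \<in> D x) \<longrightarrow> (\<forall>q\<in>W \<inter> S. nab V q (U q) \<in> D q))"


section \<open>Lagrangian and Clairaut Riemannian maps\<close>

definition anti_invariant ::
    "('m, 'e::euclidean_space) chart set \<Rightarrow> ('n, 'f::euclidean_space) chart set \<Rightarrow>
     ('n \<Rightarrow> 'f \<Rightarrow> 'f \<Rightarrow> real) \<Rightarrow> ('n \<Rightarrow> 'f \<Rightarrow> 'f) \<Rightarrow> ('m \<Rightarrow> 'n) \<Rightarrow> bool" where
  "anti_invariant A B g2 J F \<longleftrightarrow>
     (\<forall>p. J (F p) ` range_diff A B F p \<subseteq> orth_compl (g2 (F p)) (range_diff A B F p))"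

definition lagrangian ::
    "('m, 'e::euclidean_space) chart set \<Rightarrow> ('n, 'f::euclidean_space) chart set \<Rightarrow>
     ('n \<Rightarrow> 'f \<Rightarrow> 'f \<Rightarrow> real) \<Rightarrow> ('n \<Rightarrow> 'f \<Rightarrow> 'f) \<Rightarrow> ('m \<Rightarrow> 'n) \<Rightarrow> bool" where
  "lagrangian A B g2 J F \<longleftrightarrow> anti_invariant A B g2 J F \<and>
     (\<forall>p. J (F p) ` range_diff A B F p = orth_compl (g2 (F p)) (range_diff A B F p))"

text \<open>
  Values in \<open>{0..pi}\<close>. Since division by zero yields zero, the angle with the zero vector is
  \<open>pi/2\<close>; this is the limit value for the angle between \<open>x + v\<close> and \<open>v\<close>, with \<open>x\<close> nonzero and
  orthogonal to \<open>v\<close>, as \<open>v\<close> tends to zero.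
\<close>

definition angle :: "('f \<Rightarrow> 'f \<Rightarrow> real) \<Rightarrow> 'f \<Rightarrow> 'f \<Rightarrow> real" where
  "angle gq u v = arccos (gq u v / (sqrt (gq u u) * sqrt (gq v v)))"

definition clairaut ::
    "('n::topological_space, 'f::euclidean_space) chart set \<Rightarrow> ('n \<Rightarrow> 'f \<Rightarrow> 'f \<Rightarrow> real) \<Rightarrow>
     (('n \<Rightarrow> 'f) \<Rightarrow> 'n \<Rightarrow> 'f \<Rightarrow> 'f) \<Rightarrow> ('n \<Rightarrow> 'f set) \<Rightarrow> ('n \<Rightarrow> real) \<Rightarrow> bool" where
  "clairaut B g nab D s \<longleftrightarrow> (\<forall>q. 0 < s q) \<and>
     (\<forall>I \<beta>. geodesic_on B nab I \<beta> \<longrightarrow>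
        (\<exists>C. \<forall>t\<in>I. \<forall>X\<in>D (\<beta> t). \<forall>V\<in>orth_compl (g (\<beta> t)) (D (\<beta> t)).
           velocity B \<beta> t = X + V \<longrightarrow>
             s (\<beta> t) * sin (angle (g (\<beta> t)) (velocity B \<beta> t) V) = C))"

end

theory Submission
  imports Defs
begin

text \<open>
  Let \<open>Y\<close> be a section of \<open>D\<close>, let \<open>v\<close> be normal to \<open>D\<close> at \<open>q\<close>, and let \<open>\<beta>\<close> be the geodesic with initial
  velocity \<open>Y q + v\<close>. Since the \<open>D\<close>-part of the velocity is its best approximation in \<open>D\<close>, the
  Clairaut relation says that a function built from \<open>Y \<circ> \<beta>\<close> has an extremum at time zero; its
  vanishing derivative, compared for \<open>v\<close> and \<open>- v\<close>, gives
  \<open>\<langle>\<nabla>\<^sub>Y Y, v\<rangle> = - dg(v) |Y|\<^sup>2\<close>, so \<open>D\<close> is totally umbilical. On the other hand, because \<open>J\<close> is parallel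
  and \<open>F\<close> is Lagrangian, the cubic form \<open>\<langle>\<nabla>\<^sub>X Y, J Z\<rangle>\<close> is totally symmetric along the image of \<open>F\<close>.
  Evaluating it at \<open>(X, X, Z)\<close> and \<open>(X, Z, X)\<close> with \<open>X\<close> orthogonal to \<open>Z\<close>, which needs rank at least two,
  gives \<open>dg(J Z) = 0\<close>, so the form vanishes and \<open>D\<close> is totally geodesic. The component of
  \<open>(\<nabla>F\<^sub>*)(X, X)\<close> tangent to the range vanishes by a Koszul-type argument, hence minimality.
\<close>

section \<open>Calculus of smooth maps between Euclidean spaces\<close>

text \<open>The obstacle is that the two halves of the argument live in different places. The
  Clairaut relation speaks of geodesics of N, whose velocity splits along \<open>D\<close>; the
  smoothness of this splitting would have to be proved. Comparison with an arbitrary section of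
  \<open>D\<close> through an extremum avoids differentiating it. The same device is used on M: the
  squared length lost by the differential of F is nonnegative, so vectors never have to be extended
  to horizontal fields. The Lagrangian condition, in contrast, holds only over the image of F, and
  \<open>D\<close> beyond the image is an arbitrary extension without any integrability. Identities
  such as the orthogonality of Y and J Z are therefore differentiated as functions on M, through the
  pullback connection. Symmetry of the cubic form in its last two slots comes from J being parallel
  and skew-adjoint, symmetry in the outer two from the symmetric second fundamental form of F. These
  two transpositions generate all permutations, and so supply the symmetry that polarizing the
  umbilical identity alone cannot give.\<close>

lemma Ck_on_cong:
  assumes "open S" "\<And>x. x \<in> S \<Longrightarrow> f x = g x" "Ck_on k S f"
  shows "Ck_on k S g"
  using assms(2,3)
proof (induction k arbitrary: f g)
  case 0
  then show ?case by (simp cong: continuous_on_cong)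
next
  case (Suc k)
  have d: "g differentiable at x" if "x \<in> S" for x
  proof -
    from Suc.prems that obtain f' where "(f has_derivative f') (at x)"
      by (auto simp: differentiable_def)
    then have "(g has_derivative f') (at x)"
      using has_derivative_transform_within_open[OF _ assms(1) that] Suc.prems(1) by blast
    then show ?thesis by (auto simp: differentiable_def)
  qed
  have "frechet_derivative f (at x) = frechet_derivative g (at x)" if "x \<in> S" for x
    using Suc.prems that assms(1) by (intro frechet_derivative_transform_within_open[of _ _ S]) auto
  then have "Ck_on k S (\<lambda>x. frechet_derivative g (at x) v)" for v
    using Suc.prems(2) by (intro Suc.IH[OF _ Suc.prems(2)[unfolded Ck_on.simps, THEN conjunct2, rule_format]]) simp
  with d show ?case by simp
qed

lemma Ck_on_subset: "Ck_on k S f \<Longrightarrow> T \<subseteq> S \<Longrightarrow> Ck_on k T f"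
  by (induction k arbitrary: f) (auto intro: continuous_on_subset)

lemma Ck_on_Suc_imp: "Ck_on (Suc k) S f \<Longrightarrow> Ck_on k S f"
proof (induction k arbitrary: f)
  case 0
  then show ?case
    by (auto intro!: differentiable_imp_continuous_on differentiable_at_imp_differentiable_on)
next
  case (Suc k)
  then show ?case by auto
qed

lemma Ck_on_const [simp]: "Ck_on k S (\<lambda>x. c)"
proof (induction k arbitrary: c)
  case (Suc k)
  have "frechet_derivative (\<lambda>x. c) (at x) = (\<lambda>v. 0)" for x :: 'a
    by (intro frechet_derivative_at[symmetric]) simp
  then show ?case using Suc by simp
qed simp

lemma frechet_derivative_eqI: "(f has_derivative f') (at x) \<Longrightarrow> frechet_derivative f (at x) = f'"
  by (rule frechet_derivative_at[symmetric])

text \<open>This and the next closure rules share one scheme: the derivative is given by an explicit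
  formula on the open set, the induction hypothesis handles that formula, and
  \<open>Ck_on_cong\<close> exchanges it for the \<open>frechet_derivative\<close> term in the
  recursion of \<open>Ck_on\<close>.\<close>

lemma Ck_on_bounded_linear:
  assumes "open S" "bounded_linear L" "Ck_on k S f"
  shows "Ck_on k S (\<lambda>x. L (f x))"
  using assms(3)
proof (induction k arbitrary: f)
  case 0
  then show ?case by (simp add: bounded_linear.continuous_on[OF assms(2)])
next
  case (Suc k)
  have D: "((\<lambda>x. L (f x)) has_derivative (\<lambda>v. L (frechet_derivative f (at x) v))) (at x)"
    if "x \<in> S" for x
    using Suc.prems that
    by (intro bounded_linear.has_derivative[OF assms(2)]) (auto simp: frechet_derivative_works)
  have "Ck_on k S (\<lambda>x. frechet_derivative (\<lambda>x. L (f x)) (at x) v)" for v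
  proof (rule Ck_on_cong[OF assms(1)])
    show "Ck_on k S (\<lambda>x. L (frechet_derivative f (at x) v))"
      using Suc.prems by (intro Suc.IH) auto
  qed (use frechet_derivative_eqI[OF D] in auto)
  then show ?case using D by (auto simp: differentiable_def)
qed

lemma Ck_on_add:
  assumes "open S" "Ck_on k S f" "Ck_on k S g"
  shows "Ck_on k S (\<lambda>x. f x + g x)"
  using assms(2,3)
proof (induction k arbitrary: f g)
  case 0
  then show ?case by (simp add: continuous_on_add)
next
  case (Suc k)
  have D: "((\<lambda>x. f x + g x) has_derivative
      (\<lambda>v. frechet_derivative f (at x) v + frechet_derivative g (at x) v)) (at x)"
    if "x \<in> S" for x
    using Suc.prems that by (intro has_derivative_add) (auto simp: frechet_derivative_works)
  have "Ck_on k S (\<lambda>x. frechet_derivative (\<lambda>x. f x + g x) (at x) v)" for v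
  proof (rule Ck_on_cong[OF assms(1)])
    show "Ck_on k S (\<lambda>x. frechet_derivative f (at x) v + frechet_derivative g (at x) v)"
      using Suc.prems by (intro Suc.IH) auto
  qed (use frechet_derivative_eqI[OF D] in auto)
  then show ?case using D by (auto simp: differentiable_def)
qed

lemma Ck_on_sum:
  assumes "open S" "\<And>i. i \<in> K \<Longrightarrow> Ck_on k S (f i)"
  shows "Ck_on k S (\<lambda>x. \<Sum>i\<in>K. f i x)"
  using assms(2) by (induction K rule: infinite_finite_induct) (auto intro: Ck_on_add assms(1))

lemma Ck_on_scaleR:
  fixes f :: "'a::euclidean_space \<Rightarrow> real"
  assumes "open S" "Ck_on k S f" "Ck_on k S g"
  shows "Ck_on k S (\<lambda>x. f x *\<^sub>R g x)"
  using assms(2,3)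
proof (induction k arbitrary: f g)
  case 0
  then show ?case by (simp add: continuous_on_scaleR)
next
  case (Suc k)
  have D: "((\<lambda>x. f x *\<^sub>R g x) has_derivative
      (\<lambda>v. f x *\<^sub>R frechet_derivative g (at x) v + frechet_derivative f (at x) v *\<^sub>R g x)) (at x)"
    if "x \<in> S" for x
    using Suc.prems that by (intro has_derivative_scaleR) (auto simp: frechet_derivative_works)
  have "Ck_on k S (\<lambda>x. frechet_derivative (\<lambda>x. f x *\<^sub>R g x) (at x) v)" for v
  proof (rule Ck_on_cong[OF assms(1)])
    show "Ck_on k S (\<lambda>x. f x *\<^sub>R frechet_derivative g (at x) v + frechet_derivative f (at x) v *\<^sub>R g x)"
      using Suc.prems Ck_on_Suc_imp[OF Suc.prems(1)] Ck_on_Suc_imp[OF Suc.prems(2)]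
      by (intro Ck_on_add[OF assms(1)] Suc.IH) auto
  qed (use frechet_derivative_eqI[OF D] in auto)
  then show ?case using D by (auto simp: differentiable_def)
qed

lemma linear_sum_Basis: "linear L \<Longrightarrow> L v = (\<Sum>b\<in>Basis. (v \<bullet> b) *\<^sub>R L b)"
  for L :: "'a::euclidean_space \<Rightarrow> 'b::real_vector"
  by (subst (1) euclidean_representation[of v, symmetric]) (simp only: linear_sum linear_scale)

text \<open>The chain rule applies the derivative of \<open>f\<close> at \<open>h x\<close> to a
  vector that moves with \<open>x\<close>, which the recursion of \<open>Ck_on\<close> does not
  cover. Expanding this vector in \<open>Basis\<close> leaves derivatives of \<open>f\<close> in
  fixed directions composed with \<open>h\<close>, and these fall under the induction
  hypothesis.\<close>

lemma Ck_on_compose: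
  fixes f :: "'b::euclidean_space \<Rightarrow> 'c::real_normed_vector" and h :: "'a::euclidean_space \<Rightarrow> 'b"
  assumes "open S" "open T" "h ` S \<subseteq> T" "Ck_on k T f" "Ck_on k S h"
  shows "Ck_on k S (\<lambda>x. f (h x))"
  using assms(4,5)
proof (induction k arbitrary: f)
  case 0
  then show ?case using assms(3) by (auto intro: continuous_on_compose2)
next
  case (Suc k)
  have D: "((\<lambda>x. f (h x)) has_derivative
      (\<lambda>v. frechet_derivative f (at (h x)) (frechet_derivative h (at x) v))) (at x)"
    if "x \<in> S" for x
    using Suc.prems that assms(3)
    by (intro has_derivative_compose[where g = f and f = h]) (auto simp: frechet_derivative_works)
  have lin: "linear (frechet_derivative f (at (h x)))" if "x \<in> S" for x
    using Suc.prems that assms(3) by (auto intro!: linear_frechet_derivative)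
  have "Ck_on k S (\<lambda>x. frechet_derivative (\<lambda>x. f (h x)) (at x) v)" for v
  proof (rule Ck_on_cong[OF assms(1)])
    show "Ck_on k S (\<lambda>x. \<Sum>b\<in>Basis. (frechet_derivative h (at x) v \<bullet> b) *\<^sub>R
        frechet_derivative f (at (h x)) b)"
      using Suc.prems Ck_on_Suc_imp[OF Suc.prems(2)]
      by (intro Ck_on_sum Ck_on_scaleR Suc.IH Ck_on_bounded_linear[OF _ bounded_linear_inner_left]
          assms(1)) auto
    show "(\<Sum>b\<in>Basis. (frechet_derivative h (at x) v \<bullet> b) *\<^sub>R frechet_derivative f (at (h x)) b) =
        frechet_derivative (\<lambda>x. f (h x)) (at x) v" if "x \<in> S" for x
      using that by (simp add: frechet_derivative_eqI[OF D] linear_sum_Basis[OF lin[OF that], symmetric])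
  qed
  then show ?case using D by (auto simp: differentiable_def)
qed

lemma smooth_on_cong:
  "open S \<Longrightarrow> smooth_on S f \<Longrightarrow> (\<And>x. x \<in> S \<Longrightarrow> f x = g x) \<Longrightarrow> smooth_on S g"
  unfolding smooth_on_def by (blast intro: Ck_on_cong)

lemma smooth_on_subset: "smooth_on S f \<Longrightarrow> T \<subseteq> S \<Longrightarrow> smooth_on T f"
  unfolding smooth_on_def by (blast intro: Ck_on_subset)

lemma smooth_on_const [simp]: "smooth_on S (\<lambda>x. c)"
  by (simp add: smooth_on_def)

lemma smooth_on_bounded_linear:
  "open S \<Longrightarrow> bounded_linear L \<Longrightarrow> smooth_on S f \<Longrightarrow> smooth_on S (\<lambda>x. L (f x))"
  by (simp add: smooth_on_def Ck_on_bounded_linear)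

lemma smooth_on_inner_left: "open S \<Longrightarrow> smooth_on S f \<Longrightarrow> smooth_on S (\<lambda>x. f x \<bullet> b)"
  by (rule smooth_on_bounded_linear[OF _ bounded_linear_inner_left])

lemma smooth_on_add:
  "open S \<Longrightarrow> smooth_on S f \<Longrightarrow> smooth_on S g \<Longrightarrow> smooth_on S (\<lambda>x. f x + g x)"
  by (simp add: smooth_on_def Ck_on_add)

lemma smooth_on_sum:
  "open S \<Longrightarrow> (\<And>i. i \<in> K \<Longrightarrow> smooth_on S (f i)) \<Longrightarrow> smooth_on S (\<lambda>x. \<Sum>i\<in>K. f i x)"
  by (simp add: smooth_on_def Ck_on_sum)

lemma smooth_on_scaleR:
  "open S \<Longrightarrow> smooth_on S f \<Longrightarrow> smooth_on S g \<Longrightarrow> smooth_on S (\<lambda>x. f x *\<^sub>R g x)"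
  by (simp add: smooth_on_def Ck_on_scaleR)

lemma smooth_on_ident: "smooth_on S (\<lambda>x. x)"
  unfolding smooth_on_def
proof
  show "Ck_on k S (\<lambda>x. x)" for k by (cases k) auto
qed

lemma smooth_on_Pair:
  assumes "open S" "smooth_on S f" "smooth_on S h"
  shows "smooth_on S (\<lambda>x. (f x, h x))"
proof -
  have "bounded_linear (\<lambda>x. (x, 0))" "bounded_linear (\<lambda>x. (0, x))"
    by (intro bounded_linear_Pair bounded_linear_ident bounded_linear_zero)+
  from smooth_on_add[OF assms(1) smooth_on_bounded_linear[OF assms(1) this(1) assms(2)]
      smooth_on_bounded_linear[OF assms(1) this(2) assms(3)]]
  show ?thesis by simp
qed

lemma smooth_on_compose:
  "open S \<Longrightarrow> open T \<Longrightarrow> h ` S \<subseteq> T \<Longrightarrow> smooth_on T f \<Longrightarrow> smooth_on S h \<Longrightarrow>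
    smooth_on S (\<lambda>x. f (h x))"
  unfolding smooth_on_def by (blast intro: Ck_on_compose)

lemma smooth_on_frechet_derivative:
  "smooth_on S f \<Longrightarrow> smooth_on S (\<lambda>x. frechet_derivative f (at x) v)"
  unfolding smooth_on_def by (metis Ck_on.simps(2))

lemma smooth_on_imp_differentiable: "smooth_on S f \<Longrightarrow> x \<in> S \<Longrightarrow> f differentiable (at x)"
  unfolding smooth_on_def by (metis Ck_on.simps(2))

lemma smooth_on_imp_continuous_on: "smooth_on S f \<Longrightarrow> continuous_on S f"
  unfolding smooth_on_def by (metis Ck_on.simps(1))

lemma smooth_on_frechet_derivative_field:
  assumes "open S" "smooth_on S f" "smooth_on S u"
  shows "smooth_on S (\<lambda>x. frechet_derivative f (at x) (u x))"
proof (rule smooth_on_cong[OF assms(1)])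
  show "smooth_on S (\<lambda>x. \<Sum>b\<in>Basis. (u x \<bullet> b) *\<^sub>R frechet_derivative f (at x) b)"
    by (intro smooth_on_sum smooth_on_scaleR smooth_on_inner_left smooth_on_frechet_derivative assms)
  show "(\<Sum>b\<in>Basis. (u x \<bullet> b) *\<^sub>R frechet_derivative f (at x) b) = frechet_derivative f (at x) (u x)"
    if "x \<in> S" for x
    using linear_sum_Basis[OF linear_frechet_derivative[OF smooth_on_imp_differentiable[OF assms(2) that]]]
    by metis
qed


section \<open>Existence and smoothness of solutions of ordinary differential equations\<close>

text \<open>Picard iteration: the integral equation is a contraction on bounded continuous functions
  on the whole line, and its fixed point is the solution.\<close>

lemma ode_exists_lipschitz:
  fixes f :: "'a::euclidean_space \<Rightarrow> 'a"
  assumes L: "0 \<le> L" "\<And>x y. norm (f x - f y) \<le> L * norm (x - y)"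
  obtains e z where "0 < e" "z 0 = z0"
    "\<And>t. t \<in> {-e<..<e} \<Longrightarrow> (z has_vector_derivative f (z t)) (at t)"
proof -
  \<comment> \<open>The oriented integral from 0 is a difference of two integrals from
    \<open>-e\<close>, each contributing at most \<open>2 * e * L\<close> to the Lipschitz constant;
    this \<open>e\<close> makes the total \<open>4 * e * L\<close> less than 1, also when
    \<open>L = 0\<close>.\<close>
  define e where "e = 1 / (4 * (L + 1))"
  have e: "0 < e" and eL: "4 * e * L < 1"
    using L(1) by (auto simp: e_def field_simps)
  \<comment> \<open>Clamping time to \<open>{-e..e}\<close> makes the iterates bounded functions on
    all reals, so the complete space is a type and the fixed point theorem for types applies. Inside
    the open interval the clamp is invisible.\<close>
  define cl where "cl = (\<lambda>t. max (-e) (min e t))"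
  have cl: "cl t \<in> {-e..e}" for t using e by (auto simp: cl_def)
  have cl_cont: "continuous_on UNIV cl" unfolding cl_def by (intro continuous_intros)
  have f_cont: "continuous_on UNIV f"
  proof (rule lipschitz_on_continuous_on)
    show "L-lipschitz_on UNIV f" using L by (auto simp: lipschitz_on_def dist_norm)
  qed
  \<comment> \<open>The subtraction gives the oriented integral from 0, also for negative times,
    where \<open>integral {0..t}\<close> would be 0.\<close>
  define T where "T = (\<lambda>z :: real \<Rightarrow> 'a. \<lambda>t. z0 + (integral {-e..cl t} (\<lambda>s. f (z s))
      - integral {-e..0} (\<lambda>s. f (z s))))"
  have fz: "continuous_on X (\<lambda>s. f (z s))" if "continuous_on UNIV z" for z :: "real \<Rightarrow> 'a" and X
    using continuous_on_compose2[OF f_cont that] continuous_on_subset by blast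
  have T: "T z \<in> bcontfun" if "continuous_on UNIV z" for z
  proof -
    have J: "continuous_on {-e..e} (\<lambda>t. integral {-e..t} (\<lambda>s. f (z s)))"
      by (intro indefinite_integral_continuous_1 integrable_continuous_real fz that)
    then have "continuous_on UNIV (T z)"
      unfolding T_def by (intro continuous_intros continuous_on_compose2[OF J cl_cont]) (use cl in auto)
    moreover have "bounded (range (T z))"
    proof -
      have "compact (T z ` {-e..e})"
        using calculation continuous_on_subset by (intro compact_continuous_image) blast+
      moreover have "range (T z) \<subseteq> T z ` {-e..e}"
      proof clarify
        fix t
        have "T z t = T z (cl t)" using e by (auto simp: T_def cl_def)
        then show "T z t \<in> T z ` {-e..e}" using cl by blast
      qed
      ultimately show ?thesis using compact_imp_bounded bounded_subset by blast
    qed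
    ultimately show ?thesis by (simp add: bcontfun_def)
  qed
  define TT where "TT = (\<lambda>z. Bcontfun (T (apply_bcontfun z)))"
  have TT: "apply_bcontfun (TT z) = T (apply_bcontfun z)" for z
    unfolding TT_def by (rule Bcontfun_inverse) (rule T, simp)
  have est: "norm (integral {-e..a} (\<lambda>s. f (z s)) - integral {-e..a} (\<lambda>s. f (w s)))
      \<le> 2 * e * L * dist z w" if "a \<in> {-e..e}" for a and z w :: "real \<Rightarrow>\<^sub>C 'a"
  proof -
    have "integral {-e..a} (\<lambda>s. f (z s)) - integral {-e..a} (\<lambda>s. f (w s)) =
        integral {-e..a} (\<lambda>s. f (z s) - f (w s))"
      by (intro integral_diff[symmetric] integrable_continuous_real fz) simp_all
    also have "norm \<dots> \<le> L * dist z w * (a - (- e))"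
    proof (rule integral_bound)
      show "norm (f (z t) - f (w t)) \<le> L * dist z w" if "t \<in> {-e..a}" for t
      proof -
        have "norm (z t - w t) \<le> dist z w" using dist_bounded[of z t w] by (simp add: dist_norm)
        then show ?thesis using L(2)[of "z t" "w t"] L(1)
          by (meson mult_left_mono order_trans)
      qed
    qed (use that in \<open>auto intro!: continuous_intros fz\<close>)
    also have "\<dots> \<le> L * dist z w * (2 * e)" using that L(1) by (intro mult_left_mono) auto
    finally show ?thesis by (simp add: mult_ac)
  qed
  have "\<exists>!z. TT z = z"
  proof (rule banach_fix_type[where c = "4 * e * L"]; (intro allI)?)
    fix z w
    show "dist (TT z) (TT w) \<le> 4 * e * L * dist z w"
    proof (rule dist_bound)
      fix t
      have "T z t - T w t = (integral {-e..cl t} (\<lambda>s. f (z s)) - integral {-e..cl t} (\<lambda>s. f (w s)))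
         - (integral {-e..0} (\<lambda>s. f (z s)) - integral {-e..0} (\<lambda>s. f (w s)))"
        by (simp add: T_def)
      also have "norm \<dots> \<le> 2 * e * L * dist z w + 2 * e * L * dist z w"
        using e by (intro norm_triangle_le_diff add_mono est cl) auto
      finally show "dist (TT z t) (TT w t) \<le> 4 * e * L * dist z w"
        by (simp add: TT dist_norm[of "T _ _"] mult_ac)
    qed
  qed (use e eL L in auto)
  then obtain zz where zz: "TT zz = zz" by blast
  define z where "z = apply_bcontfun zz"
  have z: "z t = T z t" for t using zz TT[of zz] by (simp add: z_def)
  have zc: "continuous_on UNIV z" by (simp add: z_def)
  have "(z has_vector_derivative f (z t)) (at t)" if "t \<in> {-e<..<e}" for t
  proof -
    have "((\<lambda>u. integral {-e..u} (\<lambda>s. f (z s))) has_vector_derivative f (z t)) (at t within {-e..e})"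
      using that by (intro integral_has_vector_derivative fz zc) auto
    then have "((\<lambda>u. integral {-e..u} (\<lambda>s. f (z s))) has_vector_derivative f (z t)) (at t)"
      using at_within_Icc_at[of "-e" t e] that by (metis greaterThanLessThan_iff)
    then have "((\<lambda>u. z0 + (integral {-e..u} (\<lambda>s. f (z s)) - integral {-e..0} (\<lambda>s. f (z s))))
        has_vector_derivative (0 + (f (z t) - 0))) (at t)"
      by (intro has_vector_derivative_add has_vector_derivative_diff has_vector_derivative_const)
    then have "((\<lambda>u. z0 + (integral {-e..u} (\<lambda>s. f (z s)) - integral {-e..0} (\<lambda>s. f (z s))))
        has_vector_derivative f (z t)) (at t)" by simp
    then show ?thesis
    proof (rule has_vector_derivative_transform_within_open[where S = "{-e<..<e}"])
      show "z0 + (integral {-e..u} (\<lambda>s. f (z s)) - integral {-e..0} (\<lambda>s. f (z s))) = z u"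
        if "u \<in> {-e<..<e}" for u
        using that z[of u] by (simp add: T_def cl_def)
    qed (use that in auto)
  qed
  moreover have "z 0 = z0" using z[of 0] e by (simp add: T_def cl_def)
  ultimately show thesis using that e by blast
qed

text \<open>Compactness bounds each of the finitely many partial derivatives, their sum bounds the
  operator norm, and the mean value inequality applies because the ball is convex.\<close>

lemma smooth_on_lipschitz_cball:
  fixes f :: "'a::euclidean_space \<Rightarrow> 'b::euclidean_space"
  assumes "smooth_on S f" "cball z0 r \<subseteq> S"
  obtains L where "0 \<le> L" "\<And>x y. x \<in> cball z0 r \<Longrightarrow> y \<in> cball z0 r \<Longrightarrow>
    norm (f x - f y) \<le> L * norm (x - y)"
proof -
  let ?D = "\<lambda>x. frechet_derivative f (at x)"
  have D: "(f has_derivative ?D x) (at x)" if "x \<in> cball z0 r" for x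
    using smooth_on_imp_differentiable[OF assms(1)] assms(2) that by (auto simp: frechet_derivative_works)
  have "\<exists>M. \<forall>x\<in>cball z0 r. norm (?D x b) \<le> M" for b
  proof -
    have "continuous_on (cball z0 r) (\<lambda>x. ?D x b)"
      using smooth_on_imp_continuous_on[OF smooth_on_frechet_derivative[OF assms(1)]] assms(2)
      by (rule continuous_on_subset)
    then have "bounded ((\<lambda>x. ?D x b) ` cball z0 r)"
      by (intro compact_imp_bounded compact_continuous_image) auto
    then show ?thesis by (auto simp: bounded_iff)
  qed
  then obtain M where M: "\<And>b x. x \<in> cball z0 r \<Longrightarrow> norm (?D x b) \<le> M b" by metis
  define L where "L = (\<Sum>b\<in>Basis. \<bar>M b\<bar>)"
  have on: "onorm (?D x) \<le> L" if "x \<in> cball z0 r" for x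
  proof (rule onorm_le)
    fix v
    have "norm (?D x v) = norm (\<Sum>b\<in>Basis. (v \<bullet> b) *\<^sub>R ?D x b)"
      using linear_sum_Basis[OF has_derivative_linear[OF D[OF that]]] by metis
    also have "\<dots> \<le> (\<Sum>b\<in>Basis. norm v * \<bar>M b\<bar>)"
      using M[OF that] Basis_le_norm[of _ v]
      by (intro sum_norm_le) (auto intro!: mult_mono order_trans[OF M[OF that]])
    finally show "norm (?D x v) \<le> L * norm v" by (simp add: L_def sum_distrib_left mult.commute)
  qed
  show thesis
  proof (rule that[of L])
    show "0 \<le> L" by (simp add: L_def sum_nonneg)
    show "norm (f x - f y) \<le> L * norm (x - y)" if "x \<in> cball z0 r" "y \<in> cball z0 r" for x y
      using D has_derivative_at_withinI on that
      by (intro differentiable_bound[where S = "cball z0 r" and f' = ?D]) blast+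
  qed
qed

text \<open>Precomposing \<open>f\<close> with the nearest-point projection onto a closed ball,
  which is 1-Lipschitz, makes it globally Lipschitz. The solution starts at the centre and by
  continuity stays in the ball for a short time, during which the projection is the
  identity.\<close>

lemma ode_exists:
  fixes f :: "'a::euclidean_space \<Rightarrow> 'a"
  assumes "open S" "smooth_on S f" "z0 \<in> S"
  obtains e z where "0 < e" "z 0 = z0" "z ` {-e<..<e} \<subseteq> S"
    "\<And>t. t \<in> {-e<..<e} \<Longrightarrow> (z has_vector_derivative f (z t)) (at t)"
proof -
  obtain r where r: "0 < r" "cball z0 r \<subseteq> S" using assms open_contains_cball by metis
  obtain L where L: "0 \<le> L" "\<And>x y. x \<in> cball z0 r \<Longrightarrow> y \<in> cball z0 r \<Longrightarrow>
    norm (f x - f y) \<le> L * norm (x - y)"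
    using smooth_on_lipschitz_cball[OF assms(2) r(2)] by blast
  define P where "P = closest_point (cball z0 r)"
  have ne: "cball z0 r \<noteq> {}" using r by auto
  have P: "P x \<in> cball z0 r" "norm (P x - P y) \<le> norm (x - y)" for x y
    using closest_point_in_set[OF closed_cball ne] closest_point_lipschitz[OF convex_cball closed_cball ne]
    by (auto simp: P_def dist_norm)
  have "norm (f (P x) - f (P y)) \<le> L * norm (x - y)" for x y
    using L(2)[OF P(1) P(1), of x y] P(2)[of x y] L(1) by (meson mult_left_mono order_trans)
  then obtain e z where ez: "0 < e" "z 0 = z0"
      "\<And>t. t \<in> {-e<..<e} \<Longrightarrow> (z has_vector_derivative f (P (z t))) (at t)"
    using ode_exists_lipschitz[OF L(1), of "\<lambda>x. f (P x)"] by metis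
  have "isCont z 0" using ez(1) ez(3)[of 0] has_vector_derivative_continuous by auto
  then obtain d where d: "0 < d" "\<And>t. \<bar>t\<bar> < d \<Longrightarrow> z t \<in> cball z0 r"
    using r(1) ez(2) unfolding continuous_at_eps_delta
    by (metis dist_0_norm dist_commute less_le mem_cball real_norm_def)
  have eq: "P (z t) = z t" if "\<bar>t\<bar> < d" for t
    using d(2)[OF that] by (simp add: P_def closest_point_self)
  show thesis
  proof (rule that[of "min e d" z])
    show "z ` {-min e d<..<min e d} \<subseteq> S" using d r by force
    show "(z has_vector_derivative f (z t)) (at t)" if "t \<in> {-min e d<..<min e d}" for t
      using ez(3)[of t] eq[of t] that by (auto simp: abs_less_iff)
  qed (use ez d in auto)
qed

text \<open>Bootstrapping: if \<open>z\<close> is of class k, then so is its derivative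
  \<open>f (z t)\<close>, hence \<open>z\<close> is of class k + 1.\<close>

lemma ode_solution_smooth:
  fixes f :: "'a::euclidean_space \<Rightarrow> 'a"
  assumes "open S" "smooth_on S f" "open I" "z ` I \<subseteq> S"
    and "\<And>t. t \<in> I \<Longrightarrow> (z has_vector_derivative f (z t)) (at t)"
  shows "smooth_on I z"
  unfolding smooth_on_def
proof
  fix k
  show "Ck_on k I z"
  proof (induction k)
    case 0
    then show ?case
      by (auto intro!: continuous_at_imp_continuous_on has_vector_derivative_continuous[OF assms(5)])
  next
    case (Suc k)
    have D: "(z has_derivative (\<lambda>v. v *\<^sub>R f (z t))) (at t)" if "t \<in> I" for t
      using assms(5)[OF that] by (simp add: has_vector_derivative_def)
    have "Ck_on k I (\<lambda>t. frechet_derivative z (at t) v)" for v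
    proof (rule Ck_on_cong[OF assms(3)])
      show "Ck_on k I (\<lambda>t. v *\<^sub>R f (z t))"
        using assms(2) Suc unfolding smooth_on_def
        by (blast intro: Ck_on_scaleR[OF assms(3) Ck_on_const Ck_on_compose[OF assms(3,1,4)]])
    qed (use frechet_derivative_eqI[OF D] in auto)
    then show ?case using D by (auto simp: differentiable_def)
  qed
qed


section \<open>Charts and smooth vector fields\<close>

lemma chart_inv_chart: "is_chart c \<Longrightarrow> p \<in> fst c \<Longrightarrow> chart_inv c (snd c p) = p"
  by (auto simp: is_chart_def homeomorphism_def)

lemma chart_chart_inv: "is_chart c \<Longrightarrow> x \<in> snd c ` fst c \<Longrightarrow> snd c (chart_inv c x) = x"
  by (auto simp: is_chart_def homeomorphism_def)

lemma chart_inv_in: "is_chart c \<Longrightarrow> x \<in> snd c ` fst c \<Longrightarrow> chart_inv c x \<in> fst c"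
  by (auto simp: is_chart_def homeomorphism_def)

lemma open_chart: "is_chart c \<Longrightarrow> open (fst c)"
  by (simp add: is_chart_def)

lemma continuous_on_chart: "is_chart c \<Longrightarrow> continuous_on (fst c) (snd c)"
  by (simp add: is_chart_def homeomorphism_def)

lemma continuous_on_chart_inv: "is_chart c \<Longrightarrow> continuous_on (snd c ` fst c) (chart_inv c)"
  by (simp add: is_chart_def homeomorphism_def)

lemma open_chart_image:
  assumes "is_chart c" "open W"
  shows "open (snd c ` (W \<inter> fst c))"
proof -
  have "open (chart_inv c -` W \<inter> snd c ` fst c)"
    using assms(2) continuous_on_chart_inv[OF assms(1)]
      continuous_on_open_vimage[of "snd c ` fst c" "chart_inv c"] assms(1)[unfolded is_chart_def]
    by simp
  moreover have "chart_inv c -` W \<inter> snd c ` fst c = snd c ` (W \<inter> fst c)"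
    using chart_inv_chart[OF assms(1)] by (auto simp: image_iff)
  ultimately show ?thesis by simp
qed

lemma manifold_chart: "smooth_manifold A \<Longrightarrow> c \<in> A \<Longrightarrow> is_chart c"
  by (auto simp: smooth_manifold_def)

lemma chart_at:
  assumes "smooth_manifold A"
  shows "chart_at A p \<in> A" "p \<in> fst (chart_at A p)"
proof -
  have "\<exists>c. c \<in> A \<and> p \<in> fst c" using assms unfolding smooth_manifold_def by blast
  then have "chart_at A p \<in> A \<and> p \<in> fst (chart_at A p)" unfolding chart_at_def by (rule someI_ex)
  then show "chart_at A p \<in> A" "p \<in> fst (chart_at A p)" by auto
qed

lemma is_chart_at: "smooth_manifold A \<Longrightarrow> is_chart (chart_at A p)"
  using chart_at manifold_chart by blast

lemma transition_smooth:
  "smooth_manifold A \<Longrightarrow> c \<in> A \<Longrightarrow> d \<in> A \<Longrightarrow>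
    smooth_on (snd c ` (fst c \<inter> fst d)) (snd d \<circ> chart_inv c)"
  by (simp add: smooth_manifold_def)

lemma smooth_manifold_std: "smooth_manifold std_atlas"
  by (auto simp: smooth_manifold_def std_atlas_def is_chart_def homeomorphism_def o_def smooth_on_ident)

text \<open>\<open>differential\<close>, \<open>to_chart\<close> and \<open>of_chart\<close> are all
  instances, the last two for the identity map, so a single chain rule yields every change-of-chart
  identity.\<close>

definition coord_deriv ::
  "('m, 'e::euclidean_space) chart \<Rightarrow> ('n, 'f::euclidean_space) chart \<Rightarrow> ('m \<Rightarrow> 'n) \<Rightarrow> 'm \<Rightarrow> 'e \<Rightarrow> 'f"
  where "coord_deriv c d F p = frechet_derivative (\<lambda>x. snd d (F (chart_inv c x))) (at (snd c p))"

lemma differential_coord_deriv: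
  "differential A B F p = coord_deriv (chart_at A p) (chart_at B (F p)) F p"
  by (simp add: differential_def coord_deriv_def o_def)

lemma to_chart_coord_deriv: "to_chart A c p = coord_deriv (chart_at A p) c (\<lambda>x. x) p"
  by (simp add: to_chart_def coord_deriv_def o_def)

lemma of_chart_coord_deriv: "of_chart A c p = coord_deriv c (chart_at A p) (\<lambda>x. x) p"
  by (simp add: of_chart_def coord_deriv_def o_def)

text \<open>Inserting \<open>chart_inv e\<close> after \<open>snd e\<close> between \<open>g\<close>
  and \<open>F\<close> changes nothing near \<open>p\<close>, because \<open>F\<close> is continuous
  and maps a neighbourhood into the domain of \<open>e\<close>. After that it is the Euclidean chain
  rule. Letting \<open>g\<close> take values in a normed space covers both maps read in a chart and
  functions.\<close>

lemma coord_chain: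
  fixes g :: "'n::topological_space \<Rightarrow> 'v::real_normed_vector"
  assumes c: "is_chart c" "p \<in> fst c" and e: "is_chart e" "F p \<in> fst e"
    and W: "open W" "p \<in> W" "continuous_on W F"
    and L: "((\<lambda>x. snd e (F (chart_inv c x))) has_derivative L) (at (snd c p))"
    and M: "((\<lambda>x. g (chart_inv e x)) has_derivative M) (at (snd e (F p)))"
  shows "((\<lambda>x. g (F (chart_inv c x))) has_derivative (\<lambda>v. M (L v))) (at (snd c p))"
proof -
  define V where "V = F -` fst e \<inter> W"
  have V: "open V" "p \<in> V"
    using W e open_chart[OF e(1)] continuous_on_open_vimage[OF W(1), of F] by (auto simp: V_def)
  have *: "((\<lambda>x. g (chart_inv e (snd e (F (chart_inv c x))))) has_derivative (\<lambda>v. M (L v))) (at (snd c p))"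
    using M by (intro has_derivative_compose[OF L]) (simp add: chart_inv_chart[OF c])
  show ?thesis
    by (rule has_derivative_transform_within_open[OF * open_chart_image[OF c(1) V(1)]])
      (use V c chart_inv_chart[OF c(1)] chart_inv_chart[OF e(1)] in \<open>auto simp: V_def\<close>)
qed

lemma smooth_map_on_continuous_on: "smooth_map_on A B W F \<Longrightarrow> continuous_on W F"
  by (simp add: smooth_map_on_def)

lemma smooth_map_on_coord:
  "smooth_map_on A B W F \<Longrightarrow> c \<in> A \<Longrightarrow> d \<in> B \<Longrightarrow>
    smooth_on (snd c ` (W \<inter> fst c \<inter> F -` fst d)) (\<lambda>x. snd d (F (chart_inv c x)))"
  by (auto simp: smooth_map_on_def o_def)

lemma has_coord_deriv:
  assumes "smooth_map_on A B W F" "p \<in> W" "c \<in> A" "d \<in> B" "p \<in> fst c" "F p \<in> fst d"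
  shows "((\<lambda>x. snd d (F (chart_inv c x))) has_derivative coord_deriv c d F p) (at (snd c p))"
  unfolding coord_deriv_def
  using smooth_on_imp_differentiable[OF smooth_map_on_coord[OF assms(1,3,4)], of "snd c p"] assms
  by (auto simp: frechet_derivative_works)

lemma linear_coord_deriv:
  "smooth_map_on A B W F \<Longrightarrow> p \<in> W \<Longrightarrow> c \<in> A \<Longrightarrow> d \<in> B \<Longrightarrow> p \<in> fst c \<Longrightarrow> F p \<in> fst d \<Longrightarrow>
    linear (coord_deriv c d F p)"
  using has_coord_deriv has_derivative_linear by blast

lemma smooth_map_id: "smooth_manifold A \<Longrightarrow> smooth_map_on A A UNIV (\<lambda>x. x)"
  by (auto simp: smooth_map_on_def smooth_manifold_def o_def)

lemma coord_deriv_chain: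
  assumes A: "smooth_manifold A" and B: "smooth_manifold B" and E: "smooth_manifold E"
    and F: "smooth_map_on A B W F" "open W" "p \<in> W"
    and G: "smooth_map_on B E W' G" "F p \<in> W'"
    and c: "c \<in> A" "p \<in> fst c" and d: "d \<in> B" "F p \<in> fst d" and e: "e \<in> E" "G (F p) \<in> fst e"
  shows "coord_deriv c e (\<lambda>x. G (F x)) p v = coord_deriv d e G (F p) (coord_deriv c d F p v)"
proof -
  have "((\<lambda>x. snd e (G (F (chart_inv c x)))) has_derivative
      (\<lambda>v. coord_deriv d e G (F p) (coord_deriv c d F p v))) (at (snd c p))"
    by (rule coord_chain[where g = "\<lambda>y. snd e (G y)" and e = d and W = W])
      (use assms in \<open>auto intro: has_coord_deriv manifold_chart smooth_map_on_continuous_on\<close>)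
  then show ?thesis unfolding coord_deriv_def[of c e] using frechet_derivative_at by metis
qed

lemma coord_deriv_refl:
  assumes "is_chart c" "p \<in> fst c"
  shows "coord_deriv c c (\<lambda>x. x) p = (\<lambda>v. v)"
proof -
  have "((\<lambda>x. snd c (chart_inv c x)) has_derivative (\<lambda>v. v)) (at (snd c p))"
    by (rule has_derivative_transform_within_open[OF has_derivative_ident, of "snd c ` fst c"])
      (use assms in \<open>auto simp: chart_chart_inv is_chart_def\<close>)
  then show ?thesis unfolding coord_deriv_def by (rule frechet_derivative_eqI)
qed

section \<open>Tangent vectors, fields and functions in arbitrary charts\<close>

context
  fixes A :: "('m::{t2_space, second_countable_topology}, 'e::euclidean_space) chart set"
  assumes A: "smooth_manifold A"
begin

lemma to_chart_of_chart:
  "c \<in> A \<Longrightarrow> d \<in> A \<Longrightarrow> p \<in> fst c \<Longrightarrow> p \<in> fst d \<Longrightarrow>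
    to_chart A d p (of_chart A c p v) = coord_deriv c d (\<lambda>x. x) p v"
  unfolding to_chart_coord_deriv of_chart_coord_deriv
  using coord_deriv_chain[OF A A A smooth_map_id[OF A] _ _ smooth_map_id[OF A], of p c "chart_at A p" d v]
    chart_at[OF A] by simp

lemma to_chart_of_chart_same [simp]:
  "c \<in> A \<Longrightarrow> p \<in> fst c \<Longrightarrow> to_chart A c p (of_chart A c p v) = v"
  using coord_deriv_refl[OF manifold_chart[OF A]] by (simp add: to_chart_of_chart)

lemma of_chart_to_chart_same [simp]:
  "c \<in> A \<Longrightarrow> p \<in> fst c \<Longrightarrow> of_chart A c p (to_chart A c p v) = v"
  unfolding to_chart_coord_deriv of_chart_coord_deriv
  using coord_deriv_chain[OF A A A smooth_map_id[OF A] _ _ smooth_map_id[OF A], of p "chart_at A p" c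
      "chart_at A p" v] chart_at[OF A] coord_deriv_refl[OF is_chart_at[OF A]] by simp

lemma linear_to_chart: "c \<in> A \<Longrightarrow> p \<in> fst c \<Longrightarrow> linear (to_chart A c p)"
  unfolding to_chart_coord_deriv
  using linear_coord_deriv[OF smooth_map_id[OF A]] chart_at[OF A] by simp

lemma linear_of_chart: "c \<in> A \<Longrightarrow> p \<in> fst c \<Longrightarrow> linear (of_chart A c p)"
  unfolding of_chart_coord_deriv
  using linear_coord_deriv[OF smooth_map_id[OF A]] chart_at[OF A] by simp

lemma to_chart_at [simp]: "to_chart A (chart_at A p) p = (\<lambda>v. v)"
  using coord_deriv_refl[OF is_chart_at[OF A]] chart_at[OF A] by (simp add: to_chart_coord_deriv)

lemma of_chart_at [simp]: "of_chart A (chart_at A p) p = (\<lambda>v. v)"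
  using coord_deriv_refl[OF is_chart_at[OF A]] chart_at[OF A] by (simp add: of_chart_coord_deriv)

text \<open>Both sides are the coordinate derivative of \<open>F\<close> from the preferred chart at
  \<open>p\<close> to \<open>d\<close>, factored once through the preferred chart at
  \<open>F p\<close> and once through \<open>c\<close>.\<close>

lemma coord_deriv_to_chart:
  assumes B: "smooth_manifold B"
    and F: "smooth_map_on A B W F" "open W" "p \<in> W"
    and c: "c \<in> A" "p \<in> fst c" and d: "d \<in> B" "F p \<in> fst d"
  shows "to_chart B d (F p) (differential A B F p v) = coord_deriv c d F p (to_chart A c p v)"
  using coord_deriv_chain[OF A A B smooth_map_id[OF A] open_UNIV UNIV_I F(1,3) chart_at[OF A] c d, of v]
    coord_deriv_chain[OF A B B F smooth_map_id[OF B] UNIV_I chart_at[OF A] chart_at[OF B] d, of v]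
  by (simp add: to_chart_coord_deriv differential_coord_deriv)

lemma linear_differential:
  "smooth_manifold B \<Longrightarrow> smooth_map_on A B W F \<Longrightarrow> p \<in> W \<Longrightarrow> linear (differential A B F p)"
  unfolding differential_coord_deriv
  using linear_coord_deriv chart_at[OF A] chart_at by blast

lemma differential_id: "differential A A (\<lambda>x. x) p = (\<lambda>v. v)"
  using coord_deriv_refl[OF is_chart_at[OF A]] chart_at[OF A] by (simp add: differential_coord_deriv)

lemma to_chart_change:
  "c \<in> A \<Longrightarrow> d \<in> A \<Longrightarrow> p \<in> fst c \<Longrightarrow> p \<in> fst d \<Longrightarrow>
    to_chart A d p v = coord_deriv c d (\<lambda>x. x) p (to_chart A c p v)"
  using coord_deriv_to_chart[OF A smooth_map_id[OF A] open_UNIV UNIV_I, of c p d v]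
  by (simp add: differential_id)

text \<open>Smoothness can be tested in one chart covering \<open>W\<close>: components in another
  chart \<open>d\<close> arise by applying the Jacobian of the transition map, which is
  smooth.\<close>

lemma smooth_field_onI:
  assumes c: "c \<in> A" and W: "open W" "W \<subseteq> fst c"
    and X: "smooth_on (snd c ` W) (\<lambda>x. to_chart A c (chart_inv c x) (X (chart_inv c x)))"
  shows "smooth_field_on A W X"
  unfolding smooth_field_on_def
proof
  fix d assume d: "d \<in> A"
  note cc = manifold_chart[OF A c] and dc = manifold_chart[OF A d]
  let ?\<tau> = "\<lambda>x. snd c (chart_inv d x)" and ?\<sigma> = "\<lambda>x. snd d (chart_inv c x)"
  let ?S = "snd d ` (W \<inter> fst d)" and ?T = "snd c ` (W \<inter> fst d)"
  let ?X = "\<lambda>x. to_chart A c (chart_inv c x) (X (chart_inv c x))"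
  have oS: "open ?S" by (rule open_chart_image[OF dc W(1)])
  have oT: "open ?T"
    using open_chart_image[OF cc open_Int[OF W(1) open_chart[OF dc]]] W(2)
    by (simp add: inf.absorb1 inf.coboundedI1)
  have st: "smooth_on ?T ?\<sigma>"
    using smooth_on_subset[OF transition_smooth[OF A c d], of ?T] W(2) by (auto simp: o_def)
  have "smooth_on ?T (\<lambda>x. frechet_derivative ?\<sigma> (at x) (?X x))"
    by (rule smooth_on_frechet_derivative_field[OF oT st smooth_on_subset[OF X]]) auto
  moreover have "smooth_on ?S ?\<tau>"
    using smooth_on_subset[OF transition_smooth[OF A d c], of ?S] W(2) by (auto simp: o_def)
  moreover have "?\<tau> ` ?S \<subseteq> ?T" using chart_inv_chart[OF dc] by auto
  ultimately have "smooth_on ?S (\<lambda>x. frechet_derivative ?\<sigma> (at (?\<tau> x)) (?X (?\<tau> x)))"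
    using smooth_on_compose[OF oS oT] by blast
  then show "smooth_on ?S (\<lambda>x. to_chart A d (chart_inv d x) (X (chart_inv d x)))"
  proof (rule smooth_on_cong[OF oS])
    fix x assume "x \<in> ?S"
    then obtain q where q: "q \<in> W" "q \<in> fst d" "x = snd d q" by auto
    then show "frechet_derivative ?\<sigma> (at (?\<tau> x)) (?X (?\<tau> x)) =
        to_chart A d (chart_inv d x) (X (chart_inv d x))"
      using to_chart_change[OF c d, of q] W(2) chart_inv_chart[OF dc, of q] chart_inv_chart[OF cc, of q]
      by (auto simp: coord_deriv_def)
  qed
qed

lemma smooth_fun_onI:
  assumes c: "c \<in> A" and W: "open W" "W \<subseteq> fst c"
    and f: "smooth_on (snd c ` W) (\<lambda>x. f (chart_inv c x))"
  shows "smooth_fun_on A W f"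
  unfolding smooth_map_on_def
proof (intro conjI ballI)
  note cc = manifold_chart[OF A c]
  have "continuous_on W (\<lambda>q. f (chart_inv c (snd c q)))"
    by (rule continuous_on_compose2[OF smooth_on_imp_continuous_on[OF f]])
      (use W(2) continuous_on_chart[OF cc] continuous_on_subset in auto)
  then show "continuous_on W f"
    by (rule continuous_on_eq) (use W(2) chart_inv_chart[OF cc] in auto)
  fix d s assume d: "d \<in> A" and "s \<in> (std_atlas :: (real, real) chart set)"
  then have s: "s = (UNIV, \<lambda>x. x)" by (simp add: std_atlas_def)
  note dc = manifold_chart[OF A d]
  let ?S = "snd d ` (W \<inter> fst d)"
  have oS: "open ?S" by (rule open_chart_image[OF dc W(1)])
  have oT: "open (snd c ` W)" using open_chart_image[OF cc W(1)] W(2) by (simp add: inf.absorb1)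
  have "smooth_on ?S (snd c \<circ> chart_inv d)"
    using smooth_on_subset[OF transition_smooth[OF A d c], of ?S] W(2) by auto
  moreover have "(snd c \<circ> chart_inv d) ` ?S \<subseteq> snd c ` W" using chart_inv_chart[OF dc] by auto
  ultimately have "smooth_on ?S (\<lambda>x. f (chart_inv c ((snd c \<circ> chart_inv d) x)))"
    using smooth_on_compose[OF oS oT _ f] by blast
  then have "smooth_on ?S (f \<circ> chart_inv d)"
    by (rule smooth_on_cong[OF oS])
      (use W(2) chart_inv_chart[OF dc] chart_inv_chart[OF cc] in auto)
  then show "smooth_on (snd d ` (W \<inter> fst d \<inter> f -` fst s)) (snd s \<circ> f \<circ> chart_inv d)"
    by (simp add: s o_def)
qed

lemma smooth_fun_on_coord:
  "smooth_fun_on A W f \<Longrightarrow> c \<in> A \<Longrightarrow> smooth_on (snd c ` (W \<inter> fst c)) (\<lambda>x. f (chart_inv c x))"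
  using smooth_map_on_coord[of A std_atlas W f c "(UNIV, \<lambda>x. x)"] by (simp add: std_atlas_def)

lemma smooth_field_on_coord:
  "smooth_field_on A W X \<Longrightarrow> c \<in> A \<Longrightarrow>
    smooth_on (snd c ` (W \<inter> fst c)) (\<lambda>x. to_chart A c (chart_inv c x) (X (chart_inv c x)))"
  by (simp add: smooth_field_on_def)

lemma smooth_field_on_subset: "smooth_field_on A W X \<Longrightarrow> V \<subseteq> W \<Longrightarrow> smooth_field_on A V X"
  unfolding smooth_field_on_def by (meson Int_mono image_mono order_refl smooth_on_subset)

lemma smooth_field_on_coord_field:
  assumes "c \<in> A" shows "smooth_field_on A (fst c) (\<lambda>q. of_chart A c q b)"
proof (rule smooth_field_onI[OF assms open_chart[OF manifold_chart[OF A assms]] order_refl])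
  show "smooth_on (snd c ` fst c) (\<lambda>x. to_chart A c (chart_inv c x) (of_chart A c (chart_inv c x) b))"
  proof (rule smooth_on_cong[where f = "\<lambda>x. b"])
    show "open (snd c ` fst c)" using manifold_chart[OF A assms] by (simp add: is_chart_def)
  qed (use chart_inv_in[OF manifold_chart[OF A assms]] assms in auto)
qed

lemma to_chart_in_image:
  assumes "c \<in> A" "x \<in> snd c ` (W \<inter> fst c)"
  shows "linear (to_chart A c (chart_inv c x))" "chart_inv c x \<in> W" "chart_inv c x \<in> fst c"
  using assms chart_inv_chart[OF manifold_chart[OF A assms(1)]] by (auto intro!: linear_to_chart)

lemma smooth_field_on_add:
  assumes "open W" "smooth_field_on A W X" "smooth_field_on A W Y"
  shows "smooth_field_on A W (\<lambda>q. X q + Y q)"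
  unfolding smooth_field_on_def
proof
  fix c assume c: "c \<in> A"
  note o = open_chart_image[OF manifold_chart[OF A c] assms(1)]
  show "smooth_on (snd c ` (W \<inter> fst c))
      (\<lambda>x. to_chart A c (chart_inv c x) (X (chart_inv c x) + Y (chart_inv c x)))"
    by (rule smooth_on_cong[OF o smooth_on_add[OF o smooth_field_on_coord[OF assms(2) c]
            smooth_field_on_coord[OF assms(3) c]]])
      (simp add: linear_add[OF to_chart_in_image(1)[OF c]])
qed

lemma smooth_field_on_scaleR:
  assumes "open W" "smooth_fun_on A W f" "smooth_field_on A W X"
  shows "smooth_field_on A W (\<lambda>q. f q *\<^sub>R X q)"
  unfolding smooth_field_on_def
proof
  fix c assume c: "c \<in> A"
  note o = open_chart_image[OF manifold_chart[OF A c] assms(1)]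
  show "smooth_on (snd c ` (W \<inter> fst c))
      (\<lambda>x. to_chart A c (chart_inv c x) (f (chart_inv c x) *\<^sub>R X (chart_inv c x)))"
    by (rule smooth_on_cong[OF o smooth_on_scaleR[OF o smooth_fun_on_coord[OF assms(2) c]
            smooth_field_on_coord[OF assms(3) c]]])
      (simp add: linear_scale[OF to_chart_in_image(1)[OF c]])
qed

lemma smooth_field_on_const_scaleR:
  assumes "open W" "smooth_field_on A W X"
  shows "smooth_field_on A W (\<lambda>q. a *\<^sub>R X q)"
  unfolding smooth_field_on_def
proof
  fix c assume c: "c \<in> A"
  note o = open_chart_image[OF manifold_chart[OF A c] assms(1)]
  show "smooth_on (snd c ` (W \<inter> fst c)) (\<lambda>x. to_chart A c (chart_inv c x) (a *\<^sub>R X (chart_inv c x)))"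
    by (rule smooth_on_cong[OF o smooth_on_bounded_linear[OF o bounded_linear_scaleR_right[of a]
            smooth_field_on_coord[OF assms(2) c]]])
      (simp add: linear_scale[OF to_chart_in_image(1)[OF c]])
qed

lemma smooth_field_on_zero: "open W \<Longrightarrow> smooth_field_on A W (\<lambda>q. 0)"
  unfolding smooth_field_on_def
proof
  fix c assume "open W" and c: "c \<in> A"
  note o = open_chart_image[OF manifold_chart[OF A c] \<open>open W\<close>]
  show "smooth_on (snd c ` (W \<inter> fst c)) (\<lambda>x. to_chart A c (chart_inv c x) 0)"
    by (rule smooth_on_cong[OF o smooth_on_const]) (simp add: linear_0[OF to_chart_in_image(1)[OF c]])
qed

lemma smooth_field_on_sum:
  assumes "open W" "\<And>i. i \<in> K \<Longrightarrow> smooth_field_on A W (X i)"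
  shows "smooth_field_on A W (\<lambda>q. \<Sum>i\<in>K. X i q)"
  using assms(2)
  by (induction K rule: infinite_finite_induct)
    (auto intro: smooth_field_on_add smooth_field_on_zero assms(1))

end


section \<open>Derivatives of functions and connections in coordinates\<close>

text \<open>A relational counterpart of \<open>dfun\<close>: it records differentiability, which
  \<open>dfun\<close> cannot, and allows vector values such as the components of a field. The
  preferred chart is used so that \<open>L\<close> acts on the tangent space as it is identified
  with the model space.\<close>

definition has_mderiv ::
  "('m, 'e::euclidean_space) chart set \<Rightarrow> ('m \<Rightarrow> 'v::real_normed_vector) \<Rightarrow> 'm \<Rightarrow> ('e \<Rightarrow> 'v) \<Rightarrow> bool"
  where "has_mderiv A f p L \<longleftrightarrow>
    ((\<lambda>x. f (chart_inv (chart_at A p) x)) has_derivative L) (at (snd (chart_at A p) p))"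

lemma has_mderiv_std: "has_mderiv std_atlas f t L \<longleftrightarrow> (f has_derivative L) (at t)"
  by (simp add: has_mderiv_def)

lemma has_mderiv_unique: "has_mderiv A f p L \<Longrightarrow> has_mderiv A f p M \<Longrightarrow> L = M"
  unfolding has_mderiv_def by (rule has_derivative_unique)

lemma has_mderiv_linear: "has_mderiv A f p L \<Longrightarrow> linear L"
  unfolding has_mderiv_def by (rule has_derivative_linear)

lemma dfun_eqI: "has_mderiv A f p L \<Longrightarrow> dfun A f p = L"
  by (simp add: has_mderiv_def differential_def o_def frechet_derivative_eqI)

lemma has_mderiv_const: "has_mderiv A (\<lambda>q. c) p (\<lambda>v. 0)"
  by (simp add: has_mderiv_def)

lemma has_mderiv_diff:
  "has_mderiv A f p L \<Longrightarrow> has_mderiv A h p M \<Longrightarrow> has_mderiv A (\<lambda>q. f q - h q) p (\<lambda>v. L v - M v)"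
  unfolding has_mderiv_def by (rule has_derivative_diff)

lemma has_mderiv_bounded_linear:
  "bounded_linear T \<Longrightarrow> has_mderiv A f p L \<Longrightarrow> has_mderiv A (\<lambda>q. T (f q)) p (\<lambda>v. T (L v))"
  unfolding has_mderiv_def by (rule bounded_linear.has_derivative)

lemma has_mderiv_inner_left: "has_mderiv A f p L \<Longrightarrow> has_mderiv A (\<lambda>q. f q \<bullet> b) p (\<lambda>v. L v \<bullet> b)"
  by (rule has_mderiv_bounded_linear[OF bounded_linear_inner_left])

lemma has_mderiv_mult_left:
  "has_mderiv A f p L \<Longrightarrow> has_mderiv A (\<lambda>q. (c::real) * f q) p (\<lambda>v. c * L v)"
  by (rule has_mderiv_bounded_linear[OF bounded_linear_mult_right])

lemma has_mderiv_sum: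
  "(\<And>i. i \<in> K \<Longrightarrow> has_mderiv A (f i) p (L i)) \<Longrightarrow>
    has_mderiv A (\<lambda>q. \<Sum>i\<in>K. f i q) p (\<lambda>v. \<Sum>i\<in>K. L i v)"
  unfolding has_mderiv_def by (rule has_derivative_sum)

context
  fixes A :: "('m::{t2_space, second_countable_topology}, 'e::euclidean_space) chart set"
  assumes A: "smooth_manifold A"
begin

lemma chart_inv_at: "chart_inv (chart_at A p) (snd (chart_at A p) p) = p"
  by (rule chart_inv_chart[OF is_chart_at[OF A] chart_at(2)[OF A]])

lemma has_mderiv_scaleR:
  "has_mderiv A f p L \<Longrightarrow> has_mderiv A h p M \<Longrightarrow>
    has_mderiv A (\<lambda>q. f q *\<^sub>R h q) p (\<lambda>v. f p *\<^sub>R M v + L v *\<^sub>R h p)"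
  unfolding has_mderiv_def by (drule (1) has_derivative_scaleR) (simp add: chart_inv_at)

lemma has_mderiv_mult:
  fixes f :: "'m \<Rightarrow> real"
  shows "has_mderiv A f p L \<Longrightarrow> has_mderiv A h p M \<Longrightarrow>
    has_mderiv A (\<lambda>q. f q * h q) p (\<lambda>v. f p * M v + L v * h p)"
  using has_mderiv_scaleR[of f p L h M] by simp

lemma has_mderiv_exp:
  fixes f :: "'m \<Rightarrow> real"
  shows "has_mderiv A f p L \<Longrightarrow> has_mderiv A (\<lambda>q. exp (f q)) p (\<lambda>v. L v * exp (f p))"
  unfolding has_mderiv_def by (drule has_derivative_exp) (simp add: chart_inv_at)

lemma has_mderiv_cong:
  assumes "open W" "p \<in> W" "\<And>q. q \<in> W \<Longrightarrow> f q = h q" "has_mderiv A f p L"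
  shows "has_mderiv A h p L"
  using assms(4) unfolding has_mderiv_def
  by (rule has_derivative_transform_within_open
      [OF _ open_chart_image[OF is_chart_at[OF A, of p] assms(1)]])
    (use assms(2,3) chart_at[OF A] chart_inv_chart[OF is_chart_at[OF A]] in auto)

lemma has_mderiv_min:
  fixes f :: "'m \<Rightarrow> real"
  assumes "open W" "p \<in> W" "\<And>q. q \<in> W \<Longrightarrow> f p \<le> f q" "has_mderiv A f p L"
  shows "L v = 0"
proof -
  let ?c = "chart_at A p"
  have "L = (\<lambda>v. 0)"
    using assms(4) unfolding has_mderiv_def
  proof (rule differential_zero_maxmin[OF _ open_chart_image[OF is_chart_at[OF A, of p] assms(1)], rotated])
    show "snd ?c p \<in> snd ?c ` (W \<inter> fst ?c)" using assms(2) chart_at[OF A] by auto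
  qed (use assms(3) chart_inv_chart[OF is_chart_at[OF A]] in \<open>auto simp: chart_inv_at\<close>)
  then show ?thesis by simp
qed

lemma has_mderiv_chain:
  assumes B: "smooth_manifold B" and F: "smooth_map_on A B W F" "open W" "p \<in> W"
    and h: "has_mderiv B h (F p) L"
  shows "has_mderiv A (\<lambda>q. h (F q)) p (\<lambda>v. L (differential A B F p v))"
  unfolding has_mderiv_def differential_coord_deriv
  by (rule coord_chain[where e = "chart_at B (F p)" and W = W])
    (use assms chart_at[OF A] chart_at[OF B] is_chart_at[OF A] is_chart_at[OF B] has_coord_deriv[OF F(1)]
      in \<open>auto simp: has_mderiv_def smooth_map_on_def\<close>)

lemma has_mderivI_chart:
  assumes "c \<in> A" "p \<in> fst c" "((\<lambda>x. f (chart_inv c x)) has_derivative L) (at (snd c p))"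
  shows "has_mderiv A f p (\<lambda>v. L (to_chart A c p v))"
  unfolding has_mderiv_def to_chart_coord_deriv
  by (rule coord_chain[where e = c and W = UNIV and F = "\<lambda>x. x"])
    (use assms chart_at[OF A] is_chart_at[OF A] manifold_chart[OF A]
      has_coord_deriv[OF smooth_map_id[OF A]] in auto)

lemma has_mderivI_smooth:
  assumes "c \<in> A" "p \<in> fst c" "p \<in> W"
    and "smooth_on (snd c ` (W \<inter> fst c)) (\<lambda>x. f (chart_inv c x))"
  obtains L where "has_mderiv A f p L"
proof -
  have "(\<lambda>x. f (chart_inv c x)) differentiable at (snd c p)"
    by (rule smooth_on_imp_differentiable[OF assms(4)]) (use assms in auto)
  then show thesis using has_mderivI_chart[OF assms(1,2)] that by (auto simp: differentiable_def)
qed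

lemma has_mderiv_dfun:
  assumes "smooth_fun_on A W f" "p \<in> W"
  shows "has_mderiv A f p (dfun A f p)"
proof -
  obtain L where "has_mderiv A f p L"
    using has_mderivI_smooth[OF chart_at[OF A] assms(2) smooth_fun_on_coord[OF A assms(1) chart_at(1)[OF A]]]
    by blast
  then show ?thesis by (simp add: dfun_eqI)
qed

lemma has_mderiv_field:
  assumes "smooth_field_on A W X" "p \<in> W" "c \<in> A" "p \<in> fst c"
  obtains L where "has_mderiv A (\<lambda>q. to_chart A c q (X q)) p L"
  using has_mderivI_smooth[OF assms(3,4,2) smooth_field_on_coord[OF A assms(1,3)]] by blast

lemma smooth_fun_on_field_coord:
  assumes "open W" "smooth_field_on A W X" "c \<in> A" "W \<subseteq> fst c"
  shows "smooth_fun_on A W (\<lambda>q. to_chart A c q (X q) \<bullet> b)"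
proof (rule smooth_fun_onI[OF A assms(3,1,4)])
  have "open (snd c ` W)"
    using open_chart_image[OF manifold_chart[OF A assms(3)] assms(1)] assms(4) by (simp add: inf.absorb1)
  then show "smooth_on (snd c ` W) (\<lambda>x. to_chart A c (chart_inv c x) (X (chart_inv c x)) \<bullet> b)"
    using smooth_on_inner_left smooth_field_on_coord[OF A assms(2,3)] assms(4) by (simp add: inf.absorb1)
qed

lemma field_coord_sum:
  assumes "c \<in> A" "q \<in> fst c"
  shows "v = (\<Sum>b\<in>Basis. (to_chart A c q v \<bullet> b) *\<^sub>R of_chart A c q b)"
  using linear_sum_Basis[OF linear_of_chart[OF A assms], of "to_chart A c q v"]
  by (simp add: of_chart_to_chart_same[OF A assms])

end

section \<open>Connections in coordinates\<close>

context
  fixes B :: "('n::{t2_space, second_countable_topology}, 'f::euclidean_space) chart set"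
    and nab :: "('n \<Rightarrow> 'f) \<Rightarrow> 'n \<Rightarrow> 'f \<Rightarrow> 'f"
  assumes B: "smooth_manifold B" and nab: "affine_connection B nab"
begin

lemmas nab_axioms = nab[unfolded affine_connection_def, THEN spec, THEN mp, THEN spec, THEN mp]

lemma nab_linear: "open W \<Longrightarrow> smooth_field_on B W Y \<Longrightarrow> q \<in> W \<Longrightarrow> linear (nab Y q)"
  using nab_axioms[THEN conjunct1, rule_format] .

lemma nab_smooth:
  "open W \<Longrightarrow> smooth_field_on B W Y \<Longrightarrow> smooth_field_on B W X \<Longrightarrow>
    smooth_field_on B W (\<lambda>p. nab Y p (X p))"
  using nab_axioms[THEN conjunct2, THEN conjunct1, rule_format] .

lemma nab_cong:
  "open W \<Longrightarrow> smooth_field_on B W Y \<Longrightarrow> (\<And>q. q \<in> W \<Longrightarrow> Z q = Y q) \<Longrightarrow> q \<in> W \<Longrightarrow> nab Z q = nab Y q"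
  using nab_axioms[THEN conjunct2, THEN conjunct2, THEN conjunct1, rule_format] .

lemma nab_add:
  "open W \<Longrightarrow> smooth_field_on B W Y \<Longrightarrow> smooth_field_on B W Z \<Longrightarrow> p \<in> W \<Longrightarrow>
    nab (\<lambda>q. Y q + Z q) p v = nab Y p v + nab Z p v"
  using nab_axioms[THEN conjunct2, THEN conjunct2, THEN conjunct2, THEN conjunct1, rule_format] .

lemma nab_scaleR:
  "open W \<Longrightarrow> smooth_field_on B W Y \<Longrightarrow> smooth_fun_on B W f \<Longrightarrow> p \<in> W \<Longrightarrow>
    nab (\<lambda>q. f q *\<^sub>R Y q) p v = dfun B f p v *\<^sub>R Y p + f p *\<^sub>R nab Y p v"
  using nab_axioms[THEN conjunct2, THEN conjunct2, THEN conjunct2, THEN conjunct2, rule_format] .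

lemma nab_zero: "nab (\<lambda>q. 0) p v = 0"
  using nab_add[OF open_UNIV smooth_field_on_zero[OF B open_UNIV] smooth_field_on_zero[OF B open_UNIV]]
  by simp

lemma nab_sum:
  assumes "open W" "finite K" "\<And>i. i \<in> K \<Longrightarrow> smooth_field_on B W (X i)" "p \<in> W"
  shows "nab (\<lambda>q. \<Sum>i\<in>K. X i q) p v = (\<Sum>i\<in>K. nab (X i) p v)"
  using assms(2,3)
  by (induction K) (simp_all add: nab_zero nab_add[OF assms(1) _ smooth_field_on_sum[OF B assms(1)] assms(4)])

text \<open>Expansion of \<open>Y\<close> in the coordinate frame and the Leibniz rule: one term
  differentiates the components, the sum carries the Christoffel symbols.\<close>

lemma nab_coord:
  assumes W: "open W" "q \<in> W" "smooth_field_on B W Y" and d: "d \<in> B" "q \<in> fst d"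
    and L: "has_mderiv B (\<lambda>y. to_chart B d y (Y y)) q L"
  shows "nab Y q w = of_chart B d q (L w) +
    (\<Sum>b\<in>Basis. (to_chart B d q (Y q) \<bullet> b) *\<^sub>R nab (\<lambda>y. of_chart B d y b) q w)"
proof -
  define V where "V = W \<inter> fst d"
  define f where "f = (\<lambda>b y. to_chart B d y (Y y) \<bullet> b)"
  let ?E = "\<lambda>b y. of_chart B d y b"
  have V: "open V" "q \<in> V" using W d open_chart[OF manifold_chart[OF B d(1)]] by (auto simp: V_def)
  have Y: "smooth_field_on B V Y" using smooth_field_on_subset[OF B W(3)] by (simp add: V_def)
  have f: "smooth_fun_on B V (f b)" for b
    unfolding f_def by (rule smooth_fun_on_field_coord[OF B V(1) Y d(1)]) (simp add: V_def)
  have E: "smooth_field_on B V (?E b)" for b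
    using smooth_field_on_subset[OF B smooth_field_on_coord_field[OF B d(1)]] by (simp add: V_def)
  have df: "dfun B (f b) q = (\<lambda>w. L w \<bullet> b)" for b
    unfolding f_def by (rule dfun_eqI[OF has_mderiv_inner_left[OF L]])
  have "nab Y q w = nab (\<lambda>y. \<Sum>b\<in>Basis. f b y *\<^sub>R ?E b y) q w"
    using nab_cong[OF V(1) Y, of "\<lambda>y. \<Sum>b\<in>Basis. f b y *\<^sub>R ?E b y" q] V(2)
      field_coord_sum[OF B d(1)] by (simp add: f_def V_def)
  also have "\<dots> = (\<Sum>b\<in>Basis. (L w \<bullet> b) *\<^sub>R ?E b q + f b q *\<^sub>R nab (?E b) q w)"
    by (simp add: nab_sum[OF V(1) finite_Basis smooth_field_on_scaleR[OF B V(1) f E] V(2)]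
        nab_scaleR[OF V(1) E f V(2)] df)
  finally show ?thesis
    using linear_sum_Basis[OF linear_of_chart[OF B d], of "L w"] by (simp add: sum.distrib f_def)
qed

lemma pullback_conn_chart_at:
  assumes "has_mderiv A (\<lambda>q. to_chart B (chart_at B (F p)) (F q) (V q)) p L"
  shows "pullback_conn A B nab F V p v = L v + (\<Sum>b\<in>Basis. (V p \<bullet> b) *\<^sub>R
    nab (\<lambda>y. of_chart B (chart_at B (F p)) y b) (F p) (differential A B F p v))"
proof -
  have "dfun A (\<lambda>q. to_chart B (chart_at B (F p)) (F q) (V q) \<bullet> b) p = (\<lambda>v. L v \<bullet> b)" for b
    by (rule dfun_eqI[OF has_mderiv_inner_left[OF assms]])
  then show ?thesis
    by (simp add: pullback_conn_def Let_def to_chart_at[OF B] of_chart_at[OF B] sum.distrib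
        euclidean_representation)
qed

end

text \<open>The values \<open>V q\<close> lie in different tangent spaces with jumping
  identifications, so differentiability at \<open>p\<close> refers to components in the single chart
  fixed at \<open>F p\<close>, the one that \<open>pullback_conn\<close> uses.\<close>

definition section_diff where
  "section_diff A B F V p \<longleftrightarrow> (\<exists>L. has_mderiv A (\<lambda>q. to_chart B (chart_at B (F p)) (F q) (V q)) p L)"

lemma bilinear_sum_Basis:
  fixes h :: "'f::euclidean_space \<Rightarrow> 'f \<Rightarrow> real"
  assumes "bilinear h"
  shows "h u v = (\<Sum>a\<in>Basis. \<Sum>b\<in>Basis. (u \<bullet> a) * ((v \<bullet> b) * h a b))"
proof -
  have l: "linear (\<lambda>u. h u v)" for v using assms by (simp add: bilinear_def)
  have r: "linear (h a)" for a using assms by (simp add: bilinear_def)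
  have "h u v = (\<Sum>a\<in>Basis. (u \<bullet> a) * h a v)"
    using linear_sum_Basis[OF l, of u v] by simp
  also have "\<dots> = (\<Sum>a\<in>Basis. (u \<bullet> a) * (\<Sum>b\<in>Basis. (v \<bullet> b) * h a b))"
    by (rule sum.cong[OF refl]) (use linear_sum_Basis[OF r, of _ v] in simp)
  finally show ?thesis by (simp add: sum_distrib_left)
qed

section \<open>Differentiation of sections along a map\<close>

context
  fixes A :: "('m::{t2_space, second_countable_topology}, 'e::euclidean_space) chart set"
    and B :: "('n::{t2_space, second_countable_topology}, 'f::euclidean_space) chart set"
    and nab :: "('n \<Rightarrow> 'f) \<Rightarrow> 'n \<Rightarrow> 'f \<Rightarrow> 'f"
    and F :: "'m \<Rightarrow> 'n" and W :: "'m set" and p :: 'm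
  assumes A: "smooth_manifold A" and B: "smooth_manifold B" and nab: "affine_connection B nab"
    and F: "smooth_map_on A B W F" and W: "open W" and p: "p \<in> W"
begin

lemma open_preimage: "open U \<Longrightarrow> open (F -` U \<inter> W)"
  using continuous_on_open_vimage[OF W, of F] smooth_map_on_continuous_on[OF F] by blast

text \<open>In the preferred chart at \<open>F p\<close> both derivatives have the same Christoffel
  terms, and the chain rule identifies the derivatives of the components.\<close>

lemma section_diff_field:
  assumes "open U" "F p \<in> U" "smooth_field_on B U Y"
  shows "section_diff A B F (\<lambda>q. Y (F q)) p"
    "pullback_conn A B nab F (\<lambda>q. Y (F q)) p v = nab Y (F p) (differential A B F p v)"
proof -
  let ?d = "chart_at B (F p)"
  obtain L where L: "has_mderiv B (\<lambda>y. to_chart B ?d y (Y y)) (F p) L"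
    by (rule has_mderiv_field[OF B assms(3,2) chart_at[OF B]])
  have L': "has_mderiv A (\<lambda>q. to_chart B ?d (F q) (Y (F q))) p (\<lambda>v. L (differential A B F p v))"
    by (rule has_mderiv_chain[OF A B F W p L])
  then show "section_diff A B F (\<lambda>q. Y (F q)) p" by (auto simp: section_diff_def)
  show "pullback_conn A B nab F (\<lambda>q. Y (F q)) p v = nab Y (F p) (differential A B F p v)"
    by (simp add: pullback_conn_chart_at[OF B nab L'] nab_coord[OF B nab assms chart_at[OF B] L]
        to_chart_at[OF B] of_chart_at[OF B])
qed

text \<open>Chart independence of \<open>pullback_conn\<close>, whose definition is tied to the
  preferred chart at \<open>F p\<close>. The geodesic equation needs it, since a curve is solved for
  in one fixed chart while the preferred chart jumps along it.\<close>

lemma pullback_conn_chart: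
  assumes d: "d \<in> B" "F p \<in> fst d"
    and L: "has_mderiv A (\<lambda>q. to_chart B d (F q) (V q)) p L"
  shows "section_diff A B F V p"
    "pullback_conn A B nab F V p v = of_chart B d (F p) (L v) +
      (\<Sum>b\<in>Basis. (to_chart B d (F p) (V p) \<bullet> b) *\<^sub>R
        nab (\<lambda>y. of_chart B d y b) (F p) (differential A B F p v))"
proof -
  let ?e = "chart_at B (F p)"
  let ?E = "\<lambda>b y. of_chart B d y b"
  let ?c = "\<lambda>b q. to_chart B d (F q) (V q) \<bullet> b"
  let ?w = "differential A B F p v"
  let ?N = "\<lambda>a. nab (\<lambda>y. of_chart B ?e y a) (F p) ?w"
  have dc: "open (fst d)" by (rule open_chart[OF manifold_chart[OF B d(1)]])
  have E: "smooth_field_on B (fst d) (?E b)" for b by (rule smooth_field_on_coord_field[OF B d(1)])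
  have "\<exists>dK. has_mderiv B (\<lambda>y. to_chart B ?e y (?E b y)) (F p) dK" for b
    using has_mderiv_field[OF B E d(2) chart_at[OF B]] by metis
  then obtain dK where dK: "has_mderiv B (\<lambda>y. to_chart B ?e y (?E b y)) (F p) (dK b)" for b
    by metis
  have *: "has_mderiv A (\<lambda>q. \<Sum>b\<in>Basis. ?c b q *\<^sub>R to_chart B ?e (F q) (?E b (F q))) p
     (\<lambda>v. \<Sum>b\<in>Basis. ?c b p *\<^sub>R dK b (differential A B F p v) +
        (L v \<bullet> b) *\<^sub>R to_chart B ?e (F p) (?E b (F p)))"
    by (intro has_mderiv_sum has_mderiv_scaleR[OF A] has_mderiv_inner_left[OF L]
        has_mderiv_chain[OF A B F W p dK])
  have **: "has_mderiv A (\<lambda>q. to_chart B ?e (F q) (V q)) p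
     (\<lambda>v. \<Sum>b\<in>Basis. ?c b p *\<^sub>R dK b (differential A B F p v) + (L v \<bullet> b) *\<^sub>R ?E b (F p))"
  proof (rule has_mderiv_cong[OF A open_preimage[of "fst d \<inter> fst ?e"]])
    show "open (fst d \<inter> fst ?e)" using dc open_chart[OF is_chart_at[OF B]] by blast
    show "p \<in> F -` (fst d \<inter> fst ?e) \<inter> W" using d p chart_at[OF B] by auto
    fix q assume q: "q \<in> F -` (fst d \<inter> fst ?e) \<inter> W"
    have lin: "linear (to_chart B ?e (F q))" using q chart_at[OF B] by (intro linear_to_chart[OF B]) auto
    have "to_chart B ?e (F q) (V q) = to_chart B ?e (F q) (\<Sum>b\<in>Basis. ?c b q *\<^sub>R ?E b (F q))"
      using field_coord_sum[OF B d(1), of "F q" "V q"] q by simp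
    then show "(\<Sum>b\<in>Basis. ?c b q *\<^sub>R to_chart B ?e (F q) (?E b (F q))) = to_chart B ?e (F q) (V q)"
      by (simp add: linear_sum[OF lin] linear_scale[OF lin])
  qed (use * in \<open>simp add: to_chart_at[OF B]\<close>)
  then show "section_diff A B F V p" by (auto simp: section_diff_def)
  \<comment> \<open>The inhomogeneous part \<open>dK b\<close> of this change of frame is the term
    that also arises when the components are converted to the chart \<open>?e\<close>; the two
    recombine to the derivative of the frame of \<open>d\<close>.\<close>
  have N: "nab (?E b) (F p) ?w = dK b ?w + (\<Sum>a\<in>Basis. (?E b (F p) \<bullet> a) *\<^sub>R ?N a)" for b
    using nab_coord[OF B nab dc d(2) E chart_at[OF B] dK] by (simp add: to_chart_at[OF B] of_chart_at[OF B])
  have "(\<Sum>a\<in>Basis. (V p \<bullet> a) *\<^sub>R ?N a) =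
      (\<Sum>a\<in>Basis. \<Sum>b\<in>Basis. (?c b p * (?E b (F p) \<bullet> a)) *\<^sub>R ?N a)"
  proof (rule sum.cong[OF refl])
    fix a
    have "V p \<bullet> a = (\<Sum>b\<in>Basis. ?c b p * (?E b (F p) \<bullet> a))"
      by (subst field_coord_sum[OF B d, of "V p"]) (simp add: inner_sum_left)
    then show "(V p \<bullet> a) *\<^sub>R ?N a = (\<Sum>b\<in>Basis. (?c b p * (?E b (F p) \<bullet> a)) *\<^sub>R ?N a)"
      by (simp add: scaleR_left.sum)
  qed
  also have "\<dots> = (\<Sum>b\<in>Basis. ?c b p *\<^sub>R (\<Sum>a\<in>Basis. (?E b (F p) \<bullet> a) *\<^sub>R ?N a))"
    by (subst sum.swap) (simp add: scaleR_sum_right)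
  finally show "pullback_conn A B nab F V p v = of_chart B d (F p) (L v) +
      (\<Sum>b\<in>Basis. ?c b p *\<^sub>R nab (?E b) (F p) ?w)"
    using linear_sum_Basis[OF linear_of_chart[OF B d], of "L v"]
    by (simp add: pullback_conn_chart_at[OF B nab **] N sum.distrib scaleR_add_right)
qed

text \<open>\<open>metric_connection\<close> only prescribes the value of \<open>dfun\<close>; that
  the function really is differentiable comes from the smoothness clause of
  \<open>riemannian_metric\<close>.\<close>

lemma has_mderiv_metric_frame:
  assumes g: "riemannian_metric B g" "metric_connection B g nab" and d: "d \<in> B" "q \<in> fst d"
  shows "has_mderiv B (\<lambda>y. g y (of_chart B d y a) (of_chart B d y b)) q
    (\<lambda>w. g q (nab (\<lambda>y. of_chart B d y a) q w) (of_chart B d q b) +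
      g q (of_chart B d q a) (nab (\<lambda>y. of_chart B d y b) q w))"
proof -
  have "smooth_on (snd d ` (UNIV \<inter> fst d))
      (\<lambda>x. g (chart_inv d x) (of_chart B d (chart_inv d x) a) (of_chart B d (chart_inv d x) b))"
    using g(1) d(1) by (simp add: riemannian_metric_def)
  then obtain L where L: "has_mderiv B (\<lambda>y. g y (of_chart B d y a) (of_chart B d y b)) q L"
    using has_mderivI_smooth[OF B d UNIV_I, where f = "\<lambda>y. g y (of_chart B d y a) (of_chart B d y b)"]
    by blast
  have "dfun B (\<lambda>y. g y (of_chart B d y a) (of_chart B d y b)) q w =
      g q (nab (\<lambda>y. of_chart B d y a) q w) (of_chart B d q b) +
      g q (of_chart B d q a) (nab (\<lambda>y. of_chart B d y b) q w)" for w
    using g(2) d(2) open_chart[OF manifold_chart[OF B d(1)]] smooth_field_on_coord_field[OF B d(1)]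
    unfolding metric_connection_def by blast
  then show ?thesis using L dfun_eqI[OF L] by presburger
qed

text \<open>Metric compatibility of the pullback connection, for sections along \<open>F\<close>
  that need not be restrictions of fields. Both sections are expanded in the coordinate frame, so
  only the coefficients and the metric of the frame are differentiated.\<close>

lemma has_mderiv_metric:
  assumes g: "riemannian_metric B g" "metric_connection B g nab"
    and U: "section_diff A B F U p" and V: "section_diff A B F V p"
  shows "has_mderiv A (\<lambda>q. g (F q) (U q) (V q)) p (\<lambda>v. g (F p) (pullback_conn A B nab F U p v) (V p) +
    g (F p) (U p) (pullback_conn A B nab F V p v))"
proof -
  let ?e = "chart_at B (F p)"
  let ?E = "\<lambda>b y. of_chart B ?e y b"
  obtain L where L: "has_mderiv A (\<lambda>q. to_chart B ?e (F q) (U q)) p L" using U by (auto simp: section_diff_def)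
  obtain M where M: "has_mderiv A (\<lambda>q. to_chart B ?e (F q) (V q)) p M" using V by (auto simp: section_diff_def)
  let ?c = "\<lambda>b q. to_chart B ?e (F q) (U q) \<bullet> b" and ?d = "\<lambda>b q. to_chart B ?e (F q) (V q) \<bullet> b"
  let ?w = "differential A B F p"
  let ?N = "\<lambda>a v. nab (?E a) (F p) (?w v)"
  have bil: "bilinear (g q)" for q using g(1) by (simp add: riemannian_metric_def)
  have lin: "linear (g q u)" "linear (\<lambda>u. g q u v)" for q u v using bil by (simp_all add: bilinear_def)
  have *: "has_mderiv A (\<lambda>q. \<Sum>a\<in>Basis. \<Sum>b\<in>Basis. ?c a q * (?d b q * g (F q) (?E a (F q)) (?E b (F q)))) p
     (\<lambda>v. \<Sum>a\<in>Basis. \<Sum>b\<in>Basis. ?c a p * (?d b p * (g (F p) (?N a v) (?E b (F p)) + g (F p) (?E a (F p)) (?N b v))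
        + (M v \<bullet> b) * g (F p) (?E a (F p)) (?E b (F p))) +
        (L v \<bullet> a) * (?d b p * g (F p) (?E a (F p)) (?E b (F p))))"
    by (intro has_mderiv_sum has_mderiv_mult[OF A] has_mderiv_inner_left[OF L] has_mderiv_inner_left[OF M]
        has_mderiv_chain[OF A B F W p has_mderiv_metric_frame[OF g chart_at[OF B]]])
  have "has_mderiv A (\<lambda>q. g (F q) (U q) (V q)) p
     (\<lambda>v. \<Sum>a\<in>Basis. \<Sum>b\<in>Basis. (U p \<bullet> a) * ((V p \<bullet> b) * (g (F p) (?N a v) b + g (F p) a (?N b v))
        + (M v \<bullet> b) * g (F p) a b) + (L v \<bullet> a) * ((V p \<bullet> b) * g (F p) a b))"
  proof (rule has_mderiv_cong[OF A open_preimage[of "fst ?e"]])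
    show "open (fst ?e)" using open_chart[OF is_chart_at[OF B]] by blast
    show "p \<in> F -` fst ?e \<inter> W" using p chart_at[OF B] by auto
    fix q assume q: "q \<in> F -` fst ?e \<inter> W"
    \<comment> \<open>Transported to constant components by \<open>of_chart\<close>, the metric has
      a \<open>Basis\<close> expansion that is its expansion in the coordinate frame.\<close>
    have "bilinear (\<lambda>u v. g (F q) (of_chart B ?e (F q) u) (of_chart B ?e (F q) v))"
      using lin linear_of_chart[OF B chart_at(1)[OF B], of "F q" "F p"] q
      unfolding bilinear_def by (auto intro: linear_compose[unfolded o_def])
    from bilinear_sum_Basis[OF this, of "to_chart B ?e (F q) (U q)" "to_chart B ?e (F q) (V q)"]
    show "(\<Sum>a\<in>Basis. \<Sum>b\<in>Basis. ?c a q * (?d b q * g (F q) (?E a (F q)) (?E b (F q)))) = g (F q) (U q) (V q)"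
      using of_chart_to_chart_same[OF B chart_at(1)[OF B]] q by simp
  qed (use * in \<open>simp add: to_chart_at[OF B] of_chart_at[OF B]\<close>)
  moreover have "(\<Sum>a\<in>Basis. \<Sum>b\<in>Basis. (U p \<bullet> a) * ((V p \<bullet> b) * (g (F p) (?N a v) b + g (F p) a (?N b v))
        + (M v \<bullet> b) * g (F p) a b) + (L v \<bullet> a) * ((V p \<bullet> b) * g (F p) a b)) =
      g (F p) (pullback_conn A B nab F U p v) (V p) + g (F p) (U p) (pullback_conn A B nab F V p v)" for v
  proof -
    have 1: "g (F p) (\<Sum>a\<in>Basis. (U p \<bullet> a) *\<^sub>R ?N a v) (V p) =
        (\<Sum>a\<in>Basis. \<Sum>b\<in>Basis. (U p \<bullet> a) * ((V p \<bullet> b) * g (F p) (?N a v) b))"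
    proof -
      have "g (F p) x (V p) = (\<Sum>b\<in>Basis. (V p \<bullet> b) * g (F p) x b)" for x
        using linear_sum_Basis[OF lin(1), of "F p" x "V p"] by simp
      then show ?thesis by (simp add: linear_sum[OF lin(2)] linear_scale[OF lin(2)] sum_distrib_left)
    qed
    have 2: "g (F p) (U p) (\<Sum>b\<in>Basis. (V p \<bullet> b) *\<^sub>R ?N b v) =
        (\<Sum>a\<in>Basis. \<Sum>b\<in>Basis. (U p \<bullet> a) * ((V p \<bullet> b) * g (F p) a (?N b v)))"
    proof -
      have "g (F p) (U p) x = (\<Sum>a\<in>Basis. (U p \<bullet> a) * g (F p) a x)" for x
        using linear_sum_Basis[OF lin(2)[of "F p" x], of "U p"] by simp
      then show ?thesis
        by (simp add: linear_sum[OF lin(1)] linear_scale[OF lin(1)] sum_distrib_left)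
          (subst sum.swap, simp add: mult_ac)
    qed
    show ?thesis
      by (simp add: pullback_conn_chart_at[OF B nab L] pullback_conn_chart_at[OF B nab M]
          linear_add[OF lin(1)] linear_add[OF lin(2)] 1 2)
        (simp add: bilinear_sum_Basis[OF bil, of _ "L v"] bilinear_sum_Basis[OF bil, of _ "U p" "M v"]
          sum.distrib[symmetric] algebra_simps)
  qed
  ultimately show ?thesis by simp
qed

end


section \<open>Torsion and geodesics\<close>

lemma smooth_map_on_subset: "smooth_map_on A B W F \<Longrightarrow> V \<subseteq> W \<Longrightarrow> smooth_map_on A B V F"
  unfolding smooth_map_on_def
  by (meson Int_mono continuous_on_subset image_mono order_refl smooth_on_subset)

context
  fixes A :: "('m::{t2_space, second_countable_topology}, 'e::euclidean_space) chart set"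
    and B :: "('n::{t2_space, second_countable_topology}, 'f::euclidean_space) chart set"
    and F :: "'m \<Rightarrow> 'n" and W :: "'m set"
  assumes A: "smooth_manifold A" and B: "smooth_manifold B"
    and F: "smooth_map_on A B W F" and W: "open W"
begin

text \<open>This turns components of the differential into derivatives of functions on the source,
  the only form in which \<open>torsion_free\<close> can be applied.\<close>

lemma differential_component:
  assumes "d \<in> B" "p \<in> W" "F p \<in> fst d"
  shows "to_chart B d (F p) (differential A B F p v) \<bullet> b = dfun A (\<lambda>q. snd d (F q) \<bullet> b) p v"
proof -
  have "has_mderiv A (\<lambda>q. snd d (F q)) p (coord_deriv (chart_at A p) d F p)"
    unfolding has_mderiv_def
    by (rule has_coord_deriv[OF F assms(2) chart_at(1)[OF A] assms(1) chart_at(2)[OF A] assms(3)])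
  from dfun_eqI[OF has_mderiv_inner_left[OF this]] show ?thesis
    by (simp add: coord_deriv_to_chart[OF A B F W assms(2) chart_at[OF A] assms(1,3)] to_chart_at[OF A])
qed

lemma smooth_fun_component:
  assumes "d \<in> B"
  shows "smooth_fun_on A (W \<inter> F -` fst d) (\<lambda>q. snd d (F q) \<bullet> b)"
  unfolding smooth_map_on_def
proof (intro conjI ballI)
  have "continuous_on (W \<inter> F -` fst d) (\<lambda>q. snd d (F q))"
    by (rule continuous_on_compose2[OF continuous_on_chart[OF manifold_chart[OF B assms]]])
      (use continuous_on_subset[OF smooth_map_on_continuous_on[OF F], of "W \<inter> F -` fst d"] in auto)
  then show "continuous_on (W \<inter> F -` fst d) (\<lambda>q. snd d (F q) \<bullet> b)"
    by (intro continuous_intros)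
  fix c s assume c: "c \<in> A" and "s \<in> (std_atlas :: (real, real) chart set)"
  then have s: "s = (UNIV, \<lambda>x. x)" by (simp add: std_atlas_def)
  note cc = manifold_chart[OF A c]
  have eq: "W \<inter> fst c \<inter> F -` fst d = F -` fst d \<inter> W \<inter> fst c" by auto
  have "open (F -` fst d \<inter> W)"
    using continuous_on_open_vimage[OF W, of F] smooth_map_on_continuous_on[OF F]
      open_chart[OF manifold_chart[OF B assms]] by blast
  from smooth_on_inner_left[OF open_chart_image[OF cc this], of "\<lambda>x. snd d (F (chart_inv c x))" b]
  show "smooth_on (snd c ` (W \<inter> F -` fst d \<inter> fst c \<inter> (\<lambda>q. snd d (F q) \<bullet> b) -` fst s))
      (snd s \<circ> (\<lambda>q. snd d (F q) \<bullet> b) \<circ> chart_inv c)"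
    using smooth_map_on_coord[OF F c assms] eq by (simp add: s o_def inf_commute inf_left_commute)
qed

text \<open>In charts the section is the Jacobian of \<open>F\<close> applied to the components of
  \<open>X\<close>, hence smooth.\<close>

lemma section_diff_differential:
  assumes U: "open U" "p \<in> U" "smooth_field_on A U X" and p: "p \<in> W"
  shows "section_diff A B F (\<lambda>q. differential A B F q (X q)) p"
proof -
  let ?c = "chart_at A p" and ?d = "chart_at B (F p)"
  note c = chart_at[OF A, of p] and d = chart_at[OF B, of "F p"]
  note cc = is_chart_at[OF A, of p] and dc = is_chart_at[OF B, of "F p"]
  let ?V = "F -` fst ?d \<inter> W \<inter> U"
  have oV: "open ?V"
    using continuous_on_open_vimage[OF W, of F] smooth_map_on_continuous_on[OF F] open_chart[OF dc] U(1)
    by blast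
  define f where "f = (\<lambda>q. coord_deriv ?c ?d F q (to_chart A ?c q (X q)))"
  let ?S = "snd ?c ` (?V \<inter> fst ?c)"
  have oS: "open ?S" by (rule open_chart_image[OF cc oV])
  have "smooth_on ?S (\<lambda>x. frechet_derivative (\<lambda>x. snd ?d (F (chart_inv ?c x))) (at x)
      (to_chart A ?c (chart_inv ?c x) (X (chart_inv ?c x))))"
    by (rule smooth_on_frechet_derivative_field[OF oS smooth_on_subset[OF smooth_map_on_coord[OF F c(1) d(1)]]
          smooth_on_subset[OF smooth_field_on_coord[OF A U(3) c(1)]]]) auto
  then have "smooth_on ?S (\<lambda>x. f (chart_inv ?c x))"
    by (rule smooth_on_cong[OF oS]) (auto simp: f_def coord_deriv_def chart_inv_chart[OF cc])
  then obtain L where "has_mderiv A f p L"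
    using has_mderivI_smooth[OF A c, of ?V f] p U(2) d(2) by blast
  then have "has_mderiv A (\<lambda>q. to_chart B ?d (F q) (differential A B F q (X q))) p L"
    by (rule has_mderiv_cong[OF A open_Int[OF oV open_chart[OF cc]], rotated -1])
      (use p U(2) c d in \<open>auto simp: f_def coord_deriv_to_chart[OF A B F W]\<close>)
  then show ?thesis by (auto simp: section_diff_def)
qed

end

lemma torsion_freeD:
  "torsion_free A nab \<Longrightarrow> open W \<Longrightarrow> smooth_field_on A W X \<Longrightarrow> smooth_field_on A W Y \<Longrightarrow>
    smooth_fun_on A W f \<Longrightarrow> p \<in> W \<Longrightarrow>
    dfun A f p (nab Y p (X p) - nab X p (Y p)) =
      dfun A (\<lambda>q. dfun A f q (Y q)) p (X p) - dfun A (\<lambda>q. dfun A f q (X q)) p (Y p)"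
  by (simp add: torsion_free_def)

text \<open>Symmetry of the Christoffel symbols. Coordinate functions have constant derivatives
  along coordinate fields, so the bracket terms vanish, and coordinate functions separate tangent
  vectors.\<close>

lemma torsion_free_frame:
  fixes B :: "('n::{t2_space, second_countable_topology}, 'f::euclidean_space) chart set"
  assumes B: "smooth_manifold B" and nab: "torsion_free B nab" and d: "d \<in> B" "q \<in> fst d"
  shows "nab (\<lambda>y. of_chart B d y b) q (of_chart B d q a) = nab (\<lambda>y. of_chart B d y a) q (of_chart B d q b)"
    (is "?l = ?r")
proof -
  let ?E = "\<lambda>b y. of_chart B d y b"
  note dc = open_chart[OF manifold_chart[OF B d(1)]]
  have E: "dfun B (\<lambda>y. snd d y \<bullet> c) y (?E b y) = b \<bullet> c" if "y \<in> fst d" for b c y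
    using differential_component[OF B B smooth_map_id[OF B] open_UNIV d(1) UNIV_I that, of "?E b y" c]
      that by (simp add: differential_id[OF B] to_chart_of_chart_same[OF B d(1)])
  have 0: "dfun B (\<lambda>y. dfun B (\<lambda>y. snd d y \<bullet> c) y (?E b y)) q v = 0" for b c v
    using dfun_eqI[OF has_mderiv_cong[OF B dc d(2) _ has_mderiv_const[of B "b \<bullet> c" q]]] E by simp
  have "smooth_fun_on B (fst d) (\<lambda>y. snd d y \<bullet> c)" for c
    using smooth_fun_component[OF B B smooth_map_id[OF B] open_UNIV d(1), of c] by simp
  then have "dfun B (\<lambda>y. snd d y \<bullet> c) q (?l - ?r) = 0" for c
    using torsion_freeD[OF nab dc smooth_field_on_coord_field[OF B d(1)]
        smooth_field_on_coord_field[OF B d(1)] _ d(2), of "\<lambda>y. snd d y \<bullet> c" b a]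
    by (simp add: 0)
  then have "to_chart B d q (?l - ?r) \<bullet> c = 0" for c
    using differential_component[OF B B smooth_map_id[OF B] open_UNIV d(1) UNIV_I d(2), of "?l - ?r" c]
    by (simp add: differential_id[OF B])
  then have "to_chart B d q (?l - ?r) = 0" using inner_eq_zero_iff by blast
  then have "of_chart B d q (to_chart B d q (?l - ?r)) = 0"
    using linear_0[OF linear_of_chart[OF B d]] by simp
  then show ?thesis by (simp add: of_chart_to_chart_same[OF B d])
qed

text \<open>In the chart at \<open>F p\<close> the Christoffel terms of N cancel by their symmetry.
  What remains is the image of the bracket of \<open>X\<close> and \<open>Y\<close>, which equals
  the image of \<open>nab1 Y p (X p) - nab1 X p (Y p)\<close> because M is torsion free.\<close>

lemma second_ff_symmetric:
  fixes A :: "('m::{t2_space, second_countable_topology}, 'e::euclidean_space) chart set"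
    and B :: "('n::{t2_space, second_countable_topology}, 'f::euclidean_space) chart set"
  assumes A: "smooth_manifold A" and B: "smooth_manifold B"
    and F: "smooth_map_on A B UNIV F"
    and nab1: "torsion_free A nab1"
    and nab2: "affine_connection B nab2" "torsion_free B nab2"
    and U: "open U" "p \<in> U" "smooth_field_on A U X" "smooth_field_on A U Y"
  shows "second_ff A nab1 B nab2 F X Y p - second_ff A nab1 B nab2 F Y X p = 0"
proof -
  let ?d = "chart_at B (F p)"
  note d = chart_at[OF B, of "F p"]
  let ?D = "differential A B F p"
  let ?N = "\<lambda>b. nab2 (\<lambda>y. of_chart B ?d y b) (F p)"
  let ?f = "\<lambda>b q. snd ?d (F q) \<bullet> b"
  define V where "V = U \<inter> F -` fst ?d"
  have V: "open V" "p \<in> V"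
    using continuous_on_open_vimage[of UNIV F] smooth_map_on_continuous_on[OF F] U
      open_chart[OF is_chart_at[OF B]] d by (auto simp: V_def)
  have linD: "linear ?D" by (rule linear_differential[OF A B F UNIV_I])
  obtain LX where LX: "has_mderiv A (\<lambda>q. to_chart B ?d (F q) (differential A B F q (X q))) p LX"
    using section_diff_differential[OF A B F open_UNIV U(1,2,3) UNIV_I] by (auto simp: section_diff_def)
  obtain LY where LY: "has_mderiv A (\<lambda>q. to_chart B ?d (F q) (differential A B F q (Y q))) p LY"
    using section_diff_differential[OF A B F open_UNIV U(1,2,4) UNIV_I] by (auto simp: section_diff_def)
  have LL: "L v \<bullet> b = dfun A (\<lambda>q. dfun A (?f b) q (Z q)) p v"
    if "has_mderiv A (\<lambda>q. to_chart B ?d (F q) (differential A B F q (Z q))) p L" for L Z v b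
  proof -
    have "has_mderiv A (\<lambda>q. dfun A (?f b) q (Z q)) p (\<lambda>v. L v \<bullet> b)"
      by (rule has_mderiv_cong[OF A V _ has_mderiv_inner_left[OF that]])
        (simp add: V_def differential_component[OF A B F open_UNIV d(1)])
    then show ?thesis by (simp add: dfun_eqI)
  qed
  let ?T = "nab1 Y p (X p) - nab1 X p (Y p)"
  \<comment> \<open>Tested on the components of \<open>F\<close>, this is torsion-freeness of
    \<open>nab1\<close> for the functions \<open>?f b\<close> on M.\<close>
  have "LY (X p) - LX (Y p) = ?D ?T"
  proof (rule euclidean_eqI)
    fix b :: 'f
    have "smooth_fun_on A V (?f b)"
      by (rule smooth_map_on_subset[OF smooth_fun_component[OF A B F open_UNIV d(1)]]) (simp add: V_def)
    moreover have "smooth_field_on A V X" "smooth_field_on A V Y"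
      using smooth_field_on_subset[OF A] U by (auto simp: V_def)
    ultimately have "dfun A (?f b) p ?T = (LY (X p) - LX (Y p)) \<bullet> b"
      using nab1 V unfolding torsion_free_def by (simp add: inner_diff_left LL[OF LX] LL[OF LY])
    then show "(LY (X p) - LX (Y p)) \<bullet> b = ?D ?T \<bullet> b"
      using differential_component[OF A B F open_UNIV d(1) UNIV_I d(2), of ?T b]
      by (simp add: to_chart_at[OF B])
  qed
  moreover have "(\<Sum>b\<in>Basis. (v \<bullet> b) *\<^sub>R ?N b w) = (\<Sum>b\<in>Basis. (w \<bullet> b) *\<^sub>R ?N b v)" for v w
  proof -
    have N: "?N b w = (\<Sum>a\<in>Basis. (w \<bullet> a) *\<^sub>R ?N b a)" for b w
      by (rule linear_sum_Basis[OF nab_linear[OF B nab2(1) open_chart[OF is_chart_at[OF B]]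
            smooth_field_on_coord_field[OF B d(1)] d(2)]])
    have sym: "?N b a = ?N a b" for a b
      using torsion_free_frame[OF B nab2(2) d, of b a] by (simp add: of_chart_at[OF B])
    have "(\<Sum>b\<in>Basis. (v \<bullet> b) *\<^sub>R ?N b w) = (\<Sum>b\<in>Basis. \<Sum>a\<in>Basis. ((v \<bullet> b) * (w \<bullet> a)) *\<^sub>R ?N b a)"
      by (subst N) (simp add: scaleR_sum_right)
    also have "\<dots> = (\<Sum>a\<in>Basis. \<Sum>b\<in>Basis. ((w \<bullet> a) * (v \<bullet> b)) *\<^sub>R ?N a b)"
      by (subst sum.swap) (simp add: sym mult.commute)
    also have "\<dots> = (\<Sum>a\<in>Basis. (w \<bullet> a) *\<^sub>R ?N a v)"
      by (subst (2) N) (simp add: scaleR_sum_right)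
    finally show ?thesis .
  qed
  ultimately show ?thesis
    by (simp add: second_ff_def pullback_conn_chart_at[OF B nab2(1) LX] pullback_conn_chart_at[OF B nab2(1) LY]
        linear_diff[OF linD] algebra_simps)
qed

text \<open>In the preferred chart at \<open>q\<close> the geodesic equation becomes the autonomous
  first-order system x' = v, v' = - Q(x, v), with Q quadratic in v.\<close>

lemma geodesic_exists:
  fixes B :: "('n::{t2_space, second_countable_topology}, 'f::euclidean_space) chart set"
  assumes B: "smooth_manifold B" and nab: "affine_connection B nab"
  obtains e \<beta> where "0 < e" "geodesic_on B nab {-e<..<e} \<beta>" "\<beta> 0 = q" "velocity B \<beta> 0 = u"
proof -
  let ?d = "chart_at B q"
  note d = chart_at[OF B, of q] and dc = is_chart_at[OF B, of q]
  let ?E = "\<lambda>b y. of_chart B ?d y b"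
  define S where "S = snd ?d ` fst ?d"
  have S: "open S" using dc by (simp add: S_def is_chart_def)
  \<comment> \<open>The Christoffel symbols: components of the covariant derivative of frame field
    \<open>b\<close> in the direction of frame field \<open>a\<close>.\<close>
  define G where "G = (\<lambda>a b x. to_chart B ?d (chart_inv ?d x) (nab (?E b) (chart_inv ?d x) (?E a (chart_inv ?d x))))"
  have G: "smooth_on S (G a b)" for a b
    using smooth_field_on_coord[OF B nab_smooth[OF B nab open_chart[OF dc]
        smooth_field_on_coord_field[OF B d(1)] smooth_field_on_coord_field[OF B d(1)]] d(1)]
    by (simp add: G_def S_def)
  define Q where "Q = (\<lambda>x v. \<Sum>b\<in>Basis. \<Sum>a\<in>Basis. (v \<bullet> b) *\<^sub>R (v \<bullet> a) *\<^sub>R G a b x)"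
  define f where "f = (\<lambda>z. (snd z, - 1 *\<^sub>R Q (fst z) (snd z)))"
  let ?S = "S \<times> (UNIV :: 'f set)"
  have oS: "open ?S" using S by (simp add: open_Times)
  have fst: "smooth_on ?S (\<lambda>z. fst z)" and snd: "smooth_on ?S (\<lambda>z. snd z)"
    by (intro smooth_on_bounded_linear[OF oS _ smooth_on_ident] bounded_linear_fst bounded_linear_snd)+
  have GS: "smooth_on ?S (\<lambda>z. G a b (fst z))" for a b
    by (rule smooth_on_compose[OF oS S _ G fst]) auto
  have "smooth_on ?S f"
    unfolding f_def Q_def
    by (intro smooth_on_Pair[OF oS snd] smooth_on_scaleR[OF oS smooth_on_const] smooth_on_sum[OF oS]
        smooth_on_scaleR[OF oS smooth_on_inner_left[OF oS snd]] GS)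
  moreover have "(snd ?d q, u) \<in> ?S" using d by (simp add: S_def)
  ultimately obtain e z where e: "0 < e" and z0: "z 0 = (snd ?d q, u)" and zS: "z ` {-e<..<e} \<subseteq> ?S"
    and z: "\<And>t. t \<in> {-e<..<e} \<Longrightarrow> (z has_vector_derivative f (z t)) (at t)"
    using ode_exists[OF oS] by metis
  define I where "I = {-e<..<e}"
  have I: "open I" "is_interval I" "0 \<in> I" using e by (auto simp: I_def is_interval_1)
  have zsm: "smooth_on I z"
    by (rule ode_solution_smooth[OF oS \<open>smooth_on ?S f\<close> I(1)]) (use zS z in \<open>auto simp: I_def\<close>)
  define x where "x = (\<lambda>t. fst (z t))"
  define v where "v = (\<lambda>t. snd (z t))"
  have x: "smooth_on I x" unfolding x_def by (rule smooth_on_bounded_linear[OF I(1) bounded_linear_fst zsm])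
  have xS: "x t \<in> S" if "t \<in> I" for t using zS that by (force simp: x_def I_def mem_Times_iff)
  have xd: "(x has_derivative (\<lambda>h. h *\<^sub>R v t)) (at t)" if "t \<in> I" for t
    using bounded_linear.has_derivative[OF bounded_linear_fst z[unfolded has_vector_derivative_def]] that
    by (simp add: x_def v_def I_def f_def)
  have vd: "(v has_derivative (\<lambda>h. h *\<^sub>R (- Q (x t) (v t)))) (at t)" if "t \<in> I" for t
    using bounded_linear.has_derivative[OF bounded_linear_snd z[unfolded has_vector_derivative_def]] that
    by (simp add: x_def v_def I_def f_def)
  define \<beta> where "\<beta> = (\<lambda>t. chart_inv ?d (x t))"
  have \<beta>d: "\<beta> t \<in> fst ?d" "snd ?d (\<beta> t) = x t" if "t \<in> I" for t
    using xS[OF that] chart_inv_in[OF dc] chart_chart_inv[OF dc] by (auto simp: \<beta>_def S_def)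
  have \<beta>: "smooth_map_on std_atlas B I \<beta>"
    unfolding smooth_map_on_def
  proof (intro conjI ballI)
    show cont: "continuous_on I \<beta>"
      unfolding \<beta>_def
      by (rule continuous_on_compose2[OF continuous_on_chart_inv[OF dc] smooth_on_imp_continuous_on[OF x]])
        (use xS in \<open>auto simp: S_def\<close>)
    fix s d' assume "s \<in> (std_atlas :: (real, real) chart set)" and d': "d' \<in> B"
    then have s: "s = (UNIV, \<lambda>x. x)" by (simp add: std_atlas_def)
    let ?I = "I \<inter> \<beta> -` fst d'"
    have oI: "open ?I"
      using continuous_on_open_vimage[OF I(1), of \<beta>] cont open_chart[OF manifold_chart[OF B d']]
      by (simp add: Int_commute)
    have oT: "open (snd ?d ` (fst ?d \<inter> fst d'))"
      using open_chart_image[OF dc open_chart[OF manifold_chart[OF B d']]] by (simp add: Int_commute)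
    have "x ` ?I \<subseteq> snd ?d ` (fst ?d \<inter> fst d')"
      using \<beta>d by (auto simp: image_iff) (metis IntI)
    from smooth_on_compose[OF oI oT this transition_smooth[OF B d(1) d'] smooth_on_subset[OF x]]
    show "smooth_on (snd s ` (I \<inter> fst s \<inter> \<beta> -` fst d')) (snd d' \<circ> \<beta> \<circ> chart_inv s)"
      by (simp add: s \<beta>_def o_def)
  qed
  note std = smooth_manifold_std[where 'a = real]
  \<comment> \<open>This links the second half of the system to the curve: \<open>v\<close> is the
    velocity read in the fixed chart, so its derivative is what enters the pullback
    connection.\<close>
  have vel: "to_chart B ?d (\<beta> t) (velocity B \<beta> t) = v t" if t: "t \<in> I" for t
  proof -
    have "((\<lambda>t. snd ?d (\<beta> t)) has_derivative (\<lambda>h. h *\<^sub>R v t)) (at t)"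
      by (rule has_derivative_transform_within_open[OF xd[OF t] I(1) t]) (simp add: \<beta>d)
    then show ?thesis
      using coord_deriv_to_chart[OF std B \<beta> I(1) t chart_at[OF std] d(1) \<beta>d(1)[OF t], of 1]
        to_chart_at[OF std, of t]
      by (simp add: velocity_def coord_deriv_def frechet_derivative_eqI)
  qed
  have "pullback_conn std_atlas B nab \<beta> (velocity B \<beta>) t 1 = 0" if t: "t \<in> I" for t
  proof -
    have L: "has_mderiv std_atlas (\<lambda>s. to_chart B ?d (\<beta> s) (velocity B \<beta> s)) t (\<lambda>h. h *\<^sub>R (- Q (x t) (v t)))"
      unfolding has_mderiv_std
      by (rule has_derivative_transform_within_open[OF vd[OF t] I(1) t]) (simp add: vel)
    have lin: "linear (of_chart B ?d (\<beta> t))" by (rule linear_of_chart[OF B d(1) \<beta>d(1)[OF t]])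
    have N: "nab (?E b) (\<beta> t) (velocity B \<beta> t) = (\<Sum>a\<in>Basis. (v t \<bullet> a) *\<^sub>R of_chart B ?d (\<beta> t) (G a b (x t)))" for b
    proof -
      have lN: "linear (nab (?E b) (\<beta> t))"
        by (rule nab_linear[OF B nab open_chart[OF dc] smooth_field_on_coord_field[OF B d(1)] \<beta>d(1)[OF t]])
      have "velocity B \<beta> t = (\<Sum>a\<in>Basis. (v t \<bullet> a) *\<^sub>R ?E a (\<beta> t))"
        using field_coord_sum[OF B d(1) \<beta>d(1)[OF t], of "velocity B \<beta> t"] vel[OF t] by simp
      then have "nab (?E b) (\<beta> t) (velocity B \<beta> t) = (\<Sum>a\<in>Basis. (v t \<bullet> a) *\<^sub>R nab (?E b) (\<beta> t) (?E a (\<beta> t)))"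
        by (simp add: linear_sum[OF lN] linear_scale[OF lN])
      then show ?thesis
        using of_chart_to_chart_same[OF B d(1) \<beta>d(1)[OF t]] by (simp add: G_def \<beta>_def)
    qed
    have "pullback_conn std_atlas B nab \<beta> (velocity B \<beta>) t 1 =
        of_chart B ?d (\<beta> t) (- Q (x t) (v t)) + (\<Sum>b\<in>Basis. (v t \<bullet> b) *\<^sub>R nab (?E b) (\<beta> t) (velocity B \<beta> t))"
      using pullback_conn_chart(2)[OF std B nab \<beta> I(1) t d(1) \<beta>d(1)[OF t] L, of 1] vel[OF t]
      by (simp add: velocity_def[symmetric])
    also have "\<dots> = 0"
      by (simp add: N Q_def linear_neg[OF lin] linear_sum[OF lin] linear_scale[OF lin] scaleR_sum_right)
    finally show ?thesis .
  qed
  then have "geodesic_on B nab I \<beta>" using \<beta> I by (simp add: geodesic_on_def)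
  moreover have "\<beta> 0 = q"
    using z0 chart_inv_chart[OF dc d(2)] by (simp add: \<beta>_def x_def)
  moreover from this have "velocity B \<beta> 0 = u"
    using vel[OF I(3)] z0 by (simp add: v_def to_chart_at[OF B])
  ultimately show thesis using that[OF e] by (simp add: I_def)
qed


section \<open>Consequences of the Clairaut condition\<close>

text \<open>The metric of a single tangent space, detached from the manifold; it is generally not
  the inner product of the model space, so its orthogonal projections must be built
  separately.\<close>

definition pos_form :: "('f::euclidean_space \<Rightarrow> 'f \<Rightarrow> real) \<Rightarrow> bool" where
  "pos_form h \<longleftrightarrow> bilinear h \<and> (\<forall>u v. h u v = h v u) \<and> (\<forall>u. u \<noteq> 0 \<longrightarrow> 0 < h u u)"

lemma riemannian_metric_pos_form: "riemannian_metric B g \<Longrightarrow> pos_form (g q)"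
  unfolding riemannian_metric_def pos_form_def by blast

section \<open>Linear algebra in one tangent space\<close>

context
  fixes h :: "'f::euclidean_space \<Rightarrow> 'f \<Rightarrow> real"
  assumes h: "pos_form h"
begin

lemma pf_bilinear: "bilinear h" and pf_sym: "h u v = h v u" and pf_pos: "u \<noteq> 0 \<Longrightarrow> 0 < h u u"
  using h unfolding pos_form_def by blast+

lemmas pf_algebra = bilinear_ladd[OF pf_bilinear] bilinear_radd[OF pf_bilinear]
  bilinear_lsub[OF pf_bilinear] bilinear_rsub[OF pf_bilinear]
  bilinear_lneg[OF pf_bilinear] bilinear_rneg[OF pf_bilinear]
  bilinear_lmul[OF pf_bilinear] bilinear_rmul[OF pf_bilinear]
  bilinear_lzero[OF pf_bilinear] bilinear_rzero[OF pf_bilinear]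

lemma pf_nonneg: "0 \<le> h u u"
  using pf_pos[of u] by (cases "u = 0") (auto simp: pf_algebra)

lemma pf_eq_0: "h u u = 0 \<Longrightarrow> u = 0"
  using pf_pos[of u] by force

text \<open>A Gram-Schmidt step over a finite spanning set: with projections onto
  \<open>span K\<close> at hand, a new vector \<open>b\<close> is replaced by its part
  \<open>c\<close> orthogonal to \<open>span K\<close>.\<close>

lemma orthogonal_decomposition:
  assumes "subspace S"
  obtains x v where "x \<in> S" "v \<in> orth_compl h S" "u = x + v"
proof -
  obtain K where K: "finite K" "span K = S"
    using basis_exists[of S] span_subspace[OF _ _ assms] finiteI_independent by metis
  have "\<exists>x\<in>span K. \<forall>y\<in>span K. h y (u - x) = 0" for u
    using K(1)
  proof (induction K arbitrary: u)
    case empty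
    then show ?case by (simp add: pf_algebra)
  next
    case (insert b K)
    obtain xb where xb: "xb \<in> span K" "\<And>y. y \<in> span K \<Longrightarrow> h y (b - xb) = 0" using insert.IH by blast
    obtain xu where xu: "xu \<in> span K" "\<And>y. y \<in> span K \<Longrightarrow> h y (u - xu) = 0" using insert.IH by blast
    define c where "c = b - xb"
    have split: "\<exists>k s. s \<in> span K \<and> y = k *\<^sub>R c + s" if y: "y \<in> span (insert b K)" for y
    proof -
      obtain k where "y - k *\<^sub>R b \<in> span K" using y unfolding span_breakdown_eq[of y b K] by blast
      then have "(y - k *\<^sub>R b) + k *\<^sub>R xb \<in> span K" using xb(1) by (intro span_add span_scale)
      then show ?thesis
        by (intro exI[of _ k] exI[of _ "(y - k *\<^sub>R b) + k *\<^sub>R xb"]) (simp add: c_def algebra_simps)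
    qed
    \<comment> \<open>If \<open>b\<close> already lies in \<open>span K\<close>, then
      \<open>c = 0\<close>; the quotient is then 0 by convention, and the formula remains
      correct.\<close>
    define x where "x = xu + (h c (u - xu) / h c c) *\<^sub>R c"
    have sub: "span K \<subseteq> span (insert b K)" by (intro span_mono) auto
    then have "c \<in> span (insert b K)" using xb(1) by (auto simp: c_def intro: span_diff span_base)
    then have "x \<in> span (insert b K)"
      unfolding x_def using xu(1) sub by (intro span_add span_scale) auto
    moreover have "h y (u - x) = 0" if y: "y \<in> span (insert b K)" for y
    proof -
      obtain k s where s: "s \<in> span K" "y = k *\<^sub>R c + s" using split[OF y] by blast
      have "h c (u - x) = 0"
        by (cases "c = 0") (use pf_pos[of c] in \<open>auto simp: x_def pf_algebra\<close>)
      moreover have "h s (u - x) = 0"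
        using xu(2)[OF s(1)] xb(2)[OF s(1)] by (simp add: x_def c_def[symmetric] pf_algebra algebra_simps)
      ultimately show ?thesis by (simp add: s(2) pf_algebra)
    qed
    ultimately show ?case by blast
  qed
  then obtain x where "x \<in> S" "\<And>y. y \<in> S \<Longrightarrow> h y (u - x) = 0" using K(2) by blast
  then show thesis using that[of x "u - x"] by (simp add: orth_compl_def)
qed

text \<open>For nonzero \<open>v\<close> the squared cosine is
  \<open>h v v / h (x + v) (x + v)\<close>, and Pythagoras gives the rest. For \<open>v = 0\<close>
  the convention that the angle is pi/2 makes the sine 1, as the identity requires.\<close>

lemma sin_angle:
  assumes "h x v = 0"
  shows "(sin (angle h (x + v) v))\<^sup>2 * h (x + v) (x + v) = h x x"
proof (cases "v = 0")
  case True
  then show ?thesis by (simp add: angle_def pf_algebra)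
next
  case False
  let ?u = "x + v"
  have uv: "h ?u v = h v v" and uu: "h ?u ?u = h x x + h v v"
    using assms by (simp_all add: pf_algebra pf_sym[of v x])
  have pos: "0 < h v v" "0 < h ?u ?u" using pf_pos[OF False] pf_nonneg[of x] uu by auto
  define r where "r = h ?u v / (sqrt (h ?u ?u) * sqrt (h v v))"
  have "r\<^sup>2 = h v v / h ?u ?u"
    using pos by (simp add: r_def uv power_divide power_mult_distrib) (simp add: power2_eq_square)
  moreover have "h v v / h ?u ?u \<le> 1" using pos uu pf_nonneg[of x] by simp
  ultimately have r1: "r\<^sup>2 \<le> 1" by simp
  then have "\<bar>r\<bar> \<le> 1" using abs_square_le_1[of r] by blast
  then have "(sin (arccos r))\<^sup>2 = 1 - h v v / h ?u ?u"
    using \<open>r\<^sup>2 = _\<close> r1 sin_arccos[of r] by (simp add: abs_le_iff)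
  moreover have "angle h ?u v = arccos r" by (simp add: angle_def r_def)
  ultimately have "(sin (angle h ?u v))\<^sup>2 = 1 - h v v / h ?u ?u" by simp
  then have "(sin (angle h ?u v))\<^sup>2 * h ?u ?u = h ?u ?u - h v v"
    using pos(2) by (simp add: left_diff_distrib)
  then show ?thesis using uu by linarith
qed

end

text \<open>Squared, the Clairaut relation says that exp(2f) times the squared length of the
  \<open>D\<close>-part X of the velocity u equals C^2 |u|^2. Since |X|^2 dominates 2<u, Y> - |Y|^2
  for every section Y of \<open>D\<close>, with equality when Y = X, replacing X by Y gives a
  function with a minimum at time 0. Only Y is ever differentiated, never X. The stated identity is
  the vanishing derivative divided by -2 exp(2f).\<close>

lemma clairaut_variation:
  fixes B :: "('n::{t2_space, second_countable_topology}, 'f::euclidean_space) chart set"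
  assumes N: "riemannian_manifold B g nab"
    and D: "\<And>q. subspace (D q)"
    and f: "smooth_fun_on B UNIV f"
    and cl: "clairaut B g nab D (\<lambda>q. exp (f q))"
    and W: "open W" "q \<in> W" "smooth_field_on B W Y" "\<And>x. x \<in> W \<Longrightarrow> Y x \<in> D x"
    and v: "v \<in> orth_compl (g q) (D q)"
  shows "dfun B f q (Y q + v) * g q (Y q) (Y q) + g q v (nab Y q (Y q + v)) = 0"
proof -
  have B: "smooth_manifold B" and nab: "affine_connection B nab" and g: "riemannian_metric B g"
    and met: "metric_connection B g nab"
    using N by (auto simp: riemannian_manifold_def levi_civita_def)
  note pf = riemannian_metric_pos_form[OF g]
  note alg = pf_algebra[OF pf]
  note std = smooth_manifold_std[where 'a = real]
  define u where "u = Y q + v"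
  obtain e \<beta> where e: "0 < e" and geo: "geodesic_on B nab {-e<..<e} \<beta>" and \<beta>0: "\<beta> 0 = q"
    and vel0: "velocity B \<beta> 0 = u"
    by (rule geodesic_exists[OF B nab])
  define I where "I = {-e<..<e}"
  have I: "open I" "0 \<in> I" using e by (auto simp: I_def)
  have \<beta>: "smooth_map_on std_atlas B I \<beta>" using geo by (simp add: geodesic_on_def I_def)
  obtain C where C: "\<And>t X V. t \<in> I \<Longrightarrow> X \<in> D (\<beta> t) \<Longrightarrow> V \<in> orth_compl (g (\<beta> t)) (D (\<beta> t)) \<Longrightarrow>
      velocity B \<beta> t = X + V \<Longrightarrow> exp (f (\<beta> t)) * sin (angle (g (\<beta> t)) (velocity B \<beta> t) V) = C"
    using cl geo unfolding clairaut_def I_def by metis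
  let ?u = "velocity B \<beta>" and ?h = "\<lambda>t. g (\<beta> t)"
  \<comment> \<open>Squaring removes both the sine and the square roots and leaves an identity
    between quadratic forms.\<close>
  have C2: "exp (2 * f (\<beta> t)) * ?h t X X = C\<^sup>2 * ?h t (?u t) (?u t)"
    if t: "t \<in> I" and X: "X \<in> D (\<beta> t)" "V \<in> orth_compl (?h t) (D (\<beta> t))" "?u t = X + V" for t X V
  proof -
    have "?h t X V = 0" using X by (simp add: orth_compl_def)
    from sin_angle[OF pf this] have s: "(sin (angle (?h t) (?u t) V))\<^sup>2 * ?h t (?u t) (?u t) = ?h t X X"
      using X(3) by simp
    have "C\<^sup>2 = exp (2 * f (\<beta> t)) * (sin (angle (?h t) (?u t) V))\<^sup>2"
      using C[OF t X] by (simp add: power_mult_distrib[symmetric] exp_double)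
    then show ?thesis using s by (simp add: mult.assoc)
  qed
  \<comment> \<open>For a decomposition u = X + V, this is exp(2f) times |X - Y|^2. It vanishes at
    time 0, where the \<open>D\<close>-part of the velocity is \<open>Y q\<close> by the choice of
    the initial velocity.\<close>
  define defect where "defect = (\<lambda>t. C\<^sup>2 * ?h t (?u t) (?u t) -
    exp (2 * f (\<beta> t)) * (2 * ?h t (?u t) (Y (\<beta> t)) - ?h t (Y (\<beta> t)) (Y (\<beta> t))))"
  define U where "U = \<beta> -` W \<inter> I"
  have U: "open U" "0 \<in> U"
    using continuous_on_open_vimage[OF I(1)] smooth_map_on_continuous_on[OF \<beta>] W(1,2) I(2) \<beta>0
    by (auto simp: U_def)
  have defect0: "defect 0 = 0"
  proof -
    have "?h 0 (Y q) v = 0" using v W(2,4) \<beta>0 by (simp add: orth_compl_def)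
    moreover have "exp (2 * f q) * g q (Y q) (Y q) = C\<^sup>2 * g q u u"
      using C2[OF I(2), of "Y q" v] v W(2,4) \<beta>0 vel0 by (simp add: u_def)
    ultimately show ?thesis
      using pf_sym[OF pf, of q v "Y q"] \<beta>0 vel0 by (simp add: defect_def) (simp add: u_def alg)
  qed
  \<comment> \<open>\<open>Y \<circ> \<beta>\<close> is a competitor in the least-squares problem solved by the \<open>D\<close>-part of the velocity.\<close>
  have "0 \<le> defect t" if "t \<in> U" for t
  proof -
    have t: "t \<in> I" "\<beta> t \<in> W" using that by (auto simp: U_def)
    obtain X V where XV: "X \<in> D (\<beta> t)" "V \<in> orth_compl (?h t) (D (\<beta> t))" "?u t = X + V"
      using orthogonal_decomposition[OF pf D] by metis
    have "?h t (Y (\<beta> t)) V = 0" using XV(2) W(4)[OF t(2)] by (simp add: orth_compl_def)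
    then have "2 * ?h t (?u t) (Y (\<beta> t)) - ?h t (Y (\<beta> t)) (Y (\<beta> t)) =
        ?h t X X - ?h t (X - Y (\<beta> t)) (X - Y (\<beta> t))"
      using XV(3) by (simp add: alg pf_sym[OF pf, of "\<beta> t" V] pf_sym[OF pf, of "\<beta> t" X "Y (\<beta> t)"])
    then have "2 * ?h t (?u t) (Y (\<beta> t)) - ?h t (Y (\<beta> t)) (Y (\<beta> t)) \<le> ?h t X X"
      using pf_nonneg[OF pf] by simp
    then have "exp (2 * f (\<beta> t)) * (2 * ?h t (?u t) (Y (\<beta> t)) - ?h t (Y (\<beta> t)) (Y (\<beta> t))) \<le>
        exp (2 * f (\<beta> t)) * ?h t X X"
      by (intro mult_left_mono) auto
    then show ?thesis using C2[OF t(1) XV] by (simp add: defect_def)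
  qed
  \<comment> \<open>The velocity is the image of this unit field under the differential of the
    curve, so \<open>section_diff_differential\<close> applies to it.\<close>
  have one: "smooth_field_on std_atlas UNIV (\<lambda>t::real. 1 :: real)"
  proof -
    have "of_chart std_atlas (UNIV, \<lambda>x. x) t = (\<lambda>v. v)" for t :: real
      using of_chart_at[OF std, of t] by simp
    then show ?thesis
      using smooth_field_on_coord_field[OF std, of "(UNIV, \<lambda>x. x)" 1] by (simp add: std_atlas_def)
  qed
  have du: "section_diff std_atlas B \<beta> ?u 0"
    using section_diff_differential[OF std B \<beta> I(1) open_UNIV UNIV_I one I(2)] by (simp add: velocity_def[abs_def])
  have dY: "section_diff std_atlas B \<beta> (\<lambda>t. Y (\<beta> t)) 0"
    and pY: "\<And>v. pullback_conn std_atlas B nab \<beta> (\<lambda>t. Y (\<beta> t)) 0 v = nab Y q (differential std_atlas B \<beta> 0 v)"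
    using section_diff_field[OF std B nab \<beta> I W(1) _ W(3)] W(2) \<beta>0 by auto
  note dm = has_mderiv_metric[OF std B nab \<beta> I g met]
  have df: "has_mderiv std_atlas (\<lambda>t. f (\<beta> t)) 0 (\<lambda>v. dfun B f q (differential std_atlas B \<beta> 0 v))"
    using has_mderiv_chain[OF std B \<beta> I has_mderiv_dfun[OF B f UNIV_I]] \<beta>0 by simp
  have "has_mderiv std_atlas defect 0 (\<lambda>w. C\<^sup>2 *
      (?h 0 (pullback_conn std_atlas B nab \<beta> ?u 0 w) (?u 0) + ?h 0 (?u 0) (pullback_conn std_atlas B nab \<beta> ?u 0 w)) -
      (exp (2 * f (\<beta> 0)) *
        (2 * (?h 0 (pullback_conn std_atlas B nab \<beta> ?u 0 w) (Y (\<beta> 0)) +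
              ?h 0 (?u 0) (pullback_conn std_atlas B nab \<beta> (\<lambda>t. Y (\<beta> t)) 0 w)) -
          (?h 0 (pullback_conn std_atlas B nab \<beta> (\<lambda>t. Y (\<beta> t)) 0 w) (Y (\<beta> 0)) +
           ?h 0 (Y (\<beta> 0)) (pullback_conn std_atlas B nab \<beta> (\<lambda>t. Y (\<beta> t)) 0 w))) +
      (2 * dfun B f q (differential std_atlas B \<beta> 0 w) * exp (2 * f (\<beta> 0))) *
        (2 * ?h 0 (?u 0) (Y (\<beta> 0)) - ?h 0 (Y (\<beta> 0)) (Y (\<beta> 0)))))"
    unfolding defect_def
    by (intro has_mderiv_diff has_mderiv_mult[OF std] has_mderiv_mult_left has_mderiv_exp[OF std] dm du dY df)
  from has_mderiv_min[OF std U _ this, of 1] \<open>\<And>t. t \<in> U \<Longrightarrow> 0 \<le> defect t\<close> defect0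
  have min: "C\<^sup>2 *
      (g q (pullback_conn std_atlas B nab \<beta> ?u 0 1) u + g q u (pullback_conn std_atlas B nab \<beta> ?u 0 1)) -
      (exp (2 * f q) *
        (2 * (g q (pullback_conn std_atlas B nab \<beta> ?u 0 1) (Y q) + g q u (nab Y q (differential std_atlas B \<beta> 0 1))) -
          (g q (nab Y q (differential std_atlas B \<beta> 0 1)) (Y q) + g q (Y q) (nab Y q (differential std_atlas B \<beta> 0 1)))) +
      (2 * dfun B f q (differential std_atlas B \<beta> 0 1) * exp (2 * f q)) *
        (2 * g q u (Y q) - g q (Y q) (Y q))) = 0"
    by (simp only: pY \<beta>0 vel0)
  \<comment> \<open>The geodesic equation annihilates the derivative of |u|^2, so \<open>C\<close>
    drops out.\<close>
  have 1: "pullback_conn std_atlas B nab \<beta> ?u 0 1 = 0"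
    using geo I(2) by (simp add: geodesic_on_def I_def)
  have 2: "differential std_atlas B \<beta> 0 1 = u" using vel0 by (simp add: velocity_def)
  have 3: "g q (Y q) v = 0" "g q v (Y q) = 0"
    using v W(2,4) pf_sym[OF pf, of q v "Y q"] by (simp_all add: orth_compl_def)
  \<comment> \<open>The exponential is made opaque so that the remaining identity is purely
    polynomial.\<close>
  obtain E where E: "exp (2 * f q) = E" by blast
  have "E \<noteq> 0" using exp_not_eq_zero[of "2 * f q"] unfolding E .
  have u: "g q u w = g q (Y q) w + g q v w" for w by (simp add: u_def alg)
  have "E * (dfun B f q u * g q (Y q) (Y q)) + E * g q v (nab Y q u) = 0"
  proof -
    have "E * (2 * (g q (Y q) (nab Y q u) + g q v (nab Y q u)) -
        (g q (Y q) (nab Y q u) + g q (Y q) (nab Y q u))) +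
        2 * dfun B f q u * E * (2 * g q (Y q) (Y q) - g q (Y q) (Y q)) = 0"
      using min unfolding 1 2 E alg u pf_sym[OF pf, of q "nab Y q u" "Y q"]
      by (simp only: 3 mult_zero_right add_0_left add_0_right diff_0 neg_equal_0_iff_equal)
    then show ?thesis by algebra
  qed
  then have "E * (dfun B f q u * g q (Y q) (Y q) + g q v (nab Y q u)) = 0"
    by (simp only: distrib_left)
  with \<open>E \<noteq> 0\<close> have "dfun B f q u * g q (Y q) (Y q) + g q v (nab Y q u) = 0" by simp
  then show ?thesis by (simp add: u_def)
qed

context
  fixes B :: "('n::{t2_space, second_countable_topology}, 'f::euclidean_space) chart set"
    and g nab and D :: "'n \<Rightarrow> 'f set" and f W q v
  assumes N: "riemannian_manifold B g nab"
    and D: "\<And>q. subspace (D q)"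
    and f: "smooth_fun_on B UNIV f"
    and cl: "clairaut B g nab D (\<lambda>q. exp (f q))"
    and W: "open W" "q \<in> W"
    and v: "v \<in> orth_compl (g q) (D q)"
begin

text \<open>In \<open>clairaut_variation\<close> the terms with \<open>dfun B f q (Y q)\<close> and
  with \<open>nab Y q v\<close> paired with \<open>v\<close> are even and odd-squared in
  \<open>v\<close>, hence unchanged when \<open>v\<close> becomes \<open>- v\<close>; the two terms
  wanted here change sign. Subtracting the two instances isolates them.\<close>

lemma clairaut_umbilical_diag:
  assumes Y: "smooth_field_on B W Y" "\<And>x. x \<in> W \<Longrightarrow> Y x \<in> D x"
  shows "g q v (nab Y q (Y q)) = - (dfun B f q v * g q (Y q) (Y q))"
proof -
  have B: "smooth_manifold B" and nab: "affine_connection B nab" and g: "riemannian_metric B g"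
    using N by (auto simp: riemannian_manifold_def levi_civita_def)
  note alg = pf_algebra[OF riemannian_metric_pos_form[OF g]]
  have lin: "linear (nab Y q)" by (rule nab_linear[OF B nab W(1) Y(1) W(2)])
  have lf: "linear (dfun B f q)" by (rule has_mderiv_linear[OF has_mderiv_dfun[OF B f UNIV_I]])
  have "- v \<in> orth_compl (g q) (D q)" using v by (simp add: orth_compl_def alg)
  from clairaut_variation[OF N D f cl W Y v] clairaut_variation[OF N D f cl W Y this]
  show ?thesis
    by (simp add: linear_add[OF lin] linear_diff[OF lin] linear_add[OF lf] linear_diff[OF lf] alg algebra_simps)
qed

text \<open>Polarization with \<open>Y + Z\<close>. It yields only the symmetric part of the normal
  component, because without integrability of \<open>D\<close> the bracket of two sections may leave
  \<open>D\<close>.\<close>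

lemma clairaut_umbilical:
  assumes Y: "smooth_field_on B W Y" "\<And>x. x \<in> W \<Longrightarrow> Y x \<in> D x"
    and Z: "smooth_field_on B W Z" "\<And>x. x \<in> W \<Longrightarrow> Z x \<in> D x"
  shows "g q v (nab Y q (Z q)) + g q v (nab Z q (Y q)) = - (2 * dfun B f q v * g q (Y q) (Z q))"
proof -
  have B: "smooth_manifold B" and nab: "affine_connection B nab" and g: "riemannian_metric B g"
    using N by (auto simp: riemannian_manifold_def levi_civita_def)
  note pf = riemannian_metric_pos_form[OF g]
  note alg = pf_algebra[OF pf]
  have lin: "linear (nab Y q)" "linear (nab Z q)"
    using nab_linear[OF B nab W(1) _ W(2)] Y(1) Z(1) by auto
  have "g q v (nab (\<lambda>x. Y x + Z x) q (Y q + Z q)) =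
      - (dfun B f q v * g q (Y q + Z q) (Y q + Z q))"
    by (rule clairaut_umbilical_diag) (use Y Z D in \<open>auto intro: smooth_field_on_add[OF B W(1)] subspace_add\<close>)
  then show ?thesis
    using clairaut_umbilical_diag[OF Y] clairaut_umbilical_diag[OF Z] pf_sym[OF pf, of q "Z q" "Y q"]
    by (simp add: nab_add[OF B nab W(1) Y(1) Z(1) W(2)] linear_add[OF lin(1)] linear_add[OF lin(2)] alg
        algebra_simps)
qed

end


section \<open>Riemannian maps and Lagrangian Riemannian maps\<close>

text \<open>A vector is extended with constant coefficients in a local frame, so one neighbourhood
  \<open>W\<close> serves all vectors at \<open>q\<close>; this allows several extensions to be used
  together.\<close>

lemma distribution_section:
  fixes B :: "('n::{t2_space, second_countable_topology}, 'f::euclidean_space) chart set"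
  assumes B: "smooth_manifold B" and D: "distribution B k D"
  obtains W where "open W" "q \<in> W"
    "\<And>X. X \<in> D q \<Longrightarrow> \<exists>Y. smooth_field_on B W Y \<and> (\<forall>x\<in>W. Y x \<in> D x) \<and> Y q = X"
proof -
  obtain W E where W: "open W" "q \<in> W" "\<And>i. i < k \<Longrightarrow> smooth_field_on B W (E i)"
    and E: "\<And>x. x \<in> W \<Longrightarrow> D x = span ((\<lambda>i. E i x) ` {..<k})"
    using D unfolding distribution_def by metis
  have sub: "subspace (D x)" for x using D by (simp add: distribution_def)
  let ?P = "\<lambda>X. \<exists>Y. smooth_field_on B W Y \<and> (\<forall>x\<in>W. Y x \<in> D x) \<and> Y q = X"
  have "?P X" if "X \<in> D q" for X
    using that unfolding E[OF W(2)]
  proof (induction rule: span_induct)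
    show "subspace (Collect ?P)"
      unfolding subspace_def
    proof (intro conjI ballI allI; clarsimp)
      show "\<exists>Y. smooth_field_on B W Y \<and> (\<forall>x\<in>W. Y x \<in> D x) \<and> Y q = 0"
        using smooth_field_on_zero[OF B W(1)] subspace_0[OF sub] by (intro exI[of _ "\<lambda>x. 0"]) simp
      show "\<exists>Y''. smooth_field_on B W Y'' \<and> (\<forall>x\<in>W. Y'' x \<in> D x) \<and> Y'' q = Y q + Y' q"
        if "smooth_field_on B W Y" "\<forall>x\<in>W. Y x \<in> D x" "smooth_field_on B W Y'" "\<forall>x\<in>W. Y' x \<in> D x"
        for Y Y'
        using that smooth_field_on_add[OF B W(1)] subspace_add[OF sub]
        by (intro exI[of _ "\<lambda>x. Y x + Y' x"]) simp
      show "\<exists>Y'. smooth_field_on B W Y' \<and> (\<forall>x\<in>W. Y' x \<in> D x) \<and> Y' q = c *\<^sub>R Y q"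
        if "smooth_field_on B W Y" "\<forall>x\<in>W. Y x \<in> D x" for c Y
        using that smooth_field_on_const_scaleR[OF B W(1)] subspace_scale[OF sub]
        by (intro exI[of _ "\<lambda>x. c *\<^sub>R Y x"]) simp
    qed
    show "?P X" if X: "X \<in> (\<lambda>i. E i q) ` {..<k}" for X
    proof -
      obtain i where "i < k" "X = E i q" using X by auto
      then show ?thesis using W(3) E by (intro exI[of _ "E i"]) (auto intro: span_base)
    qed
  qed
  then show thesis using that W(1,2) by blast
qed

section \<open>The second fundamental form of a Riemannian map\<close>

context
  fixes A :: "('m::{t2_space, second_countable_topology}, 'e::euclidean_space) chart set"
    and g1 :: "'m \<Rightarrow> 'e \<Rightarrow> 'e \<Rightarrow> real"
    and nab1 :: "('m \<Rightarrow> 'e) \<Rightarrow> 'm \<Rightarrow> 'e \<Rightarrow> 'e"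
    and B :: "('n::{t2_space, second_countable_topology}, 'f::euclidean_space) chart set"
    and g2 :: "'n \<Rightarrow> 'f \<Rightarrow> 'f \<Rightarrow> real"
    and nab2 :: "('n \<Rightarrow> 'f) \<Rightarrow> 'n \<Rightarrow> 'f \<Rightarrow> 'f"
    and F :: "'m \<Rightarrow> 'n"
  assumes M: "riemannian_manifold A g1 nab1"
    and N: "riemannian_manifold B g2 nab2"
    and rm: "riemannian_map A g1 B g2 F"
begin

lemma
  manifolds: "smooth_manifold A" "smooth_manifold B" and
  connections: "affine_connection A nab1" "affine_connection B nab2" and
  torsions: "torsion_free A nab1" "torsion_free B nab2" and
  metrics: "riemannian_metric A g1" "riemannian_metric B g2"
    "metric_connection A g1 nab1" "metric_connection B g2 nab2" and
  smooth_F: "smooth_map_on A B UNIV F"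
  using M N rm by (auto simp: riemannian_manifold_def levi_civita_def riemannian_map_def)

lemmas pf1 = riemannian_metric_pos_form[OF metrics(1)]
lemmas pf2 = riemannian_metric_pos_form[OF metrics(2)]

lemma linear_differential_F: "linear (differential A B F p)"
  by (rule linear_differential[OF manifolds smooth_F UNIV_I])

abbreviation "horizontal p \<equiv> orth_compl (g1 p) (ker_diff A B F p)"

lemma horizontal_decomposition:
  obtains x v where "u = x + v" "x \<in> horizontal p" "v \<in> ker_diff A B F p"
proof -
  have "subspace (ker_diff A B F p)"
    using linear_subspace_kernel[OF linear_differential_F] by (simp add: ker_diff_def)
  then show thesis using orthogonal_decomposition[OF pf1] that by (metis add.commute)
qed

text \<open>The vertical part of \<open>w\<close> is killed by the differential and is orthogonal to
  \<open>z\<close>, so one horizontal argument is enough.\<close>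

lemma metric_differential_horizontal:
  assumes "z \<in> horizontal p"
  shows "g2 (F p) (differential A B F p w) (differential A B F p z) = g1 p w z"
proof -
  obtain x v where xv: "w = x + v" "x \<in> horizontal p" "v \<in> ker_diff A B F p"
    by (rule horizontal_decomposition)
  have "g1 p v z = 0" using assms xv(3) by (simp add: orth_compl_def)
  moreover have "differential A B F p w = differential A B F p x"
    using xv(1,3) linear_add[OF linear_differential_F] by (simp add: ker_diff_def)
  moreover have "g2 (F p) (differential A B F p x) (differential A B F p z) = g1 p x z"
    using rm xv(2) assms by (auto simp: riemannian_map_def)
  ultimately show ?thesis using xv(1) by (simp add: pf_algebra[OF pf1])
qed

text \<open>The differential is an orthogonal projection followed by an isometry. The inequality is
  the source of the minimum at \<open>p\<close> that replaces horizontal extensions.\<close>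

lemma metric_differential_le:
  "g2 (F p) (differential A B F p w) (differential A B F p w) \<le> g1 p w w"
proof -
  obtain x v where xv: "w = x + v" "x \<in> horizontal p" "v \<in> ker_diff A B F p"
    by (rule horizontal_decomposition)
  have 0: "g1 p v x = 0" "g1 p x v = 0"
    using xv(2,3) pf_sym[OF pf1, of p v x] by (simp_all add: orth_compl_def)
  have "differential A B F p w = differential A B F p x"
    using xv(1,3) linear_add[OF linear_differential_F] by (simp add: ker_diff_def)
  then have "g2 (F p) (differential A B F p w) (differential A B F p w) = g1 p x x"
    using metric_differential_horizontal[OF xv(2)] by simp
  also have "\<dots> \<le> g1 p w w" using xv(1) 0 pf_nonneg[OF pf1, of p v] by (simp add: pf_algebra[OF pf1])
  finally show ?thesis .
qed

lemma metric_defect_derivative: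
  assumes "open U" "p \<in> U" "smooth_field_on A U X" "smooth_field_on A U Y"
  shows "has_mderiv A (\<lambda>q. g1 q (X q) (Y q) - g2 (F q) (differential A B F q (X q)) (differential A B F q (Y q))) p
    (\<lambda>v. (g1 p (nab1 X p v) (Y p) + g1 p (X p) (nab1 Y p v)) -
      (g2 (F p) (pullback_conn A B nab2 F (\<lambda>q. differential A B F q (X q)) p v) (differential A B F p (Y p)) +
       g2 (F p) (differential A B F p (X p)) (pullback_conn A B nab2 F (\<lambda>q. differential A B F q (Y q)) p v)))"
proof (intro has_mderiv_diff)
  note A = manifolds(1) and B = manifolds(2)
  \<comment> \<open>A field on M is a section along the identity map, so the product rule along maps
    serves for both metrics.\<close>
  note id = section_diff_field[OF A A connections(1) smooth_map_id[OF A] open_UNIV UNIV_I assms(1,2)]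
  show "has_mderiv A (\<lambda>q. g1 q (X q) (Y q)) p (\<lambda>v. g1 p (nab1 X p v) (Y p) + g1 p (X p) (nab1 Y p v))"
    using has_mderiv_metric[OF A A connections(1) smooth_map_id[OF A] open_UNIV UNIV_I metrics(1,3)
        id(1)[OF assms(3)] id(1)[OF assms(4)]]
    by (simp add: id(2)[OF assms(3)] id(2)[OF assms(4)] differential_id[OF A])
  show "has_mderiv A (\<lambda>q. g2 (F q) (differential A B F q (X q)) (differential A B F q (Y q))) p
    (\<lambda>v. g2 (F p) (pullback_conn A B nab2 F (\<lambda>q. differential A B F q (X q)) p v) (differential A B F p (Y p)) +
       g2 (F p) (differential A B F p (X p)) (pullback_conn A B nab2 F (\<lambda>q. differential A B F q (Y q)) p v))"
    using assms by (intro has_mderiv_metric[OF A B connections(2) smooth_F open_UNIV UNIV_I metrics(2,4)]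
        section_diff_differential[OF A B smooth_F open_UNIV _ _ _ UNIV_I])
qed

text \<open>
  \<open>g\<^sub>1(X, X) - |F\<^sub>* X|\<^sup>2\<close> is nonnegative and vanishes at \<open>p\<close>, so its derivative there is zero;
  polarization replaces an extension of \<open>X p\<close>, \<open>Y p\<close> to horizontal fields.
\<close>

lemma second_ff_skew:
  assumes U: "open U" "p \<in> U" and X: "smooth_field_on A U X" "X p \<in> horizontal p"
    and Y: "smooth_field_on A U Y" "Y p \<in> horizontal p" and Z: "Z p = v"
  shows "g2 (F p) (second_ff A nab1 B nab2 F Z X p) (differential A B F p (Y p)) +
    g2 (F p) (differential A B F p (X p)) (second_ff A nab1 B nab2 F Z Y p) = 0"
proof -
  note A = manifolds(1)
  let ?D = "differential A B F"
  define \<Phi> where "\<Phi> = (\<lambda>V V' q. g1 q (V q) (V' q) - g2 (F q) (?D q (V q)) (?D q (V' q)))"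
  have 0: "has_mderiv A (\<Phi> V V) p (\<lambda>v. 0)" if V: "smooth_field_on A U V" "V p \<in> horizontal p" for V
  proof -
    obtain L where L: "has_mderiv A (\<Phi> V V) p L"
      unfolding \<Phi>_def using metric_defect_derivative[OF U V(1) V(1)] by blast
    have "\<Phi> V V p = 0" using metric_differential_horizontal[OF V(2)] by (simp add: \<Phi>_def)
    then have "L v = 0" for v
      using metric_differential_le by (intro has_mderiv_min[OF A U _ L]) (simp add: \<Phi>_def)
    then have "L = (\<lambda>v. 0)" by blast
    with L show ?thesis by simp
  qed
  let ?S = "\<lambda>q. X q + Y q"
  have S: "smooth_field_on A U ?S" "?S p \<in> horizontal p"
    using X Y smooth_field_on_add[OF A U(1)] by (auto simp: orth_compl_def pf_algebra[OF pf1])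
  have "has_mderiv A (\<lambda>q. (1/2) * ((\<Phi> ?S ?S q - \<Phi> X X q) - \<Phi> Y Y q)) p (\<lambda>v. (1/2) * ((0 - 0) - 0))"
    by (intro has_mderiv_mult_left has_mderiv_diff 0 S X Y)
  moreover have "(\<lambda>q. (1/2) * ((\<Phi> ?S ?S q - \<Phi> X X q) - \<Phi> Y Y q)) = \<Phi> X Y"
  proof
    fix q
    show "(1/2) * ((\<Phi> ?S ?S q - \<Phi> X X q) - \<Phi> Y Y q) = \<Phi> X Y q"
      using pf_sym[OF pf1, of q "Y q" "X q"] pf_sym[OF pf2, of "F q" "?D q (Y q)" "?D q (X q)"]
      by (simp add: \<Phi>_def linear_add[OF linear_differential_F] pf_algebra[OF pf1] pf_algebra[OF pf2])
  qed
  ultimately have "has_mderiv A (\<Phi> X Y) p (\<lambda>v. 0)" by simp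
  from has_mderiv_unique[OF this[unfolded \<Phi>_def] metric_defect_derivative[OF U X(1) Y(1)]]
  have "(g1 p (nab1 X p v) (Y p) + g1 p (X p) (nab1 Y p v)) -
      (g2 (F p) (pullback_conn A B nab2 F (\<lambda>q. ?D q (X q)) p v) (?D p (Y p)) +
       g2 (F p) (?D p (X p)) (pullback_conn A B nab2 F (\<lambda>q. ?D q (Y q)) p v)) = 0" by metis
  \<comment> \<open>Horizontality at \<open>p\<close> moves the \<open>g1\<close> terms to the
    target, where they become the subtracted parts of \<open>second_ff\<close>.\<close>
  moreover have "g1 p (nab1 X p v) (Y p) = g2 (F p) (?D p (nab1 X p v)) (?D p (Y p))"
    using metric_differential_horizontal[OF Y(2)] by simp
  moreover have "g1 p (X p) (nab1 Y p v) = g2 (F p) (?D p (X p)) (?D p (nab1 Y p v))"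
    using metric_differential_horizontal[OF X(2)] pf_sym[OF pf1, of p "X p"] pf_sym[OF pf2, of "F p" "?D p (X p)"]
    by simp
  ultimately show ?thesis
    using Z by (simp add: second_ff_def pf_algebra[OF pf2])
qed

text \<open>The Koszul pattern: the trilinear expression <S(Z, X), Y> is symmetric in Z, X and skew
  in X, Y. Hence <S(X, X), Z> = - <X, S(X, Z)> = - <X, S(Z, X)>, and the last term is zero by
  skewness with both entries X.\<close>

lemma second_ff_orthogonal_range:
  assumes U: "open U" "p \<in> U" and X: "smooth_field_on A U X" "X p \<in> horizontal p"
  shows "g2 (F p) (second_ff A nab1 B nab2 F X X p) (differential A B F p w) = 0"
proof -
  note A = manifolds(1)
  obtain z v where zv: "w = z + v" "z \<in> horizontal p" "v \<in> ker_diff A B F p"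
    by (rule horizontal_decomposition)
  let ?c = "chart_at A p"
  define V where "V = U \<inter> fst ?c"
  \<comment> \<open>A coordinate field with value \<open>z\<close> at \<open>p\<close>; it is
    horizontal only at \<open>p\<close>, which is all that \<open>second_ff_skew\<close>
    asks.\<close>
  define Z where "Z = (\<lambda>q. of_chart A ?c q z)"
  have V: "open V" "p \<in> V" using U chart_at[OF A] open_chart[OF is_chart_at[OF A]] by (auto simp: V_def)
  have Z: "smooth_field_on A V Z" "Z p \<in> horizontal p" "Z p = z"
    using smooth_field_on_subset[OF A smooth_field_on_coord_field[OF A chart_at(1)[OF A]]] zv(2)
    by (auto simp: Z_def V_def of_chart_at[OF A])
  have X': "smooth_field_on A V X" using smooth_field_on_subset[OF A X(1)] by (simp add: V_def)
  let ?S = "second_ff A nab1 B nab2 F" and ?D = "differential A B F p"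
  have "g2 (F p) (?S X X p) (?D z) + g2 (F p) (?D (X p)) (?S X Z p) = 0"
    using second_ff_skew[OF V X' X(2) Z(1,2), of X "X p"] Z(3) by simp
  moreover have "?S X Z p = ?S Z X p"
    using second_ff_symmetric[OF manifolds smooth_F torsions(1) connections(2) torsions(2) V X' Z(1)] by simp
  moreover have "g2 (F p) (?S Z X p) (?D (X p)) + g2 (F p) (?D (X p)) (?S Z X p) = 0"
    using second_ff_skew[OF V X' X(2) X' X(2), of Z "Z p"] by simp
  moreover have "g2 (F p) (?S Z X p) (?D (X p)) = g2 (F p) (?D (X p)) (?S Z X p)" by (rule pf_sym[OF pf2])
  moreover have "?D w = ?D z" using zv linear_add[OF linear_differential_F] by (simp add: ker_diff_def)
  ultimately show ?thesis by simp
qed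

end

section \<open>The cubic form of a Lagrangian Riemannian map\<close>

context
  fixes A :: "('m::{t2_space, second_countable_topology}, 'e::euclidean_space) chart set"
    and g1 :: "'m \<Rightarrow> 'e \<Rightarrow> 'e \<Rightarrow> real"
    and nab1 :: "('m \<Rightarrow> 'e) \<Rightarrow> 'm \<Rightarrow> 'e \<Rightarrow> 'e"
    and B :: "('n::{t2_space, second_countable_topology}, 'f::euclidean_space) chart set"
    and g2 :: "'n \<Rightarrow> 'f \<Rightarrow> 'f \<Rightarrow> real"
    and nab2 :: "('n \<Rightarrow> 'f) \<Rightarrow> 'n \<Rightarrow> 'f \<Rightarrow> 'f"
    and J :: "'n \<Rightarrow> 'f \<Rightarrow> 'f"
    and F :: "'m \<Rightarrow> 'n"
    and D :: "'n \<Rightarrow> 'f set"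
  assumes M: "riemannian_manifold A g1 nab1"
    and K: "kaehler_manifold B g2 nab2 J"
    and rm: "riemannian_map A g1 B g2 F"
    and D: "range_distribution A B F D"
    and lag: "lagrangian A B g2 J F"
begin

lemma target_riemannian: "riemannian_manifold B g2 nab2"
  using K by (simp add: kaehler_manifold_def)

lemma J_linear: "linear (J q)" and J_J: "J q (J q u) = - u" and J_isometry: "g2 q (J q u) (J q v) = g2 q u v"
  using K unfolding kaehler_manifold_def by blast+

lemma J_smooth: "open W \<Longrightarrow> smooth_field_on B W Y \<Longrightarrow> smooth_field_on B W (\<lambda>q. J q (Y q))"
  and J_parallel: "open W \<Longrightarrow> smooth_field_on B W Y \<Longrightarrow> q \<in> W \<Longrightarrow> nab2 (\<lambda>x. J x (Y x)) q v = J q (nab2 Y q v)"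
  using K unfolding kaehler_manifold_def by blast+

lemmas source_smooth = manifolds(1)[OF M target_riemannian rm] and target_smooth = manifolds(2)[OF M target_riemannian rm]
lemmas F_smooth = smooth_F[OF M target_riemannian rm]
lemmas pfN = pf2[OF M target_riemannian rm]
lemmas algN = pf_algebra[OF pfN]

lemma J_adjoint: "g2 q (J q u) v = - g2 q u (J q v)"
  using J_isometry[of q "J q u" v] by (simp add: J_J algN)

lemma D_subspace: "subspace (D q)"
  using D by (auto simp: range_distribution_def distribution_def)

lemma D_range: "D (F p) = range (differential A B F p)"
  using D by (simp add: range_distribution_def range_diff_def)

lemma J_orthogonal: "u \<in> D (F p) \<Longrightarrow> v \<in> D (F p) \<Longrightarrow> g2 (F p) u (J (F p) v) = 0"
  using lag D by (auto simp: lagrangian_def anti_invariant_def orth_compl_def range_distribution_def)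

lemma J_surj: "v \<in> orth_compl (g2 (F p)) (D (F p)) \<Longrightarrow> \<exists>z\<in>D (F p). v = J (F p) z"
  using lag D unfolding lagrangian_def range_distribution_def by (metis imageE)

lemma J_orth_compl: "z \<in> D (F p) \<Longrightarrow> J (F p) z \<in> orth_compl (g2 (F p)) (D (F p))"
  using J_orthogonal by (simp add: orth_compl_def)

text \<open>Y is orthogonal to J Z over the image of F, so this product, as a function on M, has
  zero derivative. J passes through the connection and moves to the other factor with a minus sign.
  This transposes the last two slots of the cubic form.\<close>

lemma shape_swap:
  assumes W: "open W" "F p \<in> W" and Y: "smooth_field_on B W Y" "\<And>x. x \<in> W \<Longrightarrow> Y x \<in> D x"
    and Z: "smooth_field_on B W Z" "\<And>x. x \<in> W \<Longrightarrow> Z x \<in> D x" and X: "X \<in> D (F p)"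
  shows "g2 (F p) (nab2 Y (F p) X) (J (F p) (Z (F p))) = g2 (F p) (nab2 Z (F p) X) (J (F p) (Y (F p)))"
proof -
  obtain w where w: "X = differential A B F p w" using X D_range by auto
  note sf = section_diff_field[OF source_smooth target_smooth connections(2)[OF M target_riemannian rm] F_smooth open_UNIV UNIV_I W]
  have 1: "has_mderiv A (\<lambda>q. g2 (F q) (Y (F q)) (J (F q) (Z (F q)))) p
     (\<lambda>v. g2 (F p) (nab2 Y (F p) (differential A B F p v)) (J (F p) (Z (F p))) +
        g2 (F p) (Y (F p)) (J (F p) (nab2 Z (F p) (differential A B F p v))))"
    using has_mderiv_metric[OF source_smooth target_smooth connections(2)[OF M target_riemannian rm] F_smooth open_UNIV UNIV_I metrics(2,4)[OF M target_riemannian rm]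
        sf(1)[OF Y(1)] sf(1)[OF J_smooth[OF W(1) Z(1)]]]
    by (simp add: sf(2)[OF Y(1)] sf(2)[OF J_smooth[OF W(1) Z(1)]] J_parallel[OF W(1) Z(1) W(2)])
  have 2: "has_mderiv A (\<lambda>q. g2 (F q) (Y (F q)) (J (F q) (Z (F q)))) p (\<lambda>v. 0)"
  proof (rule has_mderiv_cong[OF source_smooth _ _ _ has_mderiv_const])
    show "open (F -` W)"
      using continuous_on_open_vimage[of UNIV F] smooth_map_on_continuous_on[OF F_smooth] W(1) by simp
    show "0 = g2 (F q) (Y (F q)) (J (F q) (Z (F q)))" if "q \<in> F -` W" for q
      using J_orthogonal Y(2) Z(2) that by simp
  qed (use W in auto)
  have "g2 (F p) (nab2 Y (F p) X) (J (F p) (Z (F p))) +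
        g2 (F p) (Y (F p)) (J (F p) (nab2 Z (F p) X)) = 0"
    unfolding w using fun_cong[OF has_mderiv_unique[OF 1 2], of w] .
  then show ?thesis
    using J_adjoint[of "F p" "Y (F p)"] pf_sym[OF pfN, of "F p" "nab2 Z (F p) X"] by simp
qed

text \<open>The computation of \<open>shape_swap\<close> with the image of a field on M in place of
  \<open>Y\<close>; such an image need not be the restriction of a field on N, hence the pullback
  connection.\<close>

lemma pullback_normal_part:
  assumes W: "open W" "F p \<in> W" and Z: "smooth_field_on B W Z" "\<And>x. x \<in> W \<Longrightarrow> Z x \<in> D x"
    and U: "open U" "p \<in> U" "smooth_field_on A U X"
  shows "g2 (F p) (pullback_conn A B nab2 F (\<lambda>q. differential A B F q (X q)) p w) (J (F p) (Z (F p))) =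
    g2 (F p) (nab2 Z (F p) (differential A B F p w)) (J (F p) (differential A B F p (X p)))"
proof -
  let ?X = "\<lambda>q. differential A B F q (X q)"
  note sf = section_diff_field[OF source_smooth target_smooth connections(2)[OF M target_riemannian rm] F_smooth open_UNIV UNIV_I W]
  have 1: "has_mderiv A (\<lambda>q. g2 (F q) (?X q) (J (F q) (Z (F q)))) p
     (\<lambda>v. g2 (F p) (pullback_conn A B nab2 F ?X p v) (J (F p) (Z (F p))) +
        g2 (F p) (?X p) (J (F p) (nab2 Z (F p) (differential A B F p v))))"
    using has_mderiv_metric[OF source_smooth target_smooth connections(2)[OF M target_riemannian rm] F_smooth open_UNIV UNIV_I metrics(2,4)[OF M target_riemannian rm]
        section_diff_differential[OF source_smooth target_smooth F_smooth open_UNIV U UNIV_I] sf(1)[OF J_smooth[OF W(1) Z(1)]]]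
    by (simp add: sf(2)[OF J_smooth[OF W(1) Z(1)]] J_parallel[OF W(1) Z(1) W(2)])
  have 2: "has_mderiv A (\<lambda>q. g2 (F q) (?X q) (J (F q) (Z (F q)))) p (\<lambda>v. 0)"
  proof (rule has_mderiv_cong[OF source_smooth _ _ _ has_mderiv_const])
    show "open (F -` W)"
      using continuous_on_open_vimage[of UNIV F] smooth_map_on_continuous_on[OF F_smooth] W(1) by simp
    show "0 = g2 (F q) (?X q) (J (F q) (Z (F q)))" if "q \<in> F -` W" for q
      using J_orthogonal[of "?X q" q "Z (F q)"] D_range[of q] Z(2)[of "F q"] that by simp
  qed (use W in auto)
  have "g2 (F p) (pullback_conn A B nab2 F ?X p w) (J (F p) (Z (F p))) +
        g2 (F p) (?X p) (J (F p) (nab2 Z (F p) (differential A B F p w))) = 0"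
    by (rule fun_cong[OF has_mderiv_unique[OF 1 2]])
  then show ?thesis
    using J_adjoint[of "F p" "?X p"] pf_sym[OF pfN, of "F p" "nab2 Z (F p) (differential A B F p w)"] by simp
qed

text \<open>Both sides are the component along J Z of the second fundamental form of F at preimages
  of X and Y, so its symmetry transposes the outer slots. The bracket is taken on M, which avoids
  any integrability of \<open>D\<close>.\<close>

lemma shape_symmetric:
  assumes W: "open W" "F p \<in> W" and Z: "smooth_field_on B W Z" "\<And>x. x \<in> W \<Longrightarrow> Z x \<in> D x"
    and X: "X \<in> D (F p)" and Y: "Y \<in> D (F p)"
  shows "g2 (F p) (nab2 Z (F p) X) (J (F p) Y) = g2 (F p) (nab2 Z (F p) Y) (J (F p) X)"
proof -
  obtain x y where xy: "X = differential A B F p x" "Y = differential A B F p y" using X Y D_range by auto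
  let ?c = "chart_at A p" and ?S = "second_ff A nab1 B nab2 F" and ?D = "differential A B F"
  define E where "E = (\<lambda>u q. of_chart A ?c q u)"
  have U: "open (fst ?c)" "p \<in> fst ?c" using chart_at[OF source_smooth] open_chart[OF is_chart_at[OF source_smooth]] by auto
  have E: "smooth_field_on A (fst ?c) (E u)" "E u p = u" for u
    using smooth_field_on_coord_field[OF source_smooth chart_at(1)[OF source_smooth]] by (auto simp: E_def of_chart_at[OF source_smooth])
  let ?JZ = "J (F p) (Z (F p))"
  \<comment> \<open>The subtracted term of \<open>second_ff\<close> lies in the range, so it is
    orthogonal to \<open>?JZ\<close> by anti-invariance.\<close>
  have S: "g2 (F p) (?S (E u) (E v) p) ?JZ = g2 (F p) (nab2 Z (F p) (?D p u)) (J (F p) (?D p v))" for u v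
    using pullback_normal_part[OF W Z U E(1), of v u] J_orthogonal[of "?D p (nab1 (E v) p u)" p "Z (F p)"]
      D_range[of p] Z(2)[OF W(2)] by (simp add: second_ff_def algN E(2))
  have "?S (E x) (E y) p = ?S (E y) (E x) p"
    using second_ff_symmetric[OF source_smooth target_smooth F_smooth torsions(1)[OF M target_riemannian rm] connections(2)[OF M target_riemannian rm]
        torsions(2)[OF M target_riemannian rm] U E(1) E(1), of x y] by simp
  then show ?thesis using S[of x y] S[of y x] by (simp add: xy)
qed

context
  fixes f :: "'n \<Rightarrow> real"
  assumes f: "smooth_fun_on B UNIV f"
    and cl: "clairaut B g2 nab2 D (\<lambda>q. exp (f q))"
begin

text \<open>The two transpositions combine to symmetry in \<open>X\<close> and \<open>Y\<close>, so
  the two terms on the left of \<open>clairaut_umbilical\<close> coincide and each is half of the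
  right-hand side.\<close>

lemma shape_umbilical:
  assumes W: "open W" "F p \<in> W"
    and X: "smooth_field_on B W X" "\<And>x. x \<in> W \<Longrightarrow> X x \<in> D x"
    and Y: "smooth_field_on B W Y" "\<And>x. x \<in> W \<Longrightarrow> Y x \<in> D x"
    and Z: "smooth_field_on B W Z" "\<And>x. x \<in> W \<Longrightarrow> Z x \<in> D x"
  shows "g2 (F p) (nab2 Y (F p) (X (F p))) (J (F p) (Z (F p))) =
    - (dfun B f (F p) (J (F p) (Z (F p))) * g2 (F p) (X (F p)) (Y (F p)))"
proof -
  let ?C = "\<lambda>X Y Z. g2 (F p) (nab2 Y (F p) (X (F p))) (J (F p) (Z (F p)))"
  have "?C X Y Z = ?C X Z Y" by (rule shape_swap[OF W Y Z X(2)[OF W(2)]])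
  also have "\<dots> = ?C Y Z X" by (rule shape_symmetric[OF W Z X(2)[OF W(2)] Y(2)[OF W(2)]])
  also have "\<dots> = ?C Y X Z" by (rule shape_swap[OF W Z X Y(2)[OF W(2)]])
  finally have "?C X Y Z = ?C Y X Z" .
  moreover have "?C X Y Z + ?C Y X Z = - (2 * dfun B f (F p) (J (F p) (Z (F p))) * g2 (F p) (X (F p)) (Y (F p)))"
    using clairaut_umbilical[OF target_riemannian D_subspace f cl W J_orth_compl[OF Z(2)[OF W(2)]] Y X]
      pf_sym[OF pfN, of "F p" "J (F p) (Z (F p))"] pf_sym[OF pfN, of "F p" "Y (F p)"] by simp
  ultimately show ?thesis by simp
qed

lemma dfun_normal_zero:
  assumes dim: "1 < dim (D (F p))" and z: "z \<in> D (F p)"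
  shows "dfun B f (F p) (J (F p) z) = 0"
proof (cases "z = 0")
  case True
  have "linear (dfun B f (F p))" by (rule has_mderiv_linear[OF has_mderiv_dfun[OF target_smooth f UNIV_I]])
  then show ?thesis using True by (simp add: linear_0[OF J_linear] linear_0)
next
  case False
  let ?q = "F p"
  \<comment> \<open>The rank condition supplies a direction outside the line of \<open>z\<close>;
    its part orthogonal to \<open>z\<close> is the nonzero test vector \<open>v\<close>.\<close>
  have "\<not> D ?q \<subseteq> span {z}"
    using dim dim_subset[of "D ?q" "span {z}"] dim_le_card'[of "{z}"] by auto
  then obtain y where y: "y \<in> D ?q" "y \<notin> span {z}" by blast
  obtain x v where xv: "x \<in> span {z}" "v \<in> orth_compl (g2 ?q) (span {z})" "y = x + v"
    by (rule orthogonal_decomposition[OF pfN subspace_span])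
  have v0: "v \<noteq> 0" using xv y(2) by auto
  have "span {z} \<subseteq> D ?q" using z D_subspace by (simp add: span_minimal)
  then have "x \<in> D ?q" using xv(1) by blast
  then have v: "v \<in> D ?q" using subspace_diff[OF D_subspace y(1)] xv(3) by fastforce
  have vz: "g2 ?q v z = 0"
    using xv(2) span_base[of z "{z}"] pf_sym[OF pfN, of ?q v z] by (simp add: orth_compl_def)
  obtain k where "distribution B k D" using D by (auto simp: range_distribution_def)
  then obtain W where W: "open W" "?q \<in> W"
    "\<And>X. X \<in> D ?q \<Longrightarrow> \<exists>Y. smooth_field_on B W Y \<and> (\<forall>x\<in>W. Y x \<in> D x) \<and> Y ?q = X"
    using distribution_section[OF target_smooth] by metis
  obtain V where V: "smooth_field_on B W V" "\<And>x. x \<in> W \<Longrightarrow> V x \<in> D x" "V ?q = v" using W(3)[OF v] by blast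
  obtain Z where Z: "smooth_field_on B W Z" "\<And>x. x \<in> W \<Longrightarrow> Z x \<in> D x" "Z ?q = z" using W(3)[OF z] by blast
  \<comment> \<open>By \<open>shape_umbilical\<close> the left side is - df(J z) |v|^2, while the
    right side is a multiple of <v, z> = 0.\<close>
  have "g2 ?q (nab2 V ?q (V ?q)) (J ?q (Z ?q)) = g2 ?q (nab2 Z ?q (V ?q)) (J ?q (V ?q))"
    by (rule shape_swap[OF W(1,2) V(1,2) Z(1,2) V(2)[OF W(2)]])
  then have "dfun B f ?q (J ?q z) * g2 ?q v v = 0"
    using shape_umbilical[OF W(1,2) V(1,2) V(1,2) Z(1,2)] shape_umbilical[OF W(1,2) V(1,2) Z(1,2) V(1,2)]
    by (simp add: V(3) Z(3) vz)
  then show ?thesis using pf_eq_0[OF pfN] v0 by auto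
qed

context
  assumes dim: "\<And>p. dim (D (F p)) > 1"
begin

text \<open>Direction and normal are vectors at one point here; they are extended to sections on a
  common neighbourhood so that \<open>shape_umbilical\<close> applies, whose right-hand side
  vanishes by \<open>dfun_normal_zero\<close>.\<close>

lemma shape_zero:
  assumes W: "open W" "F p \<in> W"
    and Y: "smooth_field_on B W Y" "\<And>x. x \<in> W \<Longrightarrow> Y x \<in> D x"
    and X: "X \<in> D (F p)" and Z: "Z \<in> D (F p)"
  shows "g2 (F p) (nab2 Y (F p) X) (J (F p) Z) = 0"
proof -
  let ?q = "F p"
  obtain k where "distribution B k D" using D by (auto simp: range_distribution_def)
  then obtain W' where W': "open W'" "?q \<in> W'"
    "\<And>X. X \<in> D ?q \<Longrightarrow> \<exists>Y. smooth_field_on B W' Y \<and> (\<forall>x\<in>W'. Y x \<in> D x) \<and> Y ?q = X"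
    using distribution_section[OF target_smooth] by metis
  let ?W = "W \<inter> W'"
  have WW: "open ?W" "?q \<in> ?W" using W W' by auto
  obtain SX where SX: "smooth_field_on B ?W SX" "\<And>x. x \<in> ?W \<Longrightarrow> SX x \<in> D x" "SX ?q = X"
    using W'(3)[OF X] smooth_field_on_subset[OF target_smooth] by (metis Int_iff Int_lower2)
  obtain SZ where SZ: "smooth_field_on B ?W SZ" "\<And>x. x \<in> ?W \<Longrightarrow> SZ x \<in> D x" "SZ ?q = Z"
    using W'(3)[OF Z] smooth_field_on_subset[OF target_smooth] by (metis Int_iff Int_lower2)
  have Y': "smooth_field_on B ?W Y" "\<And>x. x \<in> ?W \<Longrightarrow> Y x \<in> D x"
    using Y smooth_field_on_subset[OF target_smooth Y(1)] by auto
  show ?thesis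
    using shape_umbilical[OF WW SX(1,2) Y' SZ(1,2)] dfun_normal_zero[OF dim Z] by (simp add: SX(3) SZ(3))
qed

text \<open>Over the image every normal vector has the form J z with z in the range, so
  \<open>shape_zero\<close> makes the normal part of the derivative orthogonal to itself.\<close>

lemma range_totally_geodesic: "totally_geodesic_over B nab2 (range F) D"
  unfolding totally_geodesic_over_def
proof (intro allI impI ballI)
  fix W U V q
  assume *: "open W \<and> smooth_field_on B W U \<and> smooth_field_on B W V \<and> (\<forall>x\<in>W. U x \<in> D x \<and> V x \<in> D x)"
    and "q \<in> W \<inter> range F"
  then obtain p where p: "q = F p" "F p \<in> W" by auto
  obtain x v where xv: "x \<in> D (F p)" "v \<in> orth_compl (g2 (F p)) (D (F p))" "nab2 V q (U q) = x + v"
    by (rule orthogonal_decomposition[OF pfN D_subspace])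
  obtain z where z: "z \<in> D (F p)" "v = J (F p) z" using J_surj[OF xv(2)] by blast
  have "g2 (F p) (nab2 V q (U q)) v = 0"
    unfolding z(2) p(1) using * p(2) by (intro shape_zero[of W] z(1)) auto
  moreover have "g2 (F p) x v = 0" using xv(1,2) by (simp add: orth_compl_def)
  ultimately have "v = 0" using xv(3) pf_eq_0[OF pfN] by (simp add: algN)
  then show "nab2 V q (U q) \<in> D q" using xv p by simp
qed

text \<open>The part along the range vanishes by the Koszul pattern; the normal part is J z for some
  z in the range, and \<open>pullback_normal_part\<close> rewrites its product with
  \<open>second_ff\<close> as a value of the vanishing cubic form.\<close>

lemma second_ff_zero:
  assumes U: "open U" "p \<in> U" and X: "smooth_field_on A U X" "X p \<in> orth_compl (g1 p) (ker_diff A B F p)"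
  shows "second_ff A nab1 B nab2 F X X p = 0"
proof -
  let ?q = "F p" and ?S = "second_ff A nab1 B nab2 F X X p"
  obtain x v where xv: "x \<in> D ?q" "v \<in> orth_compl (g2 ?q) (D ?q)" "?S = x + v"
    by (rule orthogonal_decomposition[OF pfN D_subspace])
  obtain z where z: "z \<in> D ?q" "v = J ?q z" using J_surj[OF xv(2)] by blast
  obtain k where "distribution B k D" using D by (auto simp: range_distribution_def)
  then obtain W where W: "open W" "?q \<in> W"
    "\<And>X. X \<in> D ?q \<Longrightarrow> \<exists>Y. smooth_field_on B W Y \<and> (\<forall>x\<in>W. Y x \<in> D x) \<and> Y ?q = X"
    using distribution_section[OF target_smooth] by metis
  obtain Z where Z: "smooth_field_on B W Z" "\<And>x. x \<in> W \<Longrightarrow> Z x \<in> D x" "Z ?q = z" using W(3)[OF z(1)] by blast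
  have inD: "differential A B F p w \<in> D ?q" for w using D_range by blast
  have "g2 ?q ?S v = 0"
    using pullback_normal_part[OF W(1,2) Z(1,2) U X(1), of "X p"] shape_zero[OF W(1,2) Z(1,2) inD inD]
      J_orthogonal[OF inD z(1)]
    by (simp add: second_ff_def algN Z(3) z(2))
  moreover obtain w where "x = differential A B F p w" using xv(1) D_range by auto
  then have "g2 ?q ?S x = 0" using second_ff_orthogonal_range[OF M target_riemannian rm U X] by simp
  ultimately have "g2 ?q ?S ?S = 0" by (subst (2) xv(3)) (simp add: algN)
  then show ?thesis by (rule pf_eq_0[OF pfN])
qed

text \<open>Every summand of the mean curvature vanishes separately, since each frame vector is
  horizontal at \<open>p\<close>.\<close>

lemma range_minimal: "minimal_range A g1 nab1 B nab2 F r"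
  unfolding minimal_range_def
proof (intro allI impI)
  fix W X p
  assume *: "open W \<and> p \<in> W \<and> (\<forall>j\<in>{r+1..DIM('e)}. smooth_field_on A W (X j)) \<and>
      orthonormal_basis (g1 p) (orth_compl (g1 p) (ker_diff A B F p)) {r+1..DIM('e)} (\<lambda>j. X j p)"
  then have span: "span ((\<lambda>j. X j p) ` {r+1..DIM('e)}) = orth_compl (g1 p) (ker_diff A B F p)"
    by (simp only: orthonormal_basis_def)
  have "X j p \<in> orth_compl (g1 p) (ker_diff A B F p)" if "j \<in> {r+1..DIM('e)}" for j
    unfolding span[symmetric] by (rule span_base[OF imageI[OF that]])
  then have "second_ff A nab1 B nab2 F (X j) (X j) p = 0" if "j \<in> {r+1..DIM('e)}" for j
    using * that by (intro second_ff_zero[of W]) auto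
  then show "mean_curvature A nab1 B nab2 F r X p = 0" by (simp add: mean_curvature_def)
qed

end

end

end

theorem theorem5p6:
  fixes A :: "('m::{t2_space, second_countable_topology}, 'e::euclidean_space) chart set"
    and g1 :: "'m \<Rightarrow> 'e \<Rightarrow> 'e \<Rightarrow> real"
    and nab1 :: "('m \<Rightarrow> 'e) \<Rightarrow> 'm \<Rightarrow> 'e \<Rightarrow> 'e"
    and B :: "('n::{t2_space, second_countable_topology}, 'f::euclidean_space) chart set"
    and g2 :: "'n \<Rightarrow> 'f \<Rightarrow> 'f \<Rightarrow> real"
    and nab2 :: "('n \<Rightarrow> 'f) \<Rightarrow> 'n \<Rightarrow> 'f \<Rightarrow> 'f"
    and J :: "'n \<Rightarrow> 'f \<Rightarrow> 'f"
    and F :: "'m \<Rightarrow> 'n"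
    and D :: "'n \<Rightarrow> 'f set"
    and s g :: "'n \<Rightarrow> real"
    and r :: nat
  assumes "riemannian_manifold A g1 nab1"
    and "kaehler_manifold B g2 nab2 J"
    and "riemannian_map A g1 B g2 F"
    and "\<And>p. dim (ker_diff A B F p) = r"
    and "range_distribution A B F D"
    and "lagrangian A B g2 J F"
    and "smooth_fun_on B UNIV g"
    and "\<And>q. s q = exp (g q)"
    and "clairaut B g2 nab2 D s"
    and "totally_geodesic_over B nab2 (range F) (\<lambda>q. orth_compl (g2 q) (D q))"
    and "\<And>p. dim (range_diff A B F p) > 1"
  shows "minimal_range A g1 nab1 B nab2 F r \<and> totally_geodesic_over B nab2 (range F) D"
proof -
  have "s = (\<lambda>q. exp (g q))" using assms(8) by blast
  then have cl: "clairaut B g2 nab2 D (\<lambda>q. exp (g q))" using assms(9) by simp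
  have dim: "1 < dim (D (F p))" for p using assms(5,11) by (simp add: range_distribution_def)
  show ?thesis
    using range_minimal[OF assms(1,2,3,5,6,7) cl dim] range_totally_geodesic[OF assms(1,2,3,5,6,7) cl dim]
    by blast
qed

end
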